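(* (Simplification Algorithm.) Let $K$ be a simplicial set, let $n\ge 2$, $r\ge 0$ and $0\le \ell\le n-2$ be integers, and let $h:C_*(K^{\times n})\to C_*(K)^{\otimes n}$ be a morphism of degree $r$ whose normalized expression, for ${\bf x}=(x_1,\dots,x_n)\in C_m(K^{\times n})$, is $$h({\bf x})=\sum_{P(m,n+r)}(-1)^{sign\{[1],\dots,[n+r]\}}\;\partial_{[\;]}x_{k_1}\otimes\partial_{[\;]}x_{k_2}\otimes\cdots\otimes\partial_{[\;]}x_{k_n},$$ where $(x_{k_1},\dots,x_{k_n})=t_\lambda(x_1,\dots,x_n)$ for some permutation $t_\lambda$ of the $n$ factors, each $\partial_{[\;]}$ denotes a composition of non-consecutive elements of the set of face-intervals $\{\partial_{[1]},\dots,\partial_{[n+r]}\}$ with $\{[1],\dots,[n+r]\}\in P(m,n+r)$, and each $\partial_{[j]}$, $1\le j\le n+r$, appears exactly once in the expression of $h({\bf x})$. Assume that: (a) every $x_j$, $1\le j\le n$, is preceded by some face-interval in $h({\bf x})$; (b) no factor of $h({\bf x})$ has more than one face-interval preceding $x_{n+1-u}$ for some $1\le u\le\ell$; the unique face-interval preceding $x_{n+1-u}$ is denoted $\partial_{[j_u]}$, $1\le u\le \ell$; (c) the face-interval $\partial_{[j]}$ immediately before $x_{n-\ell}$ in $h({\bf x})$ does not satisfy $j=\max\{w:\ \partial_{[w]}$ appears preceding some $x_u$ with $1\le u\le n-\ell\}$; (d) for no $u$ with $1\le u\le\ell$ does the composition $\partial_{[j_u-1]}\partial_{[j_u+1]}$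 appear in the expression of $h$. Then the simplified expression of $H({\bf x})=h\,ESA_{(n,\ell)}({\bf x})$, ${\bf x}\in C_m(K^{\times n})$ (a signed sum over $P(m,n+r+1)$), is the output of the following algorithm applied to the expression of $h$. **Face-intervals.** - For $u=1$ to $u=\ell$: replace $\partial_{[j_u]}$ preceding $x_{n+1-u}$ by $\partial_{[n+r+2-u]}$. - Let $\{\partial_{[v_1]},\dots,\partial_{[v_{n+r-\ell}]}\}$, $v_1<\cdots<v_{n+r-\ell}$, be the set of the face-intervals preceding $x_u$ for $1\le u\le n-\ell$. For $s=1$ to $s=n+r-\ell$: replace $\partial_{[v_s]}$ by $\partial_{[s]}$. - Replace $x_{n-\ell}$ by $\partial_{[n+r-\ell+1]}x_{n-\ell}$. **Sign.** Starting from the sign (exponent) of $h$ of degree $m+1$, the sign of $H$ of degree $m$ is obtained as follows. Step 1. For $u=1$ to $u=\ell$ do: - replace $|j_u|$ by $|n+r-u+1|+1$; - for $j=j_u+1$ to $j=n+r-u+1$, replace $|j|$ by $|j-1|$; - add $(|n+r-u+1|+1)(|j_u|+\cdots+|n+r-u|)$. Step 2. Let $\partial_{[v]}$ be the face-interval immediately before $x_{n-\ell}$ (in the relabelled expression, prior to the insertion of $\partial_{[n+r-\ell+1]}$). Starting from the modified sign do: - for $j=n+r-\ell+2$ to $j=n+r$, replace $|j|$ by $|j+1|$; - replace $|n+r-\ell+1|$ by $|n+r-\ell+2|-1$; - replace $|v|$ by $|n+r-\ell+1|+1$; - add $|1|+\cdots+|v|+(|v+1|+\cdots+|n+r-\e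ll|)\,|n+r-\ell+1|$.
   Context: **Chain complexes.** $R$ is a commutative ring with $1\ne0$. For a simplicial set $K$ with face operators $\partial_i$ and degeneracy operators $s_i$, $C_*(K)$ denotes the normalized chain complex with coefficients in $R$ ($C_n(K)$ is the free $R$-module on $K_n$ modulo the submodule generated by degenerate $n$-simplices). Cartesian products of simplicial sets have componentwise faces and degeneracies. A morphism has degree $r$ if it raises dimension by $r$. **Shuffles.** A $(p,q)$-shuffle $(\alpha,\beta)$ is a partition $\{\alpha_1<\cdots<\alpha_p\}\cup\{\beta_1<\cdots<\beta_q\}$ of $\{0,\dots,p+q-1\}$; $sig(\alpha,\beta)=\sum_{i=1}^p(\alpha_i-(i-1))$. For a set $\gamma=\{\gamma_1<\dots<\gamma_k\}$, $s_\gamma=s_{\gamma_k}\cdots s_{\gamma_1}$. **Eilenberg–Zilber operators** for simplicial sets $K,L$: - $AW:C_*(K\times L)\to C_*(K)\otimes C_*(L)$, $AW(x_m,y_m)=\sum_{i=0}^m\partial_{i+1}\cdots\partial_m x_m\otimes\partial_0\cdots\partial_{i-1}y_m$. - $EML:C_*(K)\otimes C_*(L)\to C_*(K\times L)$, $EML(x_p\otimes y_q)=\sum(-1)^{sig(\alpha,\beta)}(s_\beta x_p,s_\alpha y_q)$, sum over all $(p,q)$-shuffles. - $SHI:C_*(K\times L)\to C_{*+1}(K\times L)$, $SHI(x_0,y_0)=0$ and $$SHI(x_m,y_m)=\sum(-1)^{\bar m-1+sig(\alpha,\beta)}\big(s_{\bar\beta+\bar m}\partial_{m-q+1}\cdots\partial_m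 x_m,\; s_{\alpha+\bar m}\partial_{\bar m}\cdots\partial_{m-q-1}y_m\big),$$ the sum being over all $p,q\ge0$ with $p+q\le m-1$ and all $(p+1,q)$-shuffles $(\alpha,\beta)$, where $\bar m=m-p-q$, $\alpha+\bar m=\{\alpha_1+\bar m,\dots,\alpha_{p+1}+\bar m\}$ and $\bar\beta+\bar m=\{\bar m-1,\beta_1+\bar m,\dots,\beta_q+\bar m\}$. For $1\le s<n$, put $AW_{(n,s)}=AW\otimes1^{\otimes s-1}$, $EML_{(n,s)}=EML\otimes 1^{\otimes s-1}$, $SHI_{(n,s)}=SHI\otimes1^{\otimes s-1}$, where $AW,EML,SHI$ are the operators for the pair of simplicial sets $K^{\times(n-s)}$ and $K$; so $AW_{(n,s)}$ goes from $C_*(K^{\times(n-s)}\times K)\otimes C_*(K)^{\otimes s-1}$ to $C_*(K^{\times(n-s)})\otimes C_*(K)\otimes C_*(K)^{\otimes s-1}$, $EML_{(n,s)}$ goes back, and $SHI_{(n,s)}$ is an endomorphism of the former. For $0\le\ell\le n-2$, $$ESA_{(n,\ell)}=EML_{(n,1)}\cdots EML_{(n,\ell)}\,SHI_{(n,\ell+1)}\,AW_{(n,\ell)}\cdots AW_{(n,1)}$$ (so $ESA_{(n,0)}=SHI_{(n,1)}$). **Interval notation.** For integers $0\le i\le j\le m$, $[i,j)$ is the set of consecutive integers from $i$ to $j-1$, and the face-interval $\partial_{[i,j)}$ is the composition $\partial_0\cdots\partial_{i-1}\partial_{j+1}\cdots\partial_m$ acting on $m$-simplices (so $\partial_{[0,j)}=\partial_{j+1}\cdots\partial_m$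 and $\partial_{[i,m)}=\partial_0\cdots\partial_{i-1}$). For $j_1\le i_2$ the "composition" of face-intervals is $$\partial_{[i_1,j_1)}\partial_{[i_2,j_2)}=\partial_0\cdots\partial_{i_1-1}\partial_{j_1+1}\cdots\partial_{i_2-1}\partial_{j_2+1}\cdots\partial_m,$$ and similarly for more face-intervals. $P(m,N)$ is the set of all partitions given by sequences $0=i_0\le i_1\le\cdots\le i_{N-1}\le i_N=m$ into $N$ (possibly empty) intervals $[k]:=[i_{k-1},i_k)$, $1\le k\le N$; $|k|:=i_k-i_{k-1}$. The exponent $sign\{[1],\dots,[n+r]\}$ is an expression in $|1|,\dots,|n+r|$. A face-interval "precedes $x_j$" if it occurs in the composition applied to $x_j$; the one "immediately before $x_j$" is the last one in that composition.
   Formalization: Step 2 of the sign rule is corrected, since as printed it gives wrong signs: |v| is replaced by |v|+|n+r-ℓ+1|+1, and |j| by |j+1|-1 for all n+r-ℓ+1≤j≤n+r. In Step 1, j_u means the current label after earlier passes. *)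

theory Defs
  imports "HOL-Library.Poly_Mapping" "HOL-Combinatorics.Permutations"
begin

(* The sets of simplices of different dimensions need not be disjoint, so the operators take the
   dimension of their argument: face K m i acts on m-simplices, and so does degen K m i. *)
record 'a sset =
  simplices :: "nat \<Rightarrow> 'a set"
  face :: "nat \<Rightarrow> nat \<Rightarrow> 'a \<Rightarrow> 'a"
  degen :: "nat \<Rightarrow> nat \<Rightarrow> 'a \<Rightarrow> 'a"

locale simplicial_set =
  fixes K :: "'a sset"
  assumes face_closed: "x \<in> simplices K (Suc m) \<Longrightarrow> i \<le> Suc m \<Longrightarrow> face K (Suc m) i x \<in> simplices K m"
    and degen_closed: "x \<in> simplices K m \<Longrightarrow> i \<le> m \<Longrightarrow> degen K m i x \<in> simplices K (Suc m)"
    and face_face: "x \<in> simplices K (Suc (Suc m)) \<Longrightarrow> i < j \<Longrightarrow> j \<le> Suc (Suc m) \<Longrightarrow>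
      face K (Suc m) i (face K (Suc (Suc m)) j x) = face K (Suc m) (j - 1) (face K (Suc (Suc m)) i x)"
    and degen_degen: "x \<in> simplices K m \<Longrightarrow> i \<le> j \<Longrightarrow> j \<le> m \<Longrightarrow>
      degen K (Suc m) i (degen K m j x) = degen K (Suc m) (Suc j) (degen K m i x)"
    and face_degen_less: "x \<in> simplices K (Suc m) \<Longrightarrow> i < j \<Longrightarrow> j \<le> Suc m \<Longrightarrow>
      face K (Suc (Suc m)) i (degen K (Suc m) j x) = degen K m (j - 1) (face K (Suc m) i x)"
    and face_degen_id: "x \<in> simplices K m \<Longrightarrow> j \<le> m \<Longrightarrow> i = j \<or> i = Suc j \<Longrightarrow>
      face K (Suc m) i (degen K m j x) = x"
    and face_degen_greater: "x \<in> simplices K (Suc m) \<Longrightarrow> Suc j < i \<Longrightarrow> i \<le> Suc (Suc m) \<Longrightarrow>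
      face K (Suc (Suc m)) i (degen K (Suc m) j x) = degen K m j (face K (Suc m) (i - 1) x)"

definition sset_power :: "nat \<Rightarrow> 'a sset \<Rightarrow> 'a list sset" where
  "sset_power n K = \<lparr>
     simplices = (\<lambda>m. {xs. length xs = n \<and> set xs \<subseteq> simplices K m}),
     face = (\<lambda>m i. map (face K m i)),
     degen = (\<lambda>m i. map (degen K m i))\<rparr>"

(* Simplices tagged with their dimension. *)
type_synonym 'a gsimplex = "nat \<times> 'a"

definition gface :: "'a sset \<Rightarrow> nat \<Rightarrow> 'a gsimplex \<Rightarrow> 'a gsimplex" where
  "gface K i = (\<lambda>(m, x). (m - 1, face K m i x))"

definition gdegen :: "'a sset \<Rightarrow> nat \<Rightarrow> 'a gsimplex \<Rightarrow> 'a gsimplex" where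
  "gdegen K i = (\<lambda>(m, x). (Suc m, degen K m i x))"

(* faces K [a, ..., b] is the composition d_a ... d_b, in which d_b is applied first. *)
definition faces :: "'a sset \<Rightarrow> nat list \<Rightarrow> 'a gsimplex \<Rightarrow> 'a gsimplex" where
  "faces K is = foldr (gface K) is"

(* s_C for a finite set C = {c_1 < ... < c_k} is s_{c_k} ... s_{c_1}; s_{c_1} is applied first. *)
definition degens :: "'a sset \<Rightarrow> nat set \<Rightarrow> 'a gsimplex \<Rightarrow> 'a gsimplex" where
  "degens K C = fold (gdegen K) (sorted_list_of_set C)"

section \<open>Normalized chains\<close>

(* A chain is an element of the free module on a set of generators, with coefficients in the
   ring 'r. A normalized module is a free module modulo the submodule generated by some of its
   generators, the degenerate ones. *)
definition scale :: "'r::comm_ring_1 \<Rightarrow> ('b \<Rightarrow>\<^sub>0 'r) \<Rightarrow> ('b \<Rightarrow>\<^sub>0 'r)" where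
  "scale a c = Poly_Mapping.map (\<lambda>t. a * t) c"

definition lin_ext :: "('b \<Rightarrow> ('c \<Rightarrow>\<^sub>0 'r)) \<Rightarrow> ('b \<Rightarrow>\<^sub>0 'r) \<Rightarrow> ('c \<Rightarrow>\<^sub>0 'r::comm_ring_1)" where
  "lin_ext f c = (\<Sum>b\<in>Poly_Mapping.keys c. scale (Poly_Mapping.lookup c b) (f b))"

definition push :: "('b \<Rightarrow> 'c) \<Rightarrow> ('b \<Rightarrow>\<^sub>0 'r) \<Rightarrow> ('c \<Rightarrow>\<^sub>0 'r::comm_ring_1)" where
  "push g = lin_ext (\<lambda>b. Poly_Mapping.single (g b) 1)"

record 'b normalized_gens =
  gens :: "'b set"
  degenerate_gens :: "'b set"
  gdim :: "'b \<Rightarrow> nat"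

definition free_chains :: "'b set \<Rightarrow> ('b \<Rightarrow>\<^sub>0 'r::comm_ring_1) set" where
  "free_chains B = {c. Poly_Mapping.keys c \<subseteq> B}"

(* The coset of c modulo the submodule generated by the degenerate generators. *)
definition ncls :: "'b normalized_gens \<Rightarrow> ('b \<Rightarrow>\<^sub>0 'r) \<Rightarrow> ('b \<Rightarrow>\<^sub>0 'r::comm_ring_1) set" where
  "ncls C c = {c'. c' - c \<in> free_chains (degenerate_gens C)}"

definition nchains :: "'b normalized_gens \<Rightarrow> nat \<Rightarrow> ('b \<Rightarrow>\<^sub>0 'r::comm_ring_1) set set" where
  "nchains C m = ncls C ` free_chains {b \<in> gens C. gdim C b = m}"

(* A linear map of degree r between the quotients, which are the direct sums of the nchains C m. *)
definition graded_morphism ::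
  "nat \<Rightarrow> 'b normalized_gens \<Rightarrow> 'c normalized_gens \<Rightarrow>
    (('b \<Rightarrow>\<^sub>0 'r) set \<Rightarrow> ('c \<Rightarrow>\<^sub>0 'r::comm_ring_1) set) \<Rightarrow> bool" where
  "graded_morphism r C C' f \<longleftrightarrow>
     (\<forall>m. \<forall>X\<in>nchains C m. f X \<in> nchains C' (m + r)) \<and>
     (\<forall>c\<in>free_chains (gens C). f (ncls C c) \<in> ncls C' ` free_chains (gens C')) \<and>
     (\<forall>a. \<forall>c1\<in>free_chains (gens C). \<forall>c2\<in>free_chains (gens C).
        \<forall>d1\<in>f (ncls C c1). \<forall>d2\<in>f (ncls C c2).
          f (ncls C (scale a c1 + c2)) = ncls C' (scale a d1 + d2))"

definition gsimplices :: "'a sset \<Rightarrow> 'a gsimplex set" where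
  "gsimplices K = {(m, x). x \<in> simplices K m}"

definition degenerate_simplices :: "'a sset \<Rightarrow> 'a gsimplex set" where
  "degenerate_simplices K = {(Suc m, degen K m i x) | m i x. i \<le> m \<and> x \<in> simplices K m}"

definition normalized_chains :: "'a sset \<Rightarrow> 'a gsimplex normalized_gens" where
  "normalized_chains K =
     \<lparr>gens = gsimplices K, degenerate_gens = degenerate_simplices K, gdim = fst\<rparr>"

(* The n-fold tensor power of the normalized chain complex. The tensor product of the quotients
   F_i / D_i of free modules F_i with basis B_i, where D_i is generated by a subset of B_i, is the
   free module on B_1 x ... x B_n modulo the tuples that have an entry in some D_i. *)
definition normalized_tensor_power :: "nat \<Rightarrow> 'a sset \<Rightarrow> 'a gsimplex list normalized_gens" where
  "normalized_tensor_power n K =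
     \<lparr>gens = {zs. length zs = n \<and> set zs \<subseteq> gsimplices K},
      degenerate_gens = {zs. length zs = n \<and> set zs \<subseteq> gsimplices K \<and>
        set zs \<inter> degenerate_simplices K \<noteq> {}},
      gdim = (\<lambda>zs. sum_list (map fst zs))\<rparr>"

section \<open>Eilenberg--Zilber operators\<close>

definition pq_shuffles :: "nat \<Rightarrow> nat \<Rightarrow> (nat set \<times> nat set) set" where
  "pq_shuffles p q =
     {(A, B). A \<union> B = {0..<p + q} \<and> A \<inter> B = {} \<and> card A = p \<and> card B = q}"

definition sig :: "nat set \<Rightarrow> nat" where
  "sig A = (\<Sum>i<card A. sorted_list_of_set A ! i - i)"

(* The operators are given on generators. The simplex (x, y) of dimension m of the product of K
   and L is written (m, (x, y)), and x \<otimes> y is the pair of tagged simplices. *)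
definition AW :: "'a sset \<Rightarrow> 'b sset \<Rightarrow> ('a \<times> 'b) gsimplex \<Rightarrow>
    ('a gsimplex \<times> 'b gsimplex \<Rightarrow>\<^sub>0 'r::comm_ring_1)" where
  "AW K L = (\<lambda>(m, (x, y)).
     \<Sum>i\<le>m. Poly_Mapping.single (faces K [i + 1..<m + 1] (m, x), faces L [0..<i] (m, y)) 1)"

definition EML :: "'a sset \<Rightarrow> 'b sset \<Rightarrow> 'a gsimplex \<times> 'b gsimplex \<Rightarrow>
    (('a \<times> 'b) gsimplex \<Rightarrow>\<^sub>0 'r::comm_ring_1)" where
  "EML K L = (\<lambda>((p, x), (q, y)).
     \<Sum>(A, B)\<in>pq_shuffles p q.
       Poly_Mapping.single (p + q, (snd (degens K B (p, x)), snd (degens L A (q, y))))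
         ((-1) ^ sig A))"

definition SHI :: "'a sset \<Rightarrow> 'b sset \<Rightarrow> ('a \<times> 'b) gsimplex \<Rightarrow>
    (('a \<times> 'b) gsimplex \<Rightarrow>\<^sub>0 'r::comm_ring_1)" where
  "SHI K L = (\<lambda>(m, (x, y)).
     \<Sum>(p, q)\<in>{(p, q). p + q < m}. \<Sum>(A, B)\<in>pq_shuffles (p + 1) q.
       let mb = m - p - q in
       Poly_Mapping.single
         (m + 1,
          (snd (degens K (insert (mb - 1) ((+) mb ` B)) (faces K [m - q + 1..<m + 1] (m, x))),
           snd (degens L ((+) mb ` A) (faces L [mb..<m - q] (m, y)))))
         ((-1) ^ (mb - 1 + sig A)))"

(* Identification of the (k+1)-st power of K with the product of the k-th power and K. *)
definition split_last :: "'a list gsimplex \<Rightarrow> ('a list \<times> 'a) gsimplex" where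
  "split_last = (\<lambda>(m, xs). (m, (butlast xs, last xs)))"

definition join_last :: "('a list \<times> 'a) gsimplex \<Rightarrow> 'a list gsimplex" where
  "join_last = (\<lambda>(m, (xs, y)). (m, xs @ [y]))"

(* Generators of the tensor product of the chains of a power of K with several copies of the
   chains of K. *)
type_synonym 'a mixed = "'a list gsimplex \<times> 'a gsimplex list"

definition AW_ns :: "'a sset \<Rightarrow> nat \<Rightarrow> nat \<Rightarrow> ('a mixed \<Rightarrow>\<^sub>0 'r) \<Rightarrow> ('a mixed \<Rightarrow>\<^sub>0 'r::comm_ring_1)" where
  "AW_ns K n s = lin_ext (\<lambda>(z, zs).
     push (\<lambda>(u, v). (u, v # zs)) (AW (sset_power (n - s) K) K (split_last z)))"

definition EML_ns :: "'a sset \<Rightarrow> nat \<Rightarrow> nat \<Rightarrow> ('a mixed \<Rightarrow>\<^sub>0 'r) \<Rightarrow> ('a mixed \<Rightarrow>\<^sub>0 'r::comm_ring_1)" where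
  "EML_ns K n s = lin_ext (\<lambda>(z, zs).
     push (\<lambda>w. (join_last w, tl zs)) (EML (sset_power (n - s) K) K (z, hd zs)))"

definition SHI_ns :: "'a sset \<Rightarrow> nat \<Rightarrow> nat \<Rightarrow> ('a mixed \<Rightarrow>\<^sub>0 'r) \<Rightarrow> ('a mixed \<Rightarrow>\<^sub>0 'r::comm_ring_1)" where
  "SHI_ns K n s = lin_ext (\<lambda>(z, zs).
     push (\<lambda>w. (join_last w, zs)) (SHI (sset_power (n - s) K) K (split_last z)))"

definition ESA :: "'a sset \<Rightarrow> nat \<Rightarrow> nat \<Rightarrow>
    ('a list gsimplex \<Rightarrow>\<^sub>0 'r) \<Rightarrow> ('a list gsimplex \<Rightarrow>\<^sub>0 'r::comm_ring_1)" where
  "ESA K n l c =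
     push fst
       (foldr (EML_ns K n) [1..<l + 1]
         (SHI_ns K n (l + 1)
           (fold (AW_ns K n) [1..<l + 1]
             (push (\<lambda>z. (z, [])) c))))"

section \<open>Face-intervals\<close>

(* P(m, N) as the set of lists [i_0, ..., i_N]. *)
definition interval_partitions :: "nat \<Rightarrow> nat \<Rightarrow> nat list set" where
  "interval_partitions m N =
     {is. length is = N + 1 \<and> sorted is \<and> is ! 0 = 0 \<and> is ! N = m}"

definition interval_length :: "nat list \<Rightarrow> nat \<Rightarrow> int" where
  "interval_length is k = int (is ! k) - int (is ! (k - 1))"

(* The indices of the faces in the composition of the face-intervals [i_1,j_1), [i_2,j_2), ...
   acting on m-simplices, starting at index a. *)
fun face_indices :: "nat \<Rightarrow> nat \<Rightarrow> (nat \<times> nat) list \<Rightarrow> nat list" where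
  "face_indices m a [] = [a..<m + 1]"
| "face_indices m a ((i, j) # ivs) = [a..<i] @ face_indices m (j + 1) ivs"

(* The composition, in increasing order, of the face-intervals whose labels form the set A. *)
definition face_intervals :: "'a sset \<Rightarrow> nat list \<Rightarrow> nat set \<Rightarrow> 'a gsimplex \<Rightarrow> 'a gsimplex" where
  "face_intervals K is A z =
     (if A = {} then z
      else faces K
        (face_indices (fst z) 0 (map (\<lambda>k. (is ! (k - 1), is ! k)) (sorted_list_of_set A))) z)"

(* If two successive intervals [i_1,j_1), [i_2,j_2) of a composition touch (j_1 = i_2, which happens
   when all the intervals between them are empty), the product d_{j_1+1} ... d_{i_2-1} would have
   -1 factors. Such a composition stands for a simplex in which the vertex j_1 is repeated, which is
   degenerate, and the summand is zero in normalized chains. (Reading the product as the identity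
   would give a summand of the wrong degree.) *)
definition separated :: "nat list \<Rightarrow> nat set \<Rightarrow> bool" where
  "separated is A \<longleftrightarrow> (\<forall>j\<in>A. \<forall>k\<in>A. j < k \<longrightarrow> is ! j < is ! (k - 1))"

(* A sign exponent is an integer expression in the lengths |1|, |2|, ... *)
type_synonym sign_expr = "(nat \<Rightarrow> int) \<Rightarrow> int"

definition minus_one_pow :: "int \<Rightarrow> 'r::comm_ring_1" where
  "minus_one_pow e = (if even e then 1 else -1)"

(* The shape of an expression: the i-th tensor factor has the variable x_(lam i), and J u is the set
   of the labels of the face-intervals preceding x_u. *)
definition wf_expression :: "nat \<Rightarrow> nat \<Rightarrow> (nat \<Rightarrow> nat) \<Rightarrow> (nat \<Rightarrow> nat set) \<Rightarrow> sign_expr \<Rightarrow> bool" where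
  "wf_expression n N lam J sgn_e \<longleftrightarrow>
     lam permutes {1..n} \<and>
     (\<forall>u\<in>{1..n}. J u \<subseteq> {1..N}) \<and>
     (\<forall>j\<in>{1..N}. \<exists>!u. u \<in> {1..n} \<and> j \<in> J u) \<and>
     (\<forall>u\<in>{1..n}. \<forall>j\<in>J u. Suc j \<notin> J u) \<and>
     (\<forall>a b. (\<forall>k\<in>{1..N}. a k = b k) \<longrightarrow> sgn_e a = sgn_e b)"

definition expression :: "'a sset \<Rightarrow> nat \<Rightarrow> nat \<Rightarrow> (nat \<Rightarrow> nat) \<Rightarrow> (nat \<Rightarrow> nat set) \<Rightarrow> sign_expr \<Rightarrow>
    nat \<Rightarrow> 'a list \<Rightarrow> ('a gsimplex list \<Rightarrow>\<^sub>0 'r::comm_ring_1)" where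
  "expression K n N lam J sgn_e m xs =
     (\<Sum>is\<in>interval_partitions m N.
        if \<forall>u\<in>{1..n}. separated is (J u)
        then Poly_Mapping.single
          (map (\<lambda>i. face_intervals K is (J (lam i)) (m, xs ! (lam i - 1))) [1..<n + 1])
          (minus_one_pow (sgn_e (interval_length is)))
        else 0)"

section \<open>The simplification algorithm\<close>

definition sole_label :: "nat \<Rightarrow> (nat \<Rightarrow> nat set) \<Rightarrow> nat \<Rightarrow> nat" where
  "sole_label n J u = the_elem (J (n + 1 - u))"

definition head_labels :: "nat \<Rightarrow> nat \<Rightarrow> (nat \<Rightarrow> nat set) \<Rightarrow> nat set" where
  "head_labels n l J = (\<Union>u\<in>{1..n - l}. J u)"

(* card {w' \<in> head_labels n l J. w' \<le> w} is the s with w = v_s. *)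
definition relabelled :: "nat \<Rightarrow> nat \<Rightarrow> nat \<Rightarrow> (nat \<Rightarrow> nat set) \<Rightarrow> nat \<Rightarrow> nat set" where
  "relabelled n r l J u =
     (if u \<le> n - l then (\<lambda>w. card {w' \<in> head_labels n l J. w' \<le> w}) ` J u
      else {n + r + 2 - (n + 1 - u)})"

definition output_labels :: "nat \<Rightarrow> nat \<Rightarrow> nat \<Rightarrow> (nat \<Rightarrow> nat set) \<Rightarrow> nat \<Rightarrow> nat set" where
  "output_labels n r l J u =
     (if u = n - l then insert (n + r - l + 1) (relabelled n r l J u) else relabelled n r l J u)"

(* Each pass of the first loop removes the label j_u and lowers the labels above it, so in the
   u-th pass the face-interval preceding x_(n+1-u) carries this label: *)
definition current_label :: "nat \<Rightarrow> (nat \<Rightarrow> nat set) \<Rightarrow> nat \<Rightarrow> nat" where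
  "current_label n J u =
     sole_label n J u - card {w \<in> {1..<u}. sole_label n J w < sole_label n J u}"

(* Replacements are substitutions into the expression, performed simultaneously in each step. *)
definition sign_step1 :: "nat \<Rightarrow> (nat \<Rightarrow> nat) \<Rightarrow> nat \<Rightarrow> sign_expr \<Rightarrow> sign_expr" where
  "sign_step1 N jc u S = (\<lambda>a.
     S (\<lambda>k. if k = jc u then a (N - u + 1) + 1
            else if jc u < k \<and> k \<le> N - u + 1 then a (k - 1)
            else a k)
     + (a (N - u + 1) + 1) * (\<Sum>k = jc u..N - u. a k))"

(* The lengths substituted here are those of the face-intervals of h, in degree m + 1: the last one
   preceding x_(n-l) has length |v| + |N-l+1| + 1, and the ones preceding x_(n+1-u) (1 \<le> u \<le> l),
   whose lengths are |N-u+1| + 1 after the first step, have lengths |N-u+2|. Hence the summand |v|,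
   and the -1 for all the k in question; in the printed algorithm the former is missing and the
   latter is present only for k = N-l+1, and the result is then not the sign of h ESA. *)
definition sign_step2 :: "nat \<Rightarrow> nat \<Rightarrow> nat \<Rightarrow> sign_expr \<Rightarrow> sign_expr" where
  "sign_step2 N l v S = (\<lambda>a.
     S (\<lambda>k. if N - l + 1 \<le> k \<and> k \<le> N then a (k + 1) - 1
            else if k = v then a v + a (N - l + 1) + 1
            else a k)
     + (\<Sum>k = 1..v. a k) + (\<Sum>k = v + 1..N - l. a k) * a (N - l + 1))"

definition output_sign :: "nat \<Rightarrow> nat \<Rightarrow> nat \<Rightarrow> (nat \<Rightarrow> nat set) \<Rightarrow> sign_expr \<Rightarrow> sign_expr" where
  "output_sign n r l J S =
     sign_step2 (n + r) l (Max (relabelled n r l J (n - l)))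
       (fold (sign_step1 (n + r) (current_label n J)) [1..<l + 1] S)"

end

theory Submission
  imports Defs
begin

text \<open>Every generator occurring in \<open>ESA\<close> is a tuple of degeneracies of faces, that is, a lattice path from which
  the face-intervals of \<open>h\<close> pick segments. A summand survives in the normalized complex only if every
  step of the path raises the variable whose interval contains it. For a shuffle product with a split-off
  factor that has the single interval \<open>j\<close> this leaves one shuffle, the one whose steps of that factor
  are the interval \<open>j\<close>; removing it gives one pass of the first loop, with the sign of moving a block past
  the later ones. For the Shih operator it leaves the choice of an edge in the last interval \<open>v\<close> of
  \<open>x_(n-l)\<close>: the part of the interval before this edge becomes the new interval \<open>v\<close>, and the part after it
  the additional last interval. The theorem follows by induction on \<open>l\<close>, splitting off
  \<open>x_n\<close> in each step.\<close>

section \<open>Chains modulo degenerate generators\<close>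

text \<open>Composites of faces and degeneracies become lists of vertices, so that they are compared
  as sorted lists instead of by simplicial identities; a list with a repeated vertex gives a
  degenerate simplex. Chains stay in the free module and are compared modulo the span of the
  degenerate tuples; cosets come back only in the theorem. One obstacle is that two intervals of the
  same variable may touch, in which case \<open>expression\<close> omits the summand. Before and
  after an operator this condition refers to different partitions, so each reindexing must show that
  touching afterwards means an absent or degenerate term before. The other obstacle is the sign. The
  last factor of an AW summand has a dimension \<open>q\<close> that is not the length of any
  interval of the smaller expression. The induction therefore ranges over all exponents that read
  only the available lengths, with \<open>q\<close> as a constant inside them; summation over the
  cut points of AW then makes \<open>q\<close> the length of a new last interval. The first loop
  writes the length of the split-off interval as one more than a variable, and the second step
  subtracts the one again: this is where the two descriptions of \<open>q\<close> meet.\<close>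

lemma lookup_scale [simp]: "Poly_Mapping.lookup (scale a c) k = a * Poly_Mapping.lookup c k"
  by (simp add: scale_def Poly_Mapping.map.rep_eq when_def)

lemma scale_zero [simp]: "scale a 0 = 0"
  by (rule poly_mapping_eqI) simp

lemma scale_one [simp]: "scale 1 c = c"
  by (rule poly_mapping_eqI) simp

lemma scale_single [simp]: "scale a (Poly_Mapping.single b t) = Poly_Mapping.single b (a * t)"
  by (rule poly_mapping_eqI) (simp add: lookup_single when_def)

lemma lookup_lin_ext:
  assumes "finite B" "Poly_Mapping.keys c \<subseteq> B"
  shows "Poly_Mapping.lookup (lin_ext f c) k =
    (\<Sum>b\<in>B. Poly_Mapping.lookup c b * Poly_Mapping.lookup (f b) k)"
  unfolding lin_ext_def lookup_sum lookup_scale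
  by (rule sum.mono_neutral_left) (use assms in \<open>auto simp: in_keys_iff\<close>)

lemma lin_ext_zero [simp]: "lin_ext f 0 = 0"
  by (simp add: lin_ext_def)

lemma lin_ext_single [simp]: "lin_ext f (Poly_Mapping.single b t) = scale t (f b)"
  by (rule poly_mapping_eqI) (simp add: lookup_lin_ext[where B="{b}"])

lemma lin_ext_add: "lin_ext f (c + d) = lin_ext f c + lin_ext f d"
proof (rule poly_mapping_eqI)
  fix k
  let ?B = "Poly_Mapping.keys c \<union> Poly_Mapping.keys d"
  have "Poly_Mapping.keys (c + d) \<subseteq> ?B"
    by (rule Poly_Mapping.keys_add)
  then show "Poly_Mapping.lookup (lin_ext f (c + d)) k = Poly_Mapping.lookup (lin_ext f c + lin_ext f d) k"
    by (simp add: lookup_lin_ext[where B="?B"] lookup_add algebra_simps sum.distrib)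
qed

lemma lin_ext_scale: "lin_ext f (scale a c) = scale a (lin_ext f c)"
proof (rule poly_mapping_eqI)
  fix k
  have "Poly_Mapping.keys (scale a c) \<subseteq> Poly_Mapping.keys c"
    by (auto simp: in_keys_iff)
  then show "Poly_Mapping.lookup (lin_ext f (scale a c)) k = Poly_Mapping.lookup (scale a (lin_ext f c)) k"
    by (simp add: lookup_lin_ext[where B="Poly_Mapping.keys c"] sum_distrib_left mult.assoc)
qed

lemma lin_ext_sum: "lin_ext f (sum g I) = (\<Sum>i\<in>I. lin_ext f (g i))"
  by (induction I rule: infinite_finite_induct) (auto simp: lin_ext_add)

lemma scale_add: "scale a (c + d) = scale a c + scale a d"
  by (rule poly_mapping_eqI) (simp add: lookup_add algebra_simps)

lemma scale_sum: "scale a (sum g I) = (\<Sum>i\<in>I. scale a (g i))"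
  by (induction I rule: infinite_finite_induct) (auto simp: scale_add)

lemma lin_ext_cong:
  "(\<And>b. b \<in> Poly_Mapping.keys c \<Longrightarrow> f b = g b) \<Longrightarrow> lin_ext f c = lin_ext g c"
  by (simp add: lin_ext_def)

lemma lin_ext_lin_ext: "lin_ext f (lin_ext g c) = lin_ext (\<lambda>b. lin_ext f (g b)) c"
  unfolding lin_ext_def[of g] lin_ext_sum lin_ext_scale
  by (simp add: lin_ext_def)

lemma push_zero [simp]: "push g 0 = 0"
  by (simp add: push_def)

lemma push_single [simp]: "push g (Poly_Mapping.single b t) = Poly_Mapping.single (g b) t"
  by (simp add: push_def)

lemma push_sum: "push g (sum f I) = (\<Sum>i\<in>I. push g (f i))"
  by (simp add: push_def lin_ext_sum)

lemma lin_ext_push: "lin_ext f (push g c) = lin_ext (\<lambda>b. f (g b)) c"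
  by (simp add: push_def lin_ext_lin_ext)

lemma push_lin_ext: "push g (lin_ext f c) = lin_ext (\<lambda>b. push g (f b)) c"
  by (simp add: push_def lin_ext_lin_ext)

lemma push_push: "push f (push g c) = push (\<lambda>b. f (g b)) c"
  by (simp add: push_lin_ext[symmetric] push_def lin_ext_lin_ext)

lemma push_cong:
  "(\<And>b. b \<in> Poly_Mapping.keys c \<Longrightarrow> f b = g b) \<Longrightarrow> push f c = push g c"
  unfolding push_def by (rule lin_ext_cong) simp

lemma push_ident [simp]: "push (\<lambda>b. b) c = c"
proof (rule poly_mapping_eqI)
  fix k
  show "Poly_Mapping.lookup (push (\<lambda>b. b) c) k = Poly_Mapping.lookup c k"
    unfolding push_def
    by (cases "k \<in> Poly_Mapping.keys c")
      (auto simp: lookup_lin_ext[OF finite_keys subset_refl] lookup_single when_def in_keys_iff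
          if_distrib[of "(*) _"] cong: if_cong)
qed

lemma keys_sum_subset: "(\<And>i. i \<in> I \<Longrightarrow> Poly_Mapping.keys (f i) \<subseteq> B) \<Longrightarrow> Poly_Mapping.keys (sum f I) \<subseteq> B"
proof (induction I rule: infinite_finite_induct)
  case (insert x F)
  then show ?case using Poly_Mapping.keys_add[of "f x" "sum f F"] by auto
qed auto

lemma keys_scale_subset: "Poly_Mapping.keys (scale a c) \<subseteq> Poly_Mapping.keys c"
  by (auto simp: in_keys_iff)

lemma keys_single_subset: "b \<in> B \<Longrightarrow> Poly_Mapping.keys (Poly_Mapping.single b t) \<subseteq> B"
  by simp

lemma keys_lin_ext_subset:
  assumes "\<And>b. b \<in> Poly_Mapping.keys c \<Longrightarrow> Poly_Mapping.keys (f b) \<subseteq> B"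
  shows "Poly_Mapping.keys (lin_ext f c) \<subseteq> B"
  unfolding lin_ext_def
  by (rule keys_sum_subset) (use assms keys_scale_subset in fastforce)

lemma keys_push_subset:
  assumes "\<And>b. b \<in> Poly_Mapping.keys c \<Longrightarrow> g b \<in> B"
  shows "Poly_Mapping.keys (push g c) \<subseteq> B"
  unfolding push_def by (rule keys_lin_ext_subset) (use assms in simp)

text \<open>Congruence modulo the span of \<open>D\<close>, put coefficientwise: compatibility with
  sums, scalars and linear extensions is then immediate, and \<open>cong_mod_iff_free_chains\<close>
  gives the link to the quotient.\<close>

definition cong_mod :: "'b set \<Rightarrow> ('b \<Rightarrow>\<^sub>0 'r::comm_ring_1) \<Rightarrow> ('b \<Rightarrow>\<^sub>0 'r) \<Rightarrow> bool" where
  "cong_mod D c d \<longleftrightarrow> (\<forall>k. k \<notin> D \<longrightarrow> Poly_Mapping.lookup c k = Poly_Mapping.lookup d k)"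

lemma cong_mod_refl [simp]: "cong_mod D c c"
  by (simp add: cong_mod_def)

lemma cong_mod_sym: "cong_mod D c d \<Longrightarrow> cong_mod D d c"
  by (simp add: cong_mod_def)

lemma cong_mod_trans [trans]: "cong_mod D c d \<Longrightarrow> cong_mod D d e \<Longrightarrow> cong_mod D c e"
  by (simp add: cong_mod_def)

lemma eq_cong_mod_trans [trans]: "c = d \<Longrightarrow> cong_mod D d e \<Longrightarrow> cong_mod D c e"
  by simp

lemma cong_mod_eq_trans [trans]: "cong_mod D c d \<Longrightarrow> d = e \<Longrightarrow> cong_mod D c e"
  by simp

lemma cong_mod_add: "cong_mod D c d \<Longrightarrow> cong_mod D c' d' \<Longrightarrow> cong_mod D (c + c') (d + d')"
  by (simp add: cong_mod_def lookup_add)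

lemma cong_mod_scale: "cong_mod D c d \<Longrightarrow> cong_mod D (scale a c) (scale a d)"
  by (simp add: cong_mod_def)

lemma cong_mod_sum: "(\<And>i. i \<in> I \<Longrightarrow> cong_mod D (f i) (g i)) \<Longrightarrow> cong_mod D (sum f I) (sum g I)"
  by (simp add: cong_mod_def lookup_sum)

lemma cong_mod_lin_ext:
  "(\<And>b. b \<in> Poly_Mapping.keys c \<Longrightarrow> cong_mod D (f b) (g b)) \<Longrightarrow> cong_mod D (lin_ext f c) (lin_ext g c)"
  unfolding lin_ext_def by (intro cong_mod_sum cong_mod_scale)

lemma cong_mod_single_zero: "b \<in> D \<Longrightarrow> cong_mod D (Poly_Mapping.single b t) 0"
  by (auto simp: cong_mod_def lookup_single when_def)

lemma cong_mod_iff_free_chains: "cong_mod D c d \<longleftrightarrow> c - d \<in> free_chains D"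
  by (auto simp: cong_mod_def free_chains_def in_keys_iff lookup_minus)

text \<open>The difference of the two chains is supported on \<open>D\<close>, so its pushforward is
  supported on \<open>D'\<close>; \<open>g\<close> may identify generators.\<close>

lemma cong_mod_push:
  assumes "cong_mod D c d" and "\<And>b. b \<in> D \<Longrightarrow> g b \<in> D'"
  shows "cong_mod D' (push g c) (push g d)"
proof -
  have "c = d + (c - d)" by simp
  then have "push g c = push g d + push g (c - d)"
    by (metis lin_ext_add push_def)
  moreover have "Poly_Mapping.keys (push g (c - d)) \<subseteq> D'"
    by (rule keys_push_subset) (use assms in \<open>auto simp: cong_mod_iff_free_chains free_chains_def\<close>)
  ultimately show ?thesis
    by (simp add: cong_mod_iff_free_chains free_chains_def)
qed

lemma ncls_eqI: "cong_mod (degenerate_gens C) c d \<Longrightarrow> ncls C c = ncls C d"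
  by (auto simp: ncls_def cong_mod_iff_free_chains[symmetric] intro: cong_mod_trans cong_mod_sym)

text \<open>The common frame of both operator computations. \<open>T\<close> indexes the summands
  that the operator produces, \<open>P\<close> those of the claimed result, and \<open>G\<close>
  matches the survivors \<open>P'\<close>. Terms unmatched on either side vanish modulo
  \<open>D\<close>. For the shuffle product \<open>P'\<close> is all of \<open>P\<close>, for the
  Shih operator it is smaller.\<close>

lemma cong_mod_sum_reindex:
  assumes fin: "finite T" "finite P" and sub: "P' \<subseteq> P" "G ` P' \<subseteq> T" and inj: "inj_on G P'"
    and zero: "\<And>t. t \<in> T \<Longrightarrow> t \<notin> G ` P' \<Longrightarrow> cong_mod D (f t) 0"
    and eq: "\<And>s. s \<in> P' \<Longrightarrow> cong_mod D (f (G s)) (g s)"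
    and zero': "\<And>s. s \<in> P \<Longrightarrow> s \<notin> P' \<Longrightarrow> cong_mod D (g s) 0"
  shows "cong_mod D (sum f T) (sum g P)"
proof -
  have "sum f T = sum f (G ` P') + sum f (T - G ` P')"
    by (metis add.commute fin(1) sub(2) sum.subset_diff)
  also have "cong_mod D \<dots> (sum f (G ` P') + (\<Sum>t\<in>T - G ` P'. 0))"
    by (intro cong_mod_add cong_mod_refl cong_mod_sum zero) auto
  also have "sum f (G ` P') + (\<Sum>t\<in>T - G ` P'. 0) = (\<Sum>s\<in>P'. f (G s))"
    by (simp add: sum.reindex inj)
  also have "cong_mod D \<dots> (sum g P' + (\<Sum>s\<in>P - P'. 0))"
    using cong_mod_sum[OF eq, where I=P'] by simp
  also have "cong_mod D \<dots> (sum g P' + sum g (P - P'))"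
    by (intro cong_mod_add cong_mod_refl cong_mod_sum cong_mod_sym[OF zero']) auto
  also have "\<dots> = sum g P"
    by (metis add.commute fin(2) sub(1) sum.subset_diff)
  finally show ?thesis .
qed

text \<open>Linearity of \<open>h\<close> is given only through representatives of cosets, so a
  combination of generators is built up one generator at a time, starting from the value at
  zero.\<close>

lemma graded_morphism_lin_ext:
  fixes h :: "('b \<Rightarrow>\<^sub>0 'r::comm_ring_1) set \<Rightarrow> ('c \<Rightarrow>\<^sub>0 'r) set"
  assumes h: "graded_morphism r C C' h"
    and e: "\<And>b. b \<in> gens C \<Longrightarrow> h (ncls C (Poly_Mapping.single b 1)) = ncls C' (e b)"
    and c: "c \<in> free_chains (gens C)"
  shows "h (ncls C c) = ncls C' (lin_ext e c)"
proof -
  have self: "d \<in> ncls C' d" for d :: "'c \<Rightarrow>\<^sub>0 'r" by (simp add: ncls_def free_chains_def)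
  have lin: "h (ncls C (scale a c1 + c2)) = ncls C' (scale a d1 + d2)"
    if "c1 \<in> free_chains (gens C)" "c2 \<in> free_chains (gens C)" "d1 \<in> h (ncls C c1)" "d2 \<in> h (ncls C c2)"
    for a c1 c2 d1 d2
    using h that unfolding graded_morphism_def by blast
  have zero: "h (ncls C 0) = ncls C' 0"
  proof -
    have 0: "0 \<in> free_chains (gens C)" by (simp add: free_chains_def)
    then have "h (ncls C 0) \<in> ncls C' ` free_chains (gens C')"
      using h unfolding graded_morphism_def by blast
    then obtain d where d: "d \<in> h (ncls C 0)" using self by blast
    \<comment> \<open>The value at the zero coset is not prescribed; linearity applied twice to the
      same representative, with factor -1, forces it.\<close>
    have "scale (-1) d + d = 0" by (rule poly_mapping_eqI) (simp add: lookup_add)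
    then show ?thesis using lin[OF 0 0 d d, of "-1"] by simp
  qed
  have "finite B \<Longrightarrow> B \<subseteq> gens C \<Longrightarrow>
    h (ncls C (\<Sum>b\<in>B. Poly_Mapping.single b (t b))) = ncls C' (\<Sum>b\<in>B. scale (t b) (e b))" for B t
  proof (induction B rule: finite_induct)
    case empty
    then show ?case using zero by simp
  next
    case (insert b B)
    have "(\<Sum>b\<in>B. Poly_Mapping.single b (t b)) \<in> free_chains (gens C)"
      unfolding free_chains_def mem_Collect_eq
      by (rule keys_sum_subset) (use insert.prems in auto)
    moreover have "Poly_Mapping.single b 1 \<in> free_chains (gens C)"
      using insert.prems by (simp add: free_chains_def)
    ultimately show ?case
      using lin[of "Poly_Mapping.single b 1" "\<Sum>b\<in>B. Poly_Mapping.single b (t b)" "e b" "\<Sum>b\<in>B. scale (t b) (e b)" "t b"]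
        insert e[of b] self by simp
  qed
  from this[OF finite_keys, of c "Poly_Mapping.lookup c"]
  have "h (ncls C (\<Sum>b\<in>Poly_Mapping.keys c. Poly_Mapping.single b (Poly_Mapping.lookup c b))) = ncls C' (lin_ext e c)"
    using c by (simp add: free_chains_def lin_ext_def)
  moreover have "(\<Sum>b\<in>Poly_Mapping.keys c. Poly_Mapping.single b (Poly_Mapping.lookup c b)) = c"
    using push_ident[of c] by (simp add: push_def lin_ext_def del: push_ident)
  ultimately show ?thesis by simp
qed

section \<open>Simplicial operators as lists of vertices\<close>

lemma fst_gface [simp]: "fst (gface K i z) = fst z - 1"
  by (simp add: gface_def split: prod.split)

lemma fst_gdegen [simp]: "fst (gdegen K i z) = Suc (fst z)"
  by (simp add: gdegen_def split: prod.split)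

lemma mem_gsimplices_iff: "z \<in> gsimplices K \<longleftrightarrow> snd z \<in> simplices K (fst z)"
  by (cases z) (simp add: gsimplices_def)

text \<open>\<open>act K vs z\<close> applies to \<open>z\<close> the simplicial operator of the monotone map with list of values \<open>vs\<close>.
  It is encoded by the multiplicities of the vertices: multiplicity 0 is a face, multiplicity \<open>k > 0\<close> is
  \<open>k - 1\<close> degeneracies. Processing the vertices from the last to the first leaves the indices of the
  smaller ones unchanged, so no reindexing is needed.\<close>

primrec blocks :: "'a sset \<Rightarrow> nat \<Rightarrow> nat list \<Rightarrow> 'a gsimplex \<Rightarrow> 'a gsimplex" where
  "blocks K j [] z = z"
| "blocks K j (k # ks) z =
    (if k = 0 then gface K j else gdegen K j ^^ (k - 1)) (blocks K (Suc j) ks z)"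

definition act :: "'a sset \<Rightarrow> nat list \<Rightarrow> 'a gsimplex \<Rightarrow> 'a gsimplex" where
  "act K vs z = blocks K 0 (map (count_list vs) [0..<Suc (fst z)]) z"

context simplicial_set
begin

section \<open>Simplicial identities and their iterates for tagged simplices\<close>

lemma gface_closed: "z \<in> gsimplices K \<Longrightarrow> 0 < fst z \<Longrightarrow> i \<le> fst z \<Longrightarrow> gface K i z \<in> gsimplices K"
  by (cases z; cases "fst z") (auto simp: gsimplices_def gface_def face_closed)

lemma gdegen_closed: "z \<in> gsimplices K \<Longrightarrow> i \<le> fst z \<Longrightarrow> gdegen K i z \<in> gsimplices K"
  by (cases z) (auto simp: gsimplices_def gdegen_def degen_closed)

lemma gdegen_degenerate: "z \<in> gsimplices K \<Longrightarrow> i \<le> fst z \<Longrightarrow> gdegen K i z \<in> degenerate_simplices K"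
  by (cases z) (auto simp: gsimplices_def gdegen_def degenerate_simplices_def)

lemma gface_gface:
  assumes "z \<in> gsimplices K" "j \<le> i" "i < fst z" "2 \<le> fst z"
  shows "gface K i (gface K j z) = gface K j (gface K (Suc i) z)"
proof -
  obtain m x where z: "z = (Suc (Suc m), x)"
    using assms(4) by (metis Suc_le_D add_2_eq_Suc prod.collapse le_add_diff_inverse)
  show ?thesis
    using assms face_face[of x m j "Suc i"] by (simp add: z gface_def gsimplices_def)
qed

lemma gdegen_gdegen:
  assumes "z \<in> gsimplices K" "j < i" "i \<le> Suc (fst z)"
  shows "gdegen K i (gdegen K j z) = gdegen K j (gdegen K (i - 1) z)"
  using assms degen_degen[of "snd z" "fst z" j "i - 1"]
  by (cases z) (simp add: gdegen_def gsimplices_def)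

lemma gface_gdegen_same:
  assumes "z \<in> gsimplices K" "j \<le> fst z" "i = j \<or> i = Suc j"
  shows "gface K i (gdegen K j z) = z"
  using assms face_degen_id[of "snd z" "fst z" j i]
  by (cases z) (simp add: gdegen_def gface_def gsimplices_def)

lemma gface_gdegen_greater:
  assumes "z \<in> gsimplices K" "Suc j < i" "i \<le> Suc (fst z)"
  shows "gface K i (gdegen K j z) = gdegen K j (gface K (i - 1) z)"
proof -
  obtain m x where z: "z = (Suc m, x)"
    using assms(2,3) by (cases z; cases "fst z") auto
  show ?thesis
    using assms face_degen_greater[of x m j i] by (simp add: z gface_def gdegen_def gsimplices_def)
qed

lemma fst_gdegen_pow [simp]: "fst ((gdegen K j ^^ k) z) = fst z + k"
  by (induction k) auto

lemma gdegen_pow_closed: "z \<in> gsimplices K \<Longrightarrow> j \<le> fst z \<Longrightarrow> (gdegen K j ^^ k) z \<in> gsimplices K"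
  by (induction k) (auto intro: gdegen_closed)

lemma gdegen_gdegen_pow:
  assumes "z \<in> gsimplices K" "j + k < i" "i \<le> fst z + k"
  shows "gdegen K i ((gdegen K j ^^ k) z) = (gdegen K j ^^ k) (gdegen K (i - k) z)"
  using assms
proof (induction k arbitrary: i)
  case (Suc k)
  have "gdegen K i ((gdegen K j ^^ Suc k) z) = gdegen K j (gdegen K (i - 1) ((gdegen K j ^^ k) z))"
    using Suc.prems by (simp add: gdegen_gdegen gdegen_pow_closed)
  also have "\<dots> = gdegen K j ((gdegen K j ^^ k) (gdegen K (i - 1 - k) z))"
    using Suc.prems by (subst Suc.IH) auto
  finally show ?case using Suc.prems by simp
qed simp

text \<open>The range of \<open>i\<close> complementary to \<open>gdegen_gdegen_pow\<close>: moving
  inwards lowers the index of the outer degeneracy by one per factor until it equals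
  \<open>j\<close>, and there it joins the power.\<close>

lemma gdegen_gdegen_pow_same:
  assumes "z \<in> gsimplices K" "j \<le> i" "i \<le> j + k" "j \<le> fst z"
  shows "gdegen K i ((gdegen K j ^^ k) z) = (gdegen K j ^^ Suc k) z"
  using assms
proof (induction k arbitrary: i)
  case (Suc k)
  show ?case
  proof (cases "i = j")
    case False
    then have "gdegen K i ((gdegen K j ^^ Suc k) z) = gdegen K j (gdegen K (i - 1) ((gdegen K j ^^ k) z))"
      using Suc.prems by (simp add: gdegen_gdegen gdegen_pow_closed)
    moreover have "gdegen K (i - 1) ((gdegen K j ^^ k) z) = (gdegen K j ^^ Suc k) z"
      by (rule Suc.IH) (use Suc.prems False in auto)
    ultimately show ?thesis by simp
  qed simp
qed simp

lemma gface_gdegen_pow: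
  assumes "z \<in> gsimplices K" "j + k < i" "i \<le> fst z + k"
  shows "gface K i ((gdegen K j ^^ k) z) = (gdegen K j ^^ k) (gface K (i - k) z)"
  using assms
proof (induction k arbitrary: i)
  case (Suc k)
  have "gface K i ((gdegen K j ^^ Suc k) z) = gdegen K j (gface K (i - 1) ((gdegen K j ^^ k) z))"
    using Suc.prems by (simp add: gface_gdegen_greater gdegen_pow_closed)
  also have "\<dots> = gdegen K j ((gdegen K j ^^ k) (gface K (i - 1 - k) z))"
    using Suc.prems by (subst Suc.IH) auto
  finally show ?case using Suc.prems by simp
qed simp

text \<open>The index of the face falls by one at each degeneracy that it passes, until it is
  \<open>j\<close> or \<open>Suc j\<close> and cancels one of them.\<close>

lemma gface_gdegen_pow_same:
  assumes "z \<in> gsimplices K" "j \<le> i" "i \<le> Suc (j + k)" "j \<le> fst z"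
  shows "gface K i ((gdegen K j ^^ Suc k) z) = (gdegen K j ^^ k) z"
  using assms
proof (induction k arbitrary: i)
  case 0
  then show ?case by (simp add: gface_gdegen_same le_Suc_eq)
next
  case (Suc k)
  show ?case
  proof (cases "i = j \<or> i = Suc j")
    case True
    then show ?thesis using Suc.prems
      by (subst funpow.simps(2), subst comp_apply, subst gface_gdegen_same) (auto intro: gdegen_pow_closed gdegen_closed)
  next
    case False
    have "gface K i ((gdegen K j ^^ Suc (Suc k)) z) =
        gdegen K j (gface K (i - 1) ((gdegen K j ^^ Suc k) z))"
      using Suc.prems False
      by (subst funpow.simps(2), subst comp_apply, subst gface_gdegen_greater)
        (auto intro: gdegen_pow_closed gdegen_closed)
    moreover have "gface K (i - 1) ((gdegen K j ^^ Suc k) z) = (gdegen K j ^^ k) z"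
      by (rule Suc.IH) (use Suc.prems False in auto)
    ultimately show ?thesis by simp
  qed
qed

lemma blocks_closed:
  assumes "z \<in> gsimplices K" "j + length ks = Suc (fst z)" "0 < j + sum_list ks"
  shows "blocks K j ks z \<in> gsimplices K \<and> fst (blocks K j ks z) = j + sum_list ks - 1"
  using assms
proof (induction ks arbitrary: j)
  case (Cons k ks)
  then have "blocks K (Suc j) ks z \<in> gsimplices K \<and> fst (blocks K (Suc j) ks z) = j + sum_list ks"
    using Cons.IH[of "Suc j"] by simp
  then show ?case using Cons.prems
    by (auto intro!: gface_closed gdegen_pow_closed)
qed auto

text \<open>Positions below \<open>j\<close> belong to vertices not yet processed. After them the
  vertex \<open>j + t\<close> occupies as many positions as its multiplicity \<open>ks ! t\<close>,
  namely those between the two partial sums. Repeating any one of these positions raises this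
  multiplicity by one.\<close>

lemma gdegen_blocks:
  assumes "z \<in> gsimplices K" "j + length ks = Suc (fst z)" "t < length ks"
    and "j + sum_list (take t ks) \<le> i" "i < j + sum_list (take (Suc t) ks)"
  shows "gdegen K i (blocks K j ks z) = blocks K j (ks[t := Suc (ks ! t)]) z"
  using assms
proof (induction ks arbitrary: j t i)
  case (Cons k ks)
  have sub: "blocks K (Suc j) ks z \<in> gsimplices K" "fst (blocks K (Suc j) ks z) = j + sum_list ks"
    using blocks_closed[of z "Suc j" ks] Cons.prems by auto
  show ?case
  proof (cases t)
    case 0
    have "gdegen K i (blocks K j (k # ks) z) = (gdegen K j ^^ Suc (k - 1)) (blocks K (Suc j) ks z)"
      using Cons.prems 0 sub by (subst gdegen_gdegen_pow_same[symmetric]) auto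
    then show ?thesis using 0 Cons.prems by (cases k) auto
  next
    case (Suc t')
    have le: "sum_list (take (Suc t') ks) \<le> sum_list ks"
      by (metis append_take_drop_id le_add1 sum_list_append)
    have IH: "gdegen K i' (blocks K (Suc j) ks z) = blocks K (Suc j) (ks[t' := Suc (ks ! t')]) z"
      if "i' = Suc i - k" for i'
      by (rule Cons.IH) (use Cons.prems Suc that in auto)
    show ?thesis
    proof (cases "k = 0")
      case True
      have pos: "sum_list ks > 0" using le Cons.prems Suc True by simp
      have "gdegen K i (gface K j (blocks K (Suc j) ks z)) = gface K j (gdegen K (Suc i) (blocks K (Suc j) ks z))"
      proof -
        let ?w = "blocks K (Suc j) ks z"
        have "fst ?w \<noteq> 0" using sub(2) pos by linarith
        then obtain m x where w: "?w = (Suc m, x)" "x \<in> simplices K (Suc m)"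
          using sub(1) by (cases ?w; cases "fst ?w") (auto simp: gsimplices_def)
        have "j < Suc i" "Suc i \<le> Suc m"
          using Cons.prems Suc True le sub(2) w by auto
        then show ?thesis
          using w face_degen_less[of x m j "Suc i"] by (simp add: gface_def gdegen_def)
      qed
      then show ?thesis using True Suc IH[of "Suc i"] by simp
    next
      case False
      have "gdegen K i ((gdegen K j ^^ (k - 1)) (blocks K (Suc j) ks z)) =
          (gdegen K j ^^ (k - 1)) (gdegen K (i - (k - 1)) (blocks K (Suc j) ks z))"
        by (rule gdegen_gdegen_pow) (use Cons.prems Suc False sub le in auto)
      then show ?thesis using False Suc IH[of "i - (k - 1)"] by simp
    qed
  qed
qed simp

text \<open>Deleting a position lowers the multiplicity of its vertex. The last assumption says that
  at least two positions exist, so that the simplex has a face to take.\<close>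

lemma gface_blocks:
  assumes "z \<in> gsimplices K" "j + length ks = Suc (fst z)" "t < length ks"
    and "j + sum_list (take t ks) \<le> i" "i < j + sum_list (take (Suc t) ks)"
    and "2 \<le> j + sum_list ks"
  shows "gface K i (blocks K j ks z) = blocks K j (ks[t := ks ! t - 1]) z"
  using assms
proof (induction ks arbitrary: j t i)
  case (Cons k ks)
  have sub: "blocks K (Suc j) ks z \<in> gsimplices K" "fst (blocks K (Suc j) ks z) = j + sum_list ks"
    using blocks_closed[of z "Suc j" ks] Cons.prems by auto
  show ?case
  proof (cases t)
    case 0
    show ?thesis
    proof (cases "k = 1")
      case True
      then have "i = j" using 0 Cons.prems by simp
      then show ?thesis using 0 True by simp
    next
      case False
      then obtain k' where k: "k = Suc (Suc k')"
        using Cons.prems 0 by (metis One_nat_def add.right_neutral le_less_trans less_irrefl_nat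
            not0_implies_Suc sum_list.Nil take0 take_Suc_Cons sum_list_simps(2) add_0)
      then have "gface K i (blocks K j (k # ks) z) = (gdegen K j ^^ k') (blocks K (Suc j) ks z)"
        using gface_gdegen_pow_same[of "blocks K (Suc j) ks z" j i k'] Cons.prems 0 sub by simp
      then show ?thesis using 0 k by simp
    qed
  next
    case (Suc t')
    have le: "sum_list (take (Suc t') ks) \<le> sum_list ks"
      by (metis append_take_drop_id le_add1 sum_list_append)
    have IH: "gface K i' (blocks K (Suc j) ks z) = blocks K (Suc j) (ks[t' := ks ! t' - 1]) z"
      if "i' = Suc i - k" for i'
      by (rule Cons.IH) (use Cons.prems Suc that le in auto)
    show ?thesis
    proof (cases "k = 0")
      case True
      have "gface K i (gface K j (blocks K (Suc j) ks z)) = gface K j (gface K (Suc i) (blocks K (Suc j) ks z))"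
        by (rule gface_gface) (use Cons.prems Suc True sub le in auto)
      then show ?thesis using True Suc IH[of "Suc i"] by simp
    next
      case False
      have "gface K i ((gdegen K j ^^ (k - 1)) (blocks K (Suc j) ks z)) =
          (gdegen K j ^^ (k - 1)) (gface K (i - (k - 1)) (blocks K (Suc j) ks z))"
        by (rule gface_gdegen_pow) (use Cons.prems Suc False sub le in auto)
      then show ?thesis using False Suc IH[of "i - (k - 1)"] by simp
    qed
  qed
qed simp

end

text \<open>Turns the partial sums of multiplicities, which bound the blocks in
  \<open>gdegen_blocks\<close> and \<open>gface_blocks\<close>, into counts of small
  entries.\<close>

lemma sum_list_count_list_upt:
  "sum_list (map (count_list vs) [0..<t]) = length (filter (\<lambda>x. x < t) vs)"
proof (induction vs)
  case (Cons v vs)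
  have "map (count_list (v # vs)) [0..<t] = map (\<lambda>s. (if v = s then 1 else 0) + count_list vs s) [0..<t]"
    by simp
  then have "sum_list (map (count_list (v # vs)) [0..<t]) =
      (\<Sum>s\<leftarrow>[0..<t]. if v = s then 1 else 0) + sum_list (map (count_list vs) [0..<t])"
    by (simp only: sum_list_addf)
  moreover have "(\<Sum>s\<leftarrow>[0..<t]. if v = s then 1 else 0) = (if v < t then 1 else (0::nat))"
    by (simp add: sum_list_distinct_conv_sum_set)
  moreover have "length (filter (\<lambda>x. x < t) (v # vs)) =
      (if v < t then 1 else 0) + length (filter (\<lambda>x. x < t) vs)"
    by simp
  ultimately show ?case using Cons.IH by (simp only:)
qed (simp add: sum_list_0)

text \<open>In a sorted list the entries below \<open>vs ! i\<close> all stand before position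
  \<open>i\<close>, and the first \<open>i + 1\<close> entries are at most \<open>vs ! i\<close>. So
  position \<open>i\<close> lies in the block of the vertex \<open>vs ! i\<close>.\<close>

lemma filter_less_le_nth:
  assumes "sorted vs" "i < length vs"
  shows "length (filter (\<lambda>x. x < vs ! i) vs) \<le> i" "i < length (filter (\<lambda>x. x < Suc (vs ! i)) vs)"
proof -
  have "{k. k < length vs \<and> vs ! k < vs ! i} \<subseteq> {..<i}"
    using assms by (metis (mono_tags, lifting) leD lessThan_iff mem_Collect_eq not_le_imp_less sorted_nth_mono subsetI)
  from card_mono[OF _ this] show "length (filter (\<lambda>x. x < vs ! i) vs) \<le> i"
    by (simp add: length_filter_conv_card)
  have "{..i} \<subseteq> {k. k < length vs \<and> vs ! k < Suc (vs ! i)}"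
    using assms by (auto simp: less_Suc_eq_le intro: sorted_nth_mono)
  from card_mono[OF _ this] show "i < length (filter (\<lambda>x. x < Suc (vs ! i)) vs)"
    by (simp add: length_filter_conv_card)
qed

lemma count_list_duplicate:
  assumes "i < length vs"
  shows "count_list (take (Suc i) vs @ drop i vs) s = count_list vs s + (if vs ! i = s then 1 else 0)"
proof -
  have "count_list vs s = count_list (take (Suc i) vs @ drop (Suc i) vs) s"
    by simp
  moreover have "drop i vs = vs ! i # drop (Suc i) vs"
    using assms by (simp add: Cons_nth_drop_Suc)
  ultimately show ?thesis by (simp del: append_take_drop_id)
qed

lemma count_list_remove:
  assumes "i < length vs"
  shows "count_list (take i vs @ drop (Suc i) vs) s = count_list vs s - (if vs ! i = s then 1 else 0)"
proof -
  have "count_list vs s = count_list (take i vs @ vs ! i # drop (Suc i) vs) s"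
    using assms by (simp add: id_take_nth_drop[symmetric])
  then show ?thesis by (simp del: append_take_drop_id)
qed

text \<open>The monotone map that collapses the edges \<open>{c, c + 1}\<close> with \<open>c \<in> C\<close>; it belongs to \<open>s_C\<close>.\<close>

definition squash :: "nat set \<Rightarrow> nat \<Rightarrow> nat" where
  "squash C t = t - card {c \<in> C. c < t}"

lemma card_less_le: "card {c \<in> C. c < t} \<le> (t::nat)"
  using card_mono[of "{..<t}" "{c \<in> C. c < t}"] by (auto simp: subset_iff)

lemma squash_Suc: "squash C (Suc t) = (if t \<in> C then squash C t else Suc (squash C t))"
proof (cases "t \<in> C")
  case True
  then have "{c \<in> C. c < Suc t} = insert t {c \<in> C. c < t}" by (auto simp: less_Suc_eq)
  then show ?thesis using True by (simp add: squash_def)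
next
  case False
  then have "{c \<in> C. c < Suc t} = {c \<in> C. c < t}" by (auto simp: less_Suc_eq)
  then show ?thesis using False card_less_le[of C t] by (simp add: squash_def Suc_diff_le)
qed

lemma squash_mono: "mono (squash C)"
  by (simp add: mono_iff_le_Suc squash_Suc)

lemma squash_const: "s \<le> t \<Longrightarrow> {s..<t} \<subseteq> C \<Longrightarrow> squash C t = squash C s"
  by (induction t rule: dec_induct) (auto simp: squash_Suc subset_iff)

text \<open>The \<open>min\<close> unites three cases: the identity up to \<open>b\<close>, the
  constant \<open>b\<close> along the collapsed block, and a translation by \<open>q\<close> after
  it.\<close>

lemma squash_interval: "squash {b..<b + q} t = t - min q (t - b)"
proof -
  have "{c \<in> {b..<b + q}. c < t} = {b..<min (b + q) t}" by auto
  moreover have "min (b + q) t - b = min q (t - b)" by arith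
  ultimately show ?thesis unfolding squash_def by (simp only: card_atLeastLessThan)
qed

lemma squash_diff: "finite C \<Longrightarrow> C \<subseteq> {..<t} \<Longrightarrow> squash C t = t - card C"
  unfolding squash_def by (rule arg_cong[where f="\<lambda>C. t - card C"]) auto

context simplicial_set
begin

section \<open>Faces and degeneracies as operations on vertex lists\<close>

lemma sum_list_count_list:
  "sorted vs \<Longrightarrow> set vs \<subseteq> {..m} \<Longrightarrow> sum_list (map (count_list vs) [0..<Suc m]) = length vs"
  unfolding sum_list_count_list_upt
  by (rule arg_cong[where f=length]) (auto simp: filter_id_conv less_Suc_eq_le)

lemma act_closed:
  assumes "z \<in> gsimplices K" "sorted vs" "set vs \<subseteq> {..fst z}" "vs \<noteq> []"
  shows "act K vs z \<in> gsimplices K" and fst_act: "fst (act K vs z) = length vs - 1"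
  using blocks_closed[of z 0 "map (count_list vs) [0..<Suc (fst z)]"] assms
  by (simp_all add: act_def sum_list_count_list del: upt_Suc)

text \<open>Both \<open>take (Suc i) vs\<close> and \<open>drop i vs\<close> contain the entry
  \<open>i\<close>, so the new list repeats it. Together with \<open>gface_act\<close>, which
  deletes an entry, this is how the simplicial identities enter all later arguments.\<close>

lemma gdegen_act:
  assumes z: "z \<in> gsimplices K" and vs: "sorted vs" "set vs \<subseteq> {..fst z}" and i: "i < length vs"
  shows "gdegen K i (act K vs z) = act K (take (Suc i) vs @ drop i vs) z"
proof -
  let ?t = "vs ! i" and ?m = "fst z"
  have t: "?t \<le> ?m" using vs i by (meson atMost_iff nth_mem subsetD)
  have tk: "take s (map (count_list vs) [0..<Suc ?m]) = map (count_list vs) [0..<s]" if "s \<le> Suc ?m" for s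
    using that by (simp add: take_map del: upt_Suc)
  have "gdegen K i (act K vs z) =
      blocks K 0 ((map (count_list vs) [0..<Suc ?m])[?t := Suc (map (count_list vs) [0..<Suc ?m] ! ?t)]) z"
    unfolding act_def
    by (rule gdegen_blocks[OF z]) (use t filter_less_le_nth[OF vs(1) i] in
      \<open>auto simp: tk sum_list_count_list_upt simp del: upt_Suc\<close>)
  also have "(map (count_list vs) [0..<Suc ?m])[?t := Suc (map (count_list vs) [0..<Suc ?m] ! ?t)] =
      map (count_list (take (Suc i) vs @ drop i vs)) [0..<Suc ?m]"
    using t by (intro nth_equalityI) (auto simp: nth_list_update count_list_duplicate[OF i] simp del: upt_Suc count_list_append)
  finally show ?thesis by (simp add: act_def del: upt_Suc)
qed

lemma gface_act:
  assumes z: "z \<in> gsimplices K" and vs: "sorted vs" "set vs \<subseteq> {..fst z}" and i: "i < length vs"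
    and len: "2 \<le> length vs"
  shows "gface K i (act K vs z) = act K (take i vs @ drop (Suc i) vs) z"
proof -
  let ?t = "vs ! i" and ?m = "fst z"
  have t: "?t \<le> ?m" using vs i by (meson atMost_iff nth_mem subsetD)
  have tk: "take s (map (count_list vs) [0..<Suc ?m]) = map (count_list vs) [0..<s]" if "s \<le> Suc ?m" for s
    using that by (simp add: take_map del: upt_Suc)
  have "gface K i (act K vs z) =
      blocks K 0 ((map (count_list vs) [0..<Suc ?m])[?t := map (count_list vs) [0..<Suc ?m] ! ?t - 1]) z"
    unfolding act_def
    by (rule gface_blocks[OF z]) (use t len filter_less_le_nth[OF vs(1) i] sum_list_count_list[OF vs] in
      \<open>auto simp: tk sum_list_count_list_upt simp del: upt_Suc\<close>)
  also have "(map (count_list vs) [0..<Suc ?m])[?t := map (count_list vs) [0..<Suc ?m] ! ?t - 1] =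
      map (count_list (take i vs @ drop (Suc i) vs)) [0..<Suc ?m]"
    using t by (intro nth_equalityI) (auto simp: nth_list_update count_list_remove[OF i] simp del: upt_Suc count_list_append)
  finally show ?thesis by (simp add: act_def del: upt_Suc)
qed

lemma count_list_upt: "count_list [0..<n] s = (if s < n then 1 else 0)"
  by (induction n) auto

lemma blocks_ones: "blocks K j (replicate k (Suc 0)) z = z"
  by (induction k arbitrary: j) auto

lemma act_id: "act K [0..<Suc (fst z)] z = z"
proof -
  have "map (count_list [0..<Suc (fst z)]) [0..<Suc (fst z)] = replicate (Suc (fst z)) 1"
    by (intro nth_equalityI) (auto simp: count_list_upt simp del: upt_Suc replicate_Suc)
  then show ?thesis by (simp add: act_def blocks_ones del: upt_Suc replicate_Suc)
qed

text \<open>A sorted list with a repetition has two equal neighbours; deleting one of them gives a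
  list from which \<open>s_i\<close> restores the original.\<close>

lemma act_degenerate:
  assumes z: "z \<in> gsimplices K" and vs: "sorted vs" "set vs \<subseteq> {..fst z}" and "\<not> distinct vs"
  shows "act K vs z \<in> degenerate_simplices K"
proof -
  obtain i where i: "Suc i < length vs" "vs ! i = vs ! Suc i"
  proof (rule ccontr)
    assume "\<not> thesis"
    then have "\<forall>i. Suc i < length vs \<longrightarrow> vs ! i < vs ! Suc i"
      using that vs(1) by (metis Suc_lessD le_neq_implies_less lessI less_imp_le sorted_nth_mono)
    then have "sorted_wrt (<) vs"
      by (simp add: sorted_wrt_iff_nth_Suc_transp)
    then show False using assms(4) by (simp add: strict_sorted_iff)
  qed
  let ?ws = "take i vs @ drop (Suc i) vs"
  have ws: "sorted ?ws" "set ?ws \<subseteq> {..fst z}" "i < length ?ws"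
  proof -
    have "sorted (take i vs @ vs ! i # drop (Suc i) vs)"
      using vs(1) i(1) by (simp add: id_take_nth_drop[symmetric])
    then show "sorted ?ws" by (auto simp: sorted_append)
    show "set ?ws \<subseteq> {..fst z}" using vs(2) by (auto dest: in_set_takeD in_set_dropD)
    show "i < length ?ws" using i(1) by simp
  qed
  have "take (Suc i) ?ws @ drop i ?ws = take i vs @ vs ! Suc i # drop (Suc i) vs"
    using i(1) by (simp add: take_Suc_conv_app_nth nth_append)
  also have "\<dots> = vs"
    using i by (metis Suc_lessD id_take_nth_drop)
  finally have "act K vs z = gdegen K i (act K ?ws z)"
    using gdegen_act[OF z ws] by simp
  moreover have "?ws \<noteq> []" using i by auto
  moreover from this have "act K ?ws z \<in> gsimplices K" "i \<le> fst (act K ?ws z)"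
    using act_closed[OF z ws(1,2)] fst_act[OF z ws(1,2)] ws(3) by auto
  ultimately show ?thesis
    by (simp add: gdegen_degenerate)
qed

text \<open>The indices increase and the largest face acts first, so each later index still denotes
  the same position as in the original list. Hence the faces delete exactly the entries at the
  positions \<open>fs\<close>.\<close>

lemma faces_act:
  assumes z: "z \<in> gsimplices K" and vs: "sorted vs" "set vs \<subseteq> {..fst z}"
    and "sorted_wrt (<) fs" "set fs \<subseteq> {..<length vs}" "length fs < length vs"
  shows "faces K fs (act K vs z) = act K (map ((!) vs) (filter (\<lambda>t. t \<notin> set fs) [0..<length vs])) z"
  using assms(4-)
proof (induction fs)
  case Nil
  then show ?case by (simp add: faces_def map_nth)
next
  case (Cons f fs)
  let ?us = "map ((!) vs) (filter (\<lambda>t. t \<notin> set fs) [0..<length vs])"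
  have f: "f < length vs" using Cons.prems by simp
  have split: "filter (\<lambda>t. t \<notin> set fs) [0..<length vs] =
      [0..<f] @ f # filter (\<lambda>t. t \<notin> set fs) [Suc f..<length vs]"
  proof -
    have "[0..<length vs] = [0..<f] @ f # [Suc f..<length vs]"
      using f upt_add_eq_append[of 0 f "length vs - f"] by (simp add: upt_conv_Cons)
    moreover have "filter (\<lambda>t. t \<notin> set fs) [0..<f] = [0..<f]"
      using Cons.prems by (auto simp: filter_id_conv)
    moreover have "f \<notin> set fs" using Cons.prems by auto
    ultimately show ?thesis by simp
  qed
  have split': "filter (\<lambda>t. t \<notin> set (f # fs)) [0..<length vs] =
      [0..<f] @ filter (\<lambda>t. t \<notin> set fs) [Suc f..<length vs]"
  proof -
    have "filter (\<lambda>t. t \<notin> set (f # fs)) [0..<length vs] =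
        filter (\<lambda>t. t \<noteq> f) (filter (\<lambda>t. t \<notin> set fs) [0..<length vs])"
      by (simp add: conj_commute cong: conj_cong)
    then show ?thesis by (simp add: split) (auto simp: filter_id_conv intro!: filter_cong)
  qed
  have len: "length ?us \<ge> 2"
  proof -
    have "length ?us = card ({..<length vs} - set fs)"
      by (simp add: distinct_length_filter Int_def set_diff_eq conj_commute lessThan_def)
    also have "\<dots> = length vs - length fs"
      using Cons.prems by (subst card_Diff_subset) (auto simp: distinct_card strict_sorted_iff)
    finally show ?thesis using Cons.prems by simp
  qed
  have us: "sorted ?us" "set ?us \<subseteq> {..fst z}"
  proof -
    have "sorted_wrt (<) (filter (\<lambda>t. t \<notin> set fs) [0..<length vs])"
      by (intro sorted_wrt_filter sorted_wrt_upt)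
    then show "sorted ?us"
      unfolding sorted_map
      by (rule sorted_wrt_mono_rel[rotated]) (use vs(1) in \<open>auto intro!: sorted_nth_mono\<close>)
    show "set ?us \<subseteq> {..fst z}" using vs(2) by (auto simp: subset_iff)
  qed
  have "faces K (f # fs) (act K vs z) = gface K f (act K ?us z)"
    using Cons by (simp add: faces_def)
  also have "\<dots> = act K (take f ?us @ drop (Suc f) ?us) z"
    by (rule gface_act[OF z us _ len]) (simp add: split)
  also have "take f ?us @ drop (Suc f) ?us = map ((!) vs) (filter (\<lambda>t. t \<notin> set (f # fs)) [0..<length vs])"
    unfolding split split' by simp
  finally show ?case .
qed

text \<open>The smallest degeneracy acts first, so the induction adds a new maximum
  \<open>c\<close>. Positions up to \<open>c\<close> are untouched by it, and positions beyond
  \<open>c\<close> have all of \<open>C\<close> below them. The bound on \<open>C\<close> makes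
  every index a valid position.\<close>

lemma degens_act:
  assumes z: "z \<in> gsimplices K" and vs: "sorted vs" "set vs \<subseteq> {..fst z}" "vs \<noteq> []"
    and "finite C" "C \<subseteq> {..<length vs + card C - 1}"
  shows "degens K C (act K vs z) =
    act K (map (\<lambda>t. vs ! squash C t) [0..<length vs + card C]) z"
  using assms(5-)
proof (induction C rule: finite_linorder_max_induct)
  case empty
  then show ?case by (simp add: degens_def map_nth squash_def)
next
  case (insert c C)
  let ?us = "map (\<lambda>t. vs ! squash C t) [0..<length vs + card C]"
  have cC: "c \<notin> C" using insert.hyps by auto
  have c: "c < length vs + card C"
    using insert cC by auto
  have C: "C \<subseteq> {..<length vs + card C - 1}"
    using insert.hyps c by fastforce
  have bound: "squash C t < length vs" if "t < length vs + card C" for t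
  proof -
    have "squash C t \<le> squash C (length vs + card C - 1)"
      using that by (intro monoD[OF squash_mono]) simp
    also have "\<dots> = length vs - 1"
      using C insert.hyps(1) by (simp add: squash_diff)
    finally show ?thesis using vs(3) by (cases vs) auto
  qed
  have us: "sorted ?us" "set ?us \<subseteq> {..fst z}"
  proof -
    show "sorted ?us"
      by (simp add: sorted_iff_nth_mono) (auto intro!: sorted_nth_mono vs(1) monoD[OF squash_mono] bound)
    show "set ?us \<subseteq> {..fst z}" using bound vs(2) by (auto simp: subset_iff)
  qed
  have "degens K (insert c C) (act K vs z) = gdegen K c (degens K C (act K vs z))"
  proof -
    have "sorted_list_of_set (insert c C) = sorted_list_of_set C @ [c]"
      using insert.hyps cC by (simp add: sorted_insort_is_snoc less_imp_le)
    then show ?thesis by (simp add: degens_def)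
  qed
  also have "\<dots> = gdegen K c (act K ?us z)"
    using insert.IH C by simp
  also have "\<dots> = act K (take (Suc c) ?us @ drop c ?us) z"
    by (rule gdegen_act[OF z us]) (use c in simp)
  also have "take (Suc c) ?us @ drop c ?us =
      map (\<lambda>t. vs ! squash (insert c C) t) [0..<length vs + card (insert c C)]"
  proof (rule nth_equalityI)
    show "length (take (Suc c) ?us @ drop c ?us) =
        length (map (\<lambda>t. vs ! squash (insert c C) t) [0..<length vs + card (insert c C)])"
      using c cC insert.hyps(1) by simp
    fix t assume "t < length (take (Suc c) ?us @ drop c ?us)"
    then have t: "t < Suc (length vs + card C)" using c by simp
    show "(take (Suc c) ?us @ drop c ?us) ! t =
        map (\<lambda>t. vs ! squash (insert c C) t) [0..<length vs + card (insert c C)] ! t"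
    proof (cases "t \<le> c")
      case True
      then have "{d \<in> insert c C. d < t} = {d \<in> C. d < t}" by auto
      then show ?thesis using True c t cC insert.hyps(1)
        by (simp add: nth_append squash_def del: upt_Suc)
    next
      case False
      then have "{d \<in> insert c C. d < t} = insert c C" "{d \<in> C. d < t - 1} = C"
        using insert.hyps by fastforce+
      then show ?thesis using False c t cC insert.hyps(1)
        by (simp add: nth_append squash_def del: upt_Suc)
    qed
  qed
  finally show ?case .
qed

end

section \<open>Vertices of face-intervals\<close>

lemma fold_gdegen_power:
  "fold (gdegen (sset_power n K)) L (m, xs) = (m + length L, map (\<lambda>x. snd (fold (gdegen K) L (m, x))) xs)"
proof (induction L arbitrary: m xs)
  case (Cons i L)
  then show ?case by (simp add: gdegen_def sset_power_def comp_def)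
qed simp

lemma fst_fold_gdegen: "fst (fold (gdegen K) L z) = fst z + length L"
  by (induction L arbitrary: z) auto

lemma degens_power:
  "finite C \<Longrightarrow> degens (sset_power n K) C (m, xs) = (m + card C, map (\<lambda>x. snd (degens K C (m, x))) xs)"
  by (simp add: degens_def fold_gdegen_power)

lemma fst_degens: "finite C \<Longrightarrow> fst (degens K C z) = fst z + card C"
  by (simp add: degens_def fst_fold_gdegen)

lemma fst_faces: "fst (faces K fs z) = fst z - length fs"
  by (induction fs) (auto simp: faces_def)

lemma faces_power:
  "faces (sset_power n K) fs (m, xs) = (m - length fs, map (\<lambda>x. snd (faces K fs (m, x))) xs)"
proof (induction fs)
  case (Cons i fs)
  have "gface K i z = (fst z - 1, face K (fst z) i (snd z))" for z
    by (simp add: gface_def split: prod.split)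
  then have "snd (faces K (i # fs) (m, x)) = face K (m - length fs) i (snd (faces K fs (m, x)))" for x
    using fst_faces[of K fs "(m, x)"] by (simp add: faces_def)
  then show ?case using Cons by (simp add: faces_def gface_def sset_power_def comp_def)
qed (simp add: faces_def)

section \<open>Interval partitions and the vertices that they select\<close>

lemma interval_partitionsD:
  assumes "is \<in> interval_partitions m N"
  shows interval_partitions_length: "length is = Suc N"
    and interval_partitions_0: "is ! 0 = 0"
    and interval_partitions_last: "is ! N = m"
    and interval_partitions_mono: "i \<le> j \<Longrightarrow> j \<le> N \<Longrightarrow> is ! i \<le> is ! j"
    and interval_partitions_le: "j \<le> N \<Longrightarrow> is ! j \<le> m"
proof -
  show *: "length is = Suc N" "is ! 0 = 0" "is ! N = m"
    using assms by (auto simp: interval_partitions_def)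
  show mono: "is ! i \<le> is ! j" if "i \<le> j" "j \<le> N" for i j
    using assms that by (auto simp: interval_partitions_def intro: sorted_nth_mono)
  show "is ! j \<le> m" if "j \<le> N" using mono[of j N] that * by simp
qed

lemma interval_partitionsI:
  assumes "length is = Suc N" "\<And>i. i < N \<Longrightarrow> is ! i \<le> is ! Suc i" "is ! 0 = 0" "is ! N = m"
  shows "is \<in> interval_partitions m N"
  using assms by (auto simp: interval_partitions_def sorted_iff_nth_Suc)

lemma finite_interval_partitions: "finite (interval_partitions m N)"
proof (rule finite_subset)
  show "interval_partitions m N \<subseteq> {is. set is \<subseteq> {..m} \<and> length is = Suc N}"
  proof
    fix "is" assume "is \<in> interval_partitions m N"
    then show "is \<in> {is. set is \<subseteq> {..m} \<and> length is = Suc N}"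
      using interval_partitions_le interval_partitions_length
      by (fastforce simp: in_set_conv_nth less_Suc_eq_le)
  qed
qed (rule finite_lists_length_eq, simp)

text \<open>The least \<open>k\<close> with \<open>t < is ! k\<close> does it: the edge from
  \<open>t\<close> to \<open>t + 1\<close> lies in interval \<open>k\<close>. Empty intervals own no
  edge.\<close>

lemma interval_partitions_owner:
  assumes "is \<in> interval_partitions m N" "t < m"
  obtains k where "k \<in> {1..N}" "is ! (k - 1) \<le> t" "t < is ! k"
proof -
  define k where "k = (LEAST k. t < is ! k)"
  have ex: "t < is ! N" using assms interval_partitions_last by metis
  have k: "t < is ! k" "k \<le> N"
    unfolding k_def by (rule LeastI[of _ N], rule ex) (rule Least_le, rule ex)
  have "k \<noteq> 0" using k assms interval_partitions_0 by (metis less_zeroE)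
  then have "\<not> t < is ! (k - 1)"
    unfolding k_def by (intro not_less_Least) simp
  then show ?thesis using that[of k] k \<open>k \<noteq> 0\<close> by simp
qed

text \<open>The half-open interval counts edges, while the face-interval keeps the vertices of these
  edges. Hence both ends are included, and an empty interval still contributes one vertex.\<close>

definition vertices :: "nat list \<Rightarrow> nat set \<Rightarrow> nat set" where
  "vertices is A = (\<Union>k\<in>A. {is ! (k - 1)..is ! k})"

lemma vertices_le:
  assumes "is \<in> interval_partitions m N" "A \<subseteq> {1..N}"
  shows "vertices is A \<subseteq> {..m}"
  using assms interval_partitions_le[OF assms(1)] by (fastforce simp: vertices_def)

lemma endpoints_in_vertices:
  assumes "is \<in> interval_partitions m N" "A \<subseteq> {1..N}" "k \<in> A"
  shows "is ! (k - 1) \<in> vertices is A" "is ! k \<in> vertices is A"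
  using assms interval_partitions_mono[OF assms(1), of "k - 1" k]
  by (auto simp: vertices_def intro!: bexI[of _ k])

text \<open>As each interval ends strictly before the next one begins, the gaps have honest lists of
  indices between them, and the deleted indices are the complement of the intervals.\<close>

lemma face_indices_eq_filter:
  assumes "sorted_wrt (\<lambda>(i, j) (i', j'). j < i') ivs" "\<forall>(i, j)\<in>set ivs. a \<le> i \<and> i \<le> j \<and> j \<le> m"
  shows "face_indices m a ivs = filter (\<lambda>t. t \<notin> (\<Union>(i, j)\<in>set ivs. {i..j})) [a..<m + 1]"
  using assms
proof (induction ivs arbitrary: a)
  case (Cons iv ivs)
  obtain i j where iv: "iv = (i, j)" by (cases iv)
  have le: "a \<le> i" "i \<le> j" "j \<le> m" using Cons.prems by (auto simp: iv)
  have gt: "j < i'" "i' \<le> j'" "j' \<le> m" if "(i', j') \<in> set ivs" for i' j'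
    using Cons.prems that by (fastforce simp: iv)+
  have IH: "face_indices m (j + 1) ivs = filter (\<lambda>t. t \<notin> (\<Union>(i, j)\<in>set ivs. {i..j})) [j + 1..<m + 1]"
    by (rule Cons.IH) (use Cons.prems gt in \<open>fastforce simp: iv\<close>)+
  have split: "[a..<m + 1] = [a..<i] @ [i..<j + 1] @ [j + 1..<m + 1]"
    using le upt_add_eq_append[of a i "m + 1 - i"] upt_add_eq_append[of i "j + 1" "m - j"] by simp
  let ?P = "\<lambda>t. t \<notin> (\<Union>(i, j)\<in>set (iv # ivs). {i..j})"
  have "filter ?P [a..<i] = [a..<i]"
    using le gt by (fastforce simp: filter_id_conv iv)
  moreover have "filter ?P [i..<j + 1] = []"
    by (auto simp: filter_empty_conv iv)
  moreover have "filter ?P [j + 1..<m + 1] = filter (\<lambda>t. t \<notin> (\<Union>(i, j)\<in>set ivs. {i..j})) [j + 1..<m + 1]"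
    by (rule filter_cong) (auto simp: iv)
  ultimately show ?case
    by (simp only: iv face_indices.simps IH split filter_append append_Nil)
qed simp

lemma filter_upt_eq_sorted_list_of_set:
  "V \<subseteq> {..<m} \<Longrightarrow> filter (\<lambda>t. t \<in> V) [0..<m] = sorted_list_of_set V"
  using finite_subset[of V "{..<m}"]
  by (intro sorted_distinct_set_unique) (auto intro: sorted_wrt_filter sorted_filter[where f=id, simplified])

lemma mono_image_sorted_list:
  assumes "finite V" "mono f" "inj_on f V"
  shows "map f (sorted_list_of_set V) = sorted_list_of_set (f ` V)"
proof (rule sorted_distinct_set_unique)
  show "sorted (map f (sorted_list_of_set V))"
    unfolding sorted_map
    by (rule sorted_wrt_mono_rel[OF _ sorted_sorted_list_of_set]) (use assms(2) in \<open>auto dest: monoD\<close>)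
qed (use assms in \<open>auto simp: distinct_map\<close>)

text \<open>One of two sources of a repeated vertex: the gap between two intervals of a variable is
  collapsed, although separation makes its ends distinct. The other source,
  \<open>not_inj_on_vertices_edge\<close>, is a collapsed edge inside an interval.\<close>

lemma not_inj_on_vertices:
  assumes "is \<in> interval_partitions m N" "A \<subseteq> {1..N}" "separated is A"
    and "j \<in> A" "k \<in> A" "j < k" "f (is ! j) = f (is ! (k - 1))"
  shows "\<not> inj_on f (vertices is A)"
proof
  assume "inj_on f (vertices is A)"
  then have "is ! j = is ! (k - 1)"
    using endpoints_in_vertices[OF assms(1,2)] assms by (meson inj_onD)
  moreover have "is ! j < is ! (k - 1)" using assms(3-6) by (auto simp: separated_def)
  ultimately show False by simp
qed

lemma not_inj_on_vertices_edge:
  assumes "k \<in> A" "is ! (k - 1) \<le> t" "t < is ! k" "f t = f (Suc t)"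
  shows "\<not> inj_on f (vertices is A)"
proof
  assume "inj_on f (vertices is A)"
  moreover have "t \<in> vertices is A" "Suc t \<in> vertices is A"
    using assms by (auto simp: vertices_def intro!: bexI[of _ k])
  ultimately show False using assms(4) by (auto dest: inj_onD)
qed

text \<open>These two sources are the only ones: \<open>step\<close> keeps the vertices of one
  interval apart, and \<open>gap\<close> with monotonicity those of different intervals.\<close>

lemma inj_on_vertices:
  assumes "is \<in> interval_partitions m N" "A \<subseteq> {1..N}" "mono f"
    and step: "\<And>k t. k \<in> A \<Longrightarrow> is ! (k - 1) \<le> t \<Longrightarrow> t \<le> is ! k \<Longrightarrow>
      f t = f (is ! (k - 1)) + (t - is ! (k - 1))"
    and gap: "\<And>j k. j \<in> A \<Longrightarrow> k \<in> A \<Longrightarrow> j < k \<Longrightarrow> f (is ! j) < f (is ! (k - 1))"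
  shows "inj_on f (vertices is A)"
proof -
  have "f s < f t" if s: "s \<in> vertices is A" and t: "t \<in> vertices is A" and st: "s < t" for s t
  proof -
    obtain j where j: "j \<in> A" "is ! (j - 1) \<le> s" "s \<le> is ! j" using s by (auto simp: vertices_def)
    obtain k where k: "k \<in> A" "is ! (k - 1) \<le> t" "t \<le> is ! k" using t by (auto simp: vertices_def)
    consider "j < k" | "j = k" | "k < j" by linarith
    then show ?thesis
    proof cases
      case 1
      have "f s \<le> f (is ! j)" "f (is ! (k - 1)) \<le> f t" using j k assms(3) by (auto dest: monoD)
      then show ?thesis using gap[OF j(1) k(1) 1] by simp
    next
      case 2
      have "f s = f (is ! (k - 1)) + (s - is ! (k - 1))" "f t = f (is ! (k - 1)) + (t - is ! (k - 1))"
        using step[of k s] step[of k t] j k 2 by auto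
      moreover have "is ! (k - 1) \<le> s" using j(2) 2 by simp
      ultimately show ?thesis using st by linarith
    next
      case 3
      have "is ! k \<le> is ! (j - 1)"
        using 3 assms(2) j(1) interval_partitions_mono[OF assms(1), of k "j - 1"] by auto
      then show ?thesis using j k st by simp
    qed
  qed
  then show ?thesis by (metis inj_onI less_irrefl linorder_neqE_nat)
qed

lemma image_interval_step:
  assumes "\<And>t. i \<le> t \<Longrightarrow> t \<le> j \<Longrightarrow> f t = f i + (t - i)" "i \<le> (j::nat)"
  shows "f ` {i..j} = {f i..f j :: nat}"
proof (intro equalityI subsetI)
  fix y assume y: "y \<in> {f i..f j}"
  then have "y = f (i + (y - f i))" "i + (y - f i) \<in> {i..j}"
    using assms(1)[of j] assms(1)[of "i + (y - f i)"] assms(2) by auto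
  then show "y \<in> f ` {i..j}" by blast
next
  fix y assume "y \<in> f ` {i..j}"
  then obtain t where t: "i \<le> t" "t \<le> j" "y = f t" by auto
  then show "y \<in> {f i..f j}" using assms(1)[of t] assms(1)[of j] by auto
qed

lemma image_vertices:
  assumes "is \<in> interval_partitions m N" "A \<subseteq> {1..N}"
    and step: "\<And>k t. k \<in> A \<Longrightarrow> is ! (k - 1) \<le> t \<Longrightarrow> t \<le> is ! k \<Longrightarrow>
      f t = f (is ! (k - 1)) + (t - is ! (k - 1))"
  shows "f ` vertices is A = (\<Union>k\<in>A. {f (is ! (k - 1))..f (is ! k)})"
proof -
  have "f ` {is ! (k - 1)..is ! k} = {f (is ! (k - 1))..f (is ! k)}" if "k \<in> A" for k
  proof (rule image_interval_step)
    show "is ! (k - 1) \<le> is ! k"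
      using that assms(2) interval_partitions_mono[OF assms(1), of "k - 1" k] by auto
  qed (rule step[OF that])
  then show ?thesis by (simp add: vertices_def image_UN)
qed

context simplicial_set
begin

text \<open>The faces delete the positions outside the chosen vertices, so of the path
  \<open>f\<close> exactly its restriction to \<open>vertices is A\<close> remains. From here on an
  entry is controlled by injectivity of \<open>f\<close> on that set.\<close>

lemma face_intervals_act:
  assumes part: "is \<in> interval_partitions M N" and A: "A \<subseteq> {1..N}" "A \<noteq> {}" "separated is A"
    and z: "z \<in> gsimplices K" and f: "mono f" "f M \<le> fst z"
  shows "face_intervals K is A (act K (map f [0..<Suc M]) z) =
    act K (map f (sorted_list_of_set (vertices is A))) z"
proof -
  let ?vs = "map f [0..<Suc M]" and ?V = "vertices is A"
  let ?ivs = "map (\<lambda>k. (is ! (k - 1), is ! k)) (sorted_list_of_set A)"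
  have finA: "finite A" using finite_subset[OF A(1)] by simp
  have vs: "sorted ?vs" "set ?vs \<subseteq> {..fst z}"
  proof -
    show "sorted ?vs"
      unfolding sorted_map by (rule sorted_wrt_mono_rel[OF _ sorted_upt]) (use f(1) in \<open>auto dest: monoD\<close>)
    have "f t \<le> fst z" if "t \<le> M" for t using f monoD[OF f(1) that] by simp
    then show "set ?vs \<subseteq> {..fst z}" by auto
  qed
  have fst: "fst (act K ?vs z) = M" using fst_act[OF z vs] by simp
  have V: "?V \<subseteq> {..M}" by (rule vertices_le[OF part A(1)])
  have UV: "(\<Union>(i, j)\<in>set ?ivs. {i..j}) = ?V" using finA by (auto simp: vertices_def)
  have "sorted_wrt (\<lambda>j k. is ! j < is ! (k - 1)) (sorted_list_of_set A)"
    by (rule sorted_wrt_mono_rel[OF _ strict_sorted_list_of_set])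
      (use A(3) finA in \<open>auto simp: separated_def\<close>)
  then have "sorted_wrt (\<lambda>(i, j) (i', j'). j < i') ?ivs"
    by (simp add: sorted_wrt_map)
  moreover have "\<forall>(i, j)\<in>set ?ivs. 0 \<le> i \<and> i \<le> j \<and> j \<le> M"
    using finA A(1) interval_partitions_mono[OF part] interval_partitions_le[OF part] by auto
  ultimately have fi: "face_indices M 0 ?ivs = filter (\<lambda>t. t \<notin> ?V) [0..<M + 1]"
    using face_indices_eq_filter[of ?ivs 0 M] unfolding UV by blast
  obtain v where v: "v \<in> ?V" using endpoints_in_vertices[OF part A(1)] A(2) by blast
  have "face_intervals K is A (act K ?vs z) = faces K (filter (\<lambda>t. t \<notin> ?V) [0..<M + 1]) (act K ?vs z)"
    by (simp only: face_intervals_def fst fi A(2) if_False)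
  also have "\<dots> = act K (map ((!) ?vs)
      (filter (\<lambda>t. t \<notin> set (filter (\<lambda>t. t \<notin> ?V) [0..<M + 1])) [0..<length ?vs])) z"
  proof (rule faces_act[OF z vs])
    show "sorted_wrt (<) (filter (\<lambda>t. t \<notin> ?V) [0..<M + 1])"
      by (intro sorted_wrt_filter sorted_wrt_upt)
    have "length (filter (\<lambda>t. t \<notin> ?V) [0..<M + 1]) < length [0..<M + 1]"
      by (rule length_filter_less[of v]) (use v V in auto)
    then show "length (filter (\<lambda>t. t \<notin> ?V) [0..<M + 1]) < length ?vs" by simp
  qed auto
  also have "filter (\<lambda>t. t \<notin> set (filter (\<lambda>t. t \<notin> ?V) [0..<M + 1])) [0..<length ?vs] =
      filter (\<lambda>t. t \<in> ?V) [0..<Suc M]"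
    by (rule filter_cong) auto
  also have "\<dots> = sorted_list_of_set ?V"
    by (rule filter_upt_eq_sorted_list_of_set) (use V in auto)
  also have "map ((!) ?vs) (sorted_list_of_set ?V) = map f (sorted_list_of_set ?V)"
    using V finite_subset[OF V] by (auto simp del: upt_Suc)
  finally show ?thesis .
qed

end

text \<open>From here on the generators are listed in the order of the variables; the permutation of the
  tensor factors is put back at the very end.\<close>

definition degenerate_tensors :: "nat \<Rightarrow> 'a sset \<Rightarrow> 'a gsimplex list set" where
  "degenerate_tensors n K = degenerate_gens (normalized_tensor_power n K)"

definition tensor_term :: "'a sset \<Rightarrow> nat \<Rightarrow> (nat \<Rightarrow> nat set) \<Rightarrow> nat \<Rightarrow> 'a list \<Rightarrow> nat list \<Rightarrow> 'a gsimplex list" where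
  "tensor_term K n J m xs is = map (\<lambda>u. face_intervals K is (J u) (m, xs ! (u - 1))) [1..<n + 1]"

text \<open>What the induction keeps of the requirements on labels: each label precedes exactly one
  variable, and every variable has at least one label, which is hypothesis (a) of the
  theorem.\<close>

definition label_partition :: "nat \<Rightarrow> nat \<Rightarrow> (nat \<Rightarrow> nat set) \<Rightarrow> bool" where
  "label_partition n N J \<longleftrightarrow> (\<forall>u\<in>{1..n}. J u \<subseteq> {1..N} \<and> J u \<noteq> {}) \<and> (\<forall>j\<in>{1..N}. \<exists>!u. u \<in> {1..n} \<and> j \<in> J u)"

lemma expression_id:
  "expression K n N id J S m xs = (\<Sum>is\<in>interval_partitions m N.
     if \<forall>u\<in>{1..n}. separated is (J u)
     then Poly_Mapping.single (tensor_term K n J m xs is) (minus_one_pow (S (interval_length is))) else 0)"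
  by (simp only: expression_def tensor_term_def id_apply)

context simplicial_set
begin

lemma tensor_term_act:
  assumes J: "label_partition n N J" and part: "is \<in> interval_partitions M N"
    and sep: "\<forall>u\<in>{1..n}. separated is (J u)"
    and y: "\<And>u. u \<in> {1..n} \<Longrightarrow> (M, ys ! (u - 1)) = act K (map (f u) [0..<Suc M]) (z u)"
    and z: "\<And>u. u \<in> {1..n} \<Longrightarrow> z u \<in> gsimplices K \<and> mono (f u) \<and> f u M \<le> fst (z u)"
  shows "tensor_term K n J M ys is =
    map (\<lambda>u. act K (map (f u) (sorted_list_of_set (vertices is (J u)))) (z u)) [1..<n + 1]"
  unfolding tensor_term_def
proof (rule map_cong[OF refl])
  fix u assume "u \<in> set [1..<n + 1]"
  then have u: "u \<in> {1..n}" by auto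
  have *: "J u \<subseteq> {1..N}" "J u \<noteq> {}" "separated is (J u)"
    using J sep u by (auto simp: label_partition_def)
  have "face_intervals K is (J u) (act K (map (f u) [0..<Suc M]) (z u)) =
      act K (map (f u) (sorted_list_of_set (vertices is (J u)))) (z u)"
    by (rule face_intervals_act[OF part *]) (use z[OF u] in blast)+
  then show "face_intervals K is (J u) (M, ys ! (u - 1)) =
      act K (map (f u) (sorted_list_of_set (vertices is (J u)))) (z u)"
    by (simp only: y[OF u])
qed

lemma act_sorted_closed:
  fixes M :: nat
  assumes "z \<in> gsimplices K" "mono f" "f M \<le> fst z" "V \<subseteq> {..M}" "V \<noteq> {}"
  shows "act K (map f (sorted_list_of_set V)) z \<in> gsimplices K"
    and "\<not> inj_on f V \<Longrightarrow> act K (map f (sorted_list_of_set V)) z \<in> degenerate_simplices K"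
proof -
  have fin: "finite V" using finite_subset[OF assms(4)] by simp
  have s: "sorted (map f (sorted_list_of_set V))"
    unfolding sorted_map by (rule sorted_wrt_mono_rel[OF _ sorted_sorted_list_of_set]) (use assms(2) in \<open>auto dest: monoD\<close>)
  have "f t \<le> fst z" if "t \<in> V" for t using assms monoD[OF assms(2), of t M] that by force
  then have b: "set (map f (sorted_list_of_set V)) \<subseteq> {..fst z}" using fin by auto
  show "act K (map f (sorted_list_of_set V)) z \<in> gsimplices K"
    by (rule act_closed[OF assms(1) s b]) (use fin assms(5) in auto)
  assume "\<not> inj_on f V"
  then show "act K (map f (sorted_list_of_set V)) z \<in> degenerate_simplices K"
    by (intro act_degenerate[OF assms(1) s b]) (use fin in \<open>auto simp: distinct_map\<close>)
qed

lemma vertices_nonempty: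
  assumes "is \<in> interval_partitions m N" "A \<subseteq> {1..N}" "A \<noteq> {}"
  shows "vertices is A \<noteq> {}"
proof -
  obtain k where "k \<in> A" using assms(3) by blast
  from endpoints_in_vertices(2)[OF assms(1,2) this] show ?thesis by blast
qed

text \<open>The source of all vanishing summands: one variable whose path repeats a vertex within
  its intervals makes the whole tuple degenerate, while the other entries need only be
  simplices.\<close>

lemma tensor_term_degenerate:
  assumes J: "label_partition n N J" and part: "is \<in> interval_partitions M N"
    and sep: "\<forall>u\<in>{1..n}. separated is (J u)"
    and y: "\<And>u. u \<in> {1..n} \<Longrightarrow> (M, ys ! (u - 1)) = act K (map (f u) [0..<Suc M]) (z u)"
    and z: "\<And>u. u \<in> {1..n} \<Longrightarrow> z u \<in> gsimplices K \<and> mono (f u) \<and> f u M \<le> fst (z u)"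
    and u: "u \<in> {1..n}" "\<not> inj_on (f u) (vertices is (J u))"
  shows "tensor_term K n J M ys is \<in> degenerate_tensors n K"
proof -
  let ?t = "\<lambda>u. act K (map (f u) (sorted_list_of_set (vertices is (J u)))) (z u)"
  have V: "vertices is (J u) \<subseteq> {..M}" "vertices is (J u) \<noteq> {}" if "u \<in> {1..n}" for u
    using J that vertices_le[OF part] vertices_nonempty[OF part] by (auto simp: label_partition_def)
  have closed: "?t u \<in> gsimplices K" if "u \<in> {1..n}" for u
    using act_sorted_closed(1)[of "z u" "f u" M "vertices is (J u)"] z[OF that] V[OF that] by blast
  have degenerate: "?t u \<in> degenerate_simplices K"
    using act_sorted_closed(2)[of "z u" "f u" M "vertices is (J u)"] z[OF u(1)] V[OF u(1)] u(2) by blast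
  have tt: "tensor_term K n J M ys is = map ?t [1..<n + 1]"
    by (rule tensor_term_act[OF J part sep y z])
  have set: "set (tensor_term K n J M ys is) = ?t ` {1..n}" and len: "length (tensor_term K n J M ys is) = n"
    unfolding tt by (auto simp del: upt_Suc)
  have "set (tensor_term K n J M ys is) \<subseteq> gsimplices K"
    unfolding set by (rule image_subsetI) (rule closed)
  moreover have "?t u \<in> set (tensor_term K n J M ys is)"
    unfolding set by (rule imageI) (rule u(1))
  then have "set (tensor_term K n J M ys is) \<inter> degenerate_simplices K \<noteq> {}"
    using degenerate by blast
  ultimately show ?thesis
    by (simp add: len degenerate_tensors_def normalized_tensor_power_def)
qed

end

section \<open>The Eilenberg--Mac Lane operator\<close>

lemma transfer_vertices:
  assumes part: "is \<in> interval_partitions m N" and A: "A \<subseteq> {1..N}" and f: "mono f"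
    and step: "\<And>k t. k \<in> A \<Longrightarrow> is ! (k - 1) \<le> t \<Longrightarrow> t \<le> is ! k \<Longrightarrow>
      f t = f (is ! (k - 1)) + (t - is ! (k - 1))"
    and rho: "strict_mono_on A rho"
    and ends: "\<And>k. k \<in> A \<Longrightarrow> is' ! rho k = f (is ! k)" "\<And>k. k \<in> A \<Longrightarrow> is' ! (rho k - 1) = f (is ! (k - 1))"
  shows separated_transfer: "separated is' (rho ` A) \<Longrightarrow> separated is A"
    and map_vertices_transfer: "separated is' (rho ` A) \<Longrightarrow>
      map f (sorted_list_of_set (vertices is A)) = sorted_list_of_set (vertices is' (rho ` A))"
    and not_inj_transfer: "separated is A \<Longrightarrow> \<not> separated is' (rho ` A) \<Longrightarrow> \<not> inj_on f (vertices is A)"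
proof -
  have gap: "f (is ! j) < f (is ! (k - 1))" if "separated is' (rho ` A)" "j \<in> A" "k \<in> A" "j < k" for j k
  proof -
    have "rho j < rho k" using rho that by (simp add: strict_mono_on_def)
    then have "is' ! rho j < is' ! (rho k - 1)" using that by (simp add: separated_def)
    then show ?thesis using ends that by simp
  qed
  show "separated is A" if "separated is' (rho ` A)"
    unfolding separated_def
  proof (intro ballI impI)
    fix j k assume "j \<in> A" "k \<in> A" "j < k"
    from gap[OF that this] show "is ! j < is ! (k - 1)"
      using monoD[OF f, of "is ! (k - 1)" "is ! j"] by (rule_tac ccontr) simp
  qed
  show "map f (sorted_list_of_set (vertices is A)) = sorted_list_of_set (vertices is' (rho ` A))"
    if sep: "separated is' (rho ` A)"
  proof -
    have fin: "finite (vertices is A)" using finite_subset[OF vertices_le[OF part A]] by simp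
    have "inj_on f (vertices is A)"
      by (rule inj_on_vertices[OF part A f]) (fact step, rule gap[OF sep])
    moreover have "f ` vertices is A = vertices is' (rho ` A)"
      by (subst image_vertices[OF part A]) (fact step, simp add: vertices_def ends del: One_nat_def)
    ultimately show ?thesis
      using mono_image_sorted_list[OF fin f] by simp
  qed
  show "\<not> inj_on f (vertices is A)" if sep: "separated is A" and nsep: "\<not> separated is' (rho ` A)"
  proof -
    obtain j k where jk: "j \<in> A" "k \<in> A" "rho j < rho k" "\<not> is' ! rho j < is' ! (rho k - 1)"
      using nsep by (auto simp: separated_def)
    have "j < k"
    proof (rule ccontr)
      assume "\<not> j < k"
      then have "rho k \<le> rho j"
        using rho jk by (cases "k = j") (auto simp: strict_mono_on_def less_imp_le)
      then show False using jk by simp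
    qed
    then have "is ! j < is ! (k - 1)" using sep jk by (simp add: separated_def)
    \<comment> \<open>Monotonicity gives one inequality, the failed separation in \<open>is'\<close>
      the other: the gap has been collapsed.\<close>
    then have "f (is ! j) = f (is ! (k - 1))"
      using jk ends monoD[OF f, of "is ! j" "is ! (k - 1)"] by simp
    then show ?thesis
      using not_inj_on_vertices[OF part A sep jk(1,2) \<open>j < k\<close>] by blast
  qed
qed

lemma squash_step: "s \<le> t \<Longrightarrow> {s..<t} \<inter> C = {} \<Longrightarrow> squash C t = squash C s + (t - s)"
proof (induction t rule: dec_induct)
  case (step t)
  have "{s..<t} \<subseteq> {s..<Suc t}" by auto
  moreover have "t \<notin> C" using step.hyps step.prems by auto
  ultimately have "t \<notin> C" "{s..<t} \<inter> C = {}" using step.prems by blast+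
  then show ?case using step by (simp add: squash_Suc)
qed simp

lemma squash_0 [simp]: "squash C 0 = 0"
  by (simp add: squash_def)

text \<open>The \<open>b\<close> elements before the removed block keep their places, and each of
  the \<open>p - b\<close> elements after it is displaced by \<open>q\<close>.\<close>

lemma sig_complement_interval:
  assumes "b \<le> p"
  shows "sig ({0..<p + q} - {b..<b + q}) = q * (p - b)"
proof -
  let ?A = "{0..<p + q} - {b..<b + q}" and ?L = "[0..<b] @ [b + q..<p + q]"
  have L: "sorted_list_of_set ?A = ?L"
    by (rule sorted_distinct_set_unique) (use assms in \<open>auto simp: sorted_append\<close>)
  then have "card ?A = length ?L"
    by (metis length_sorted_list_of_set)
  then have card: "card ?A = p" using assms by simp
  have "sig ?A = (\<Sum>i<p. ?L ! i - i)"
    by (simp only: sig_def L card)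
  also have "\<dots> = (\<Sum>i<p. if i < b then 0 else q)"
    by (rule sum.cong) (use assms in \<open>auto simp: nth_append\<close>)
  also have "\<dots> = (\<Sum>i\<in>{b..<p}. q)"
    by (rule sum.mono_neutral_cong_right) auto
  finally show ?thesis by simp
qed

lemma minus_one_pow_mult: "minus_one_pow e * (- 1) ^ s = (minus_one_pow (e + int s) :: 'r::comm_ring_1)"
  by (cases "even s") (auto simp: minus_one_pow_def)

lemma sum_interval_length:
  "i \<le> j \<Longrightarrow> (\<Sum>k = Suc i..j. interval_length is k) = int (is ! j) - int (is ! i)"
  by (induction j rule: dec_induct) (auto simp: interval_length_def)

context simplicial_set
begin

lemma degens_eq_act:
  assumes z: "z \<in> gsimplices K" and C: "finite C" "C \<subseteq> {..<fst z + card C}"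
  shows "degens K C z = act K (map (squash C) [0..<Suc (fst z + card C)]) z"
    and "squash C (fst z + card C) = fst z"
proof -
  show max: "squash C (fst z + card C) = fst z" using squash_diff[OF C] by simp
  have "degens K C (act K [0..<Suc (fst z)] z) =
      act K (map (\<lambda>t. [0..<Suc (fst z)] ! squash C t) [0..<length [0..<Suc (fst z)] + card C]) z"
    by (rule degens_act[OF z]) (use C in \<open>auto simp del: upt_Suc\<close>)
  also have "map (\<lambda>t. [0..<Suc (fst z)] ! squash C t) [0..<length [0..<Suc (fst z)] + card C] =
      map (squash C) [0..<Suc (fst z + card C)]"
  proof (rule nth_equalityI)
    fix t assume "t < length (map (\<lambda>t. [0..<Suc (fst z)] ! squash C t) [0..<length [0..<Suc (fst z)] + card C])"
    then have t: "t < Suc (fst z + card C)" by simp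
    then have "squash C t \<le> fst z"
      using monoD[OF squash_mono, of t "fst z + card C" C] max by simp
    then show "map (\<lambda>t. [0..<Suc (fst z)] ! squash C t) [0..<length [0..<Suc (fst z)] + card C] ! t =
        map (squash C) [0..<Suc (fst z + card C)] ! t"
      using t by (simp del: upt_Suc)
  qed simp
  finally show "degens K C z = act K (map (squash C) [0..<Suc (fst z + card C)]) z"
    by (simp only: act_id)
qed

lemma tensor_term_self:
  assumes "label_partition n N J" "is \<in> interval_partitions m N" "\<forall>u\<in>{1..n}. separated is (J u)"
    and "xs \<in> simplices (sset_power n K) m"
  shows "tensor_term K n J m xs is =
    map (\<lambda>u. act K (sorted_list_of_set (vertices is (J u))) (m, xs ! (u - 1))) [1..<n + 1]"
proof -
  have "tensor_term K n J m xs is =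
      map (\<lambda>u. act K (map (\<lambda>t. t) (sorted_list_of_set (vertices is (J u)))) (m, xs ! (u - 1))) [1..<n + 1]"
  proof (rule tensor_term_act[OF assms(1-3)])
    fix u assume "u \<in> {1..n}"
    then have "xs ! (u - 1) \<in> simplices K m"
      using assms(4) by (auto simp: sset_power_def subset_iff)
    then show "(m, xs ! (u - 1)) \<in> gsimplices K \<and> mono (\<lambda>t::nat. t) \<and> m \<le> fst (m, xs ! (u - 1))"
      by (auto simp: gsimplices_def mono_def)
    show "(m, xs ! (u - 1)) = act K (map (\<lambda>t. t) [0..<Suc m]) (m, xs ! (u - 1))"
      using act_id[of "(m, xs ! (u - 1))"] by (simp del: upt_Suc)
  qed
  then show ?thesis by simp
qed

end

section \<open>Removing a label and inserting an interval\<close>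

lemma label_partition_unique:
  assumes "label_partition n N J" "u \<in> {1..n}" "v \<in> {1..n}" "k \<in> J u" "k \<in> J v"
  shows "u = v"
proof -
  have "J u \<subseteq> {1..N}" using assms(1,2) by (simp add: label_partition_def)
  then have "k \<in> {1..N}" using assms(4) by blast
  then have "\<exists>!u. u \<in> {1..n} \<and> k \<in> J u" using assms(1) by (simp add: label_partition_def)
  then show ?thesis using assms by blast
qed

lemma label_partition_owner:
  assumes "label_partition n N J" "k \<in> {1..N}"
  obtains u where "u \<in> {1..n}" "k \<in> J u"
  using assms unfolding label_partition_def by blast

definition drop_label :: "nat \<Rightarrow> nat \<Rightarrow> nat" where
  "drop_label j k = (if j < k then k - 1 else k)"

text \<open>The new interval \<open>j\<close> begins at \<open>is ! (j - 1)\<close> and has length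
  \<open>q\<close>; the entries from there on take the next index and move by
  \<open>q\<close>.\<close>

definition insert_interval :: "nat \<Rightarrow> nat \<Rightarrow> nat list \<Rightarrow> nat list" where
  "insert_interval j q is = map (\<lambda>k. if k < j then is ! k else is ! (k - 1) + q) [0..<Suc (length is)]"

text \<open>The exponent \<open>S\<close> written in the lengths that remain when interval
  \<open>j\<close> is removed, with \<open>q\<close> as the constant length of that interval. The
  product is the signature of the surviving shuffle: after the removal the labels \<open>j\<close>
  to \<open>N\<close> are those of the intervals that followed \<open>j\<close>.\<close>

definition sign_drop :: "nat \<Rightarrow> nat \<Rightarrow> nat \<Rightarrow> sign_expr \<Rightarrow> sign_expr" where
  "sign_drop j N q S = (\<lambda>a.
     S (\<lambda>k. if k = j then int q else if j < k \<and> k \<le> Suc N then a (k - 1) else a k)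
     + int q * (\<Sum>k = j..N. a k))"

lemma drop_label_strict_mono: "j \<notin> A \<Longrightarrow> strict_mono_on A (drop_label j)"
  unfolding strict_mono_on_def drop_label_def
proof (intro allI impI)
  fix r s assume "j \<notin> A" "r \<in> A \<and> s \<in> A \<and> r < s"
  then have "r \<noteq> j" "s \<noteq> j" "r < s" by auto
  then show "(if j < r then r - 1 else r) < (if j < s then s - 1 else s)" by arith
qed

lemma label_partition_drop:
  assumes J: "label_partition (Suc n) (Suc N) J" and j: "J (Suc n) = {j}"
  shows "label_partition n N (\<lambda>u. drop_label j ` J u)"
proof -
  have j1: "j \<in> {1..Suc N}" using J j by (force simp: label_partition_def)
  have nj: "j \<notin> J u" if "u \<in> {1..n}" for u
  proof
    assume "j \<in> J u"
    then have "u = Suc n" using label_partition_unique[OF J, of u "Suc n" j] that j by simp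
    then show False using that by simp
  qed
  \<comment> \<open>Since \<open>j\<close> itself is not in \<open>J u\<close>, the only possible
    preimage of \<open>i\<close> under \<open>drop_label j\<close> is \<open>i\<close> below
    \<open>j\<close> and \<open>Suc i\<close> otherwise.\<close>
  have drop_iff: "i \<in> drop_label j ` J u \<longleftrightarrow> (if i < j then i else Suc i) \<in> J u" if u: "u \<in> {1..n}" for i u
  proof
    assume "i \<in> drop_label j ` J u"
    then obtain k where k: "k \<in> J u" "i = drop_label j k" by blast
    then have "k \<noteq> j" using nj[OF u] by blast
    then have "(if i < j then i else Suc i) = k" using k(2) by (auto simp: drop_label_def)
    then show "(if i < j then i else Suc i) \<in> J u" using k by simp
  next
    assume *: "(if i < j then i else Suc i) \<in> J u"
    have "i = drop_label j (if i < j then i else Suc i)" by (simp add: drop_label_def)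
    with * show "i \<in> drop_label j ` J u" by blast
  qed
  show ?thesis
    unfolding label_partition_def
  proof (intro conjI ballI)
    fix u assume u: "u \<in> {1..n}"
    then have Ju: "J u \<subseteq> {1..Suc N}" "J u \<noteq> {}" using J by (auto simp: label_partition_def)
    show "drop_label j ` J u \<subseteq> {1..N}"
    proof
      fix i assume "i \<in> drop_label j ` J u"
      then have "(if i < j then i else Suc i) \<in> {1..Suc N}" using drop_iff[OF u] Ju by blast
      then show "i \<in> {1..N}" using j1 by (auto split: if_splits)
    qed
    show "drop_label j ` J u \<noteq> {}" using Ju by simp
  next
    fix i assume i: "i \<in> {1..N}"
    let ?k = "if i < j then i else Suc i"
    have "?k \<in> {1..Suc N}" using i by auto
    then obtain u where u: "u \<in> {1..Suc n}" "?k \<in> J u" using label_partition_owner[OF J] by blast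
    have "u \<noteq> Suc n"
    proof
      assume "u = Suc n"
      then have "?k = j" using u j by simp
      then show False by (auto split: if_splits)
    qed
    then have un: "u \<in> {1..n}" using u by auto
    show "\<exists>!u. u \<in> {1..n} \<and> i \<in> drop_label j ` J u"
    proof (rule ex1I[of _ u])
      show "u \<in> {1..n} \<and> i \<in> drop_label j ` J u" using un u drop_iff[OF un] by blast
      fix v assume v: "v \<in> {1..n} \<and> i \<in> drop_label j ` J v"
      then have "?k \<in> J v" using drop_iff by blast
      then show "v = u" using label_partition_unique[OF J, of v u ?k] v u by auto
    qed
  qed
qed

lemma insert_interval_nth:
  "length is = Suc N \<Longrightarrow> k \<le> Suc N \<Longrightarrow>
    insert_interval j q is ! k = (if k < j then is ! k else is ! (k - 1) + q)"
  by (simp add: insert_interval_def del: upt_Suc)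

lemma insert_interval_partition:
  assumes "is \<in> interval_partitions p N" "j \<in> {1..Suc N}"
  shows "insert_interval j q is \<in> interval_partitions (p + q) (Suc N)"
proof (rule interval_partitionsI)
  note len = interval_partitions_length[OF assms(1)]
  show "length (insert_interval j q is) = Suc (Suc N)" by (simp add: insert_interval_def len)
  show "insert_interval j q is ! 0 = 0" "insert_interval j q is ! Suc N = p + q"
    using assms len by (auto simp: insert_interval_nth interval_partitions_0 interval_partitions_last)
  fix i assume i: "i < Suc N"
  have "is ! (i - 1) \<le> is ! i" "i < j \<longrightarrow> \<not> Suc i < j \<longrightarrow> is ! i \<le> is ! i" "Suc i < j \<longrightarrow> is ! i \<le> is ! Suc i"
    using interval_partitions_mono[OF assms(1)] i assms(2) by auto
  then show "insert_interval j q is ! i \<le> insert_interval j q is ! Suc i"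
    using i len by (auto simp: insert_interval_nth)
qed

text \<open>Collapsing the inserted edges undoes the insertion on endpoints; both ends of interval
  \<open>j\<close> go to its starting point.\<close>

lemma insert_interval_squash:
  assumes "is \<in> interval_partitions p N" "j \<in> {1..Suc N}" "k \<le> Suc N"
  shows "squash {is ! (j - 1)..<is ! (j - 1) + q} (insert_interval j q is ! k) =
    (if k < j then is ! k else is ! (k - 1))"
proof (cases "k < j")
  case True
  then have "is ! k \<le> is ! (j - 1)" using interval_partitions_mono[OF assms(1), of k "j - 1"] assms by auto
  then show ?thesis
    using True assms interval_partitions_length[OF assms(1)]
    by (simp add: squash_interval insert_interval_nth)
next
  case False
  then have "is ! (j - 1) \<le> is ! (k - 1)" using interval_partitions_mono[OF assms(1), of "j - 1" "k - 1"] assms by auto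
  then show ?thesis
    using False assms interval_partitions_length[OF assms(1)]
    by (simp add: squash_interval insert_interval_nth)
qed

lemma inj_insert_interval: "inj_on (insert_interval j q) (interval_partitions p N)"
proof (rule inj_onI)
  fix "is" is' assume *: "is \<in> interval_partitions p N" "is' \<in> interval_partitions p N"
    "insert_interval j q is = insert_interval j q is'"
  note len = interval_partitions_length[OF *(1)] interval_partitions_length[OF *(2)]
  show "is = is'"
  proof (rule nth_equalityI)
    fix k assume k: "k < length is"
    have "insert_interval j q is ! k = insert_interval j q is' ! k"
      "insert_interval j q is ! Suc k = insert_interval j q is' ! Suc k"
      using *(3) by simp_all
    then show "is ! k = is' ! k"
      using k len by (cases "k < j") (auto simp: insert_interval_nth)
  qed (simp add: len)
qed

lemma insert_intervalE:
  assumes part: "is \<in> interval_partitions (p + q) (Suc N)" and j: "j \<in> {1..Suc N}"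
    and eq: "is ! j = is ! (j - 1) + q"
  obtains is' where "is' \<in> interval_partitions p N" "is = insert_interval j q is'"
proof -
  \<comment> \<open>Entry \<open>j\<close> is left out and the later ones move down by
    \<open>q\<close>. They are at least \<open>is ! j\<close>, hence at least \<open>q\<close>, so
    the truncated subtraction loses nothing.\<close>
  define is' where "is' = map (\<lambda>k. if k < j then is ! k else is ! Suc k - q) [0..<Suc N]"
  have len: "length is' = Suc N" by (simp add: is'_def)
  have nth: "is' ! k = (if k < j then is ! k else is ! Suc k - q)" if "k \<le> N" for k
    using that by (simp add: is'_def del: upt_Suc)
  note mono = interval_partitions_mono[OF part]
  have part': "is' \<in> interval_partitions p N"
  proof (rule interval_partitionsI[OF len])
    show "is' ! 0 = 0" using j nth[of 0] interval_partitions_0[OF part] by auto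
    show "is' ! N = p"
    proof (cases "N < j")
      case True
      then have "j = Suc N" using j by simp
      then show ?thesis using eq interval_partitions_last[OF part] nth[of N] by simp
    next
      case False
      then show ?thesis using interval_partitions_last[OF part] nth[of N] by simp
    qed
    fix i assume i: "i < N"
    consider "Suc i < j" | "j = Suc i" | "j \<le> i" by linarith
    then show "is' ! i \<le> is' ! Suc i"
    proof cases
      case 1
      then show ?thesis using i mono[of i "Suc i"] by (simp add: nth)
    next
      case 2
      then have "is ! i + q \<le> is ! Suc (Suc i)" using eq mono[of "Suc i" "Suc (Suc i)"] i by simp
      then show ?thesis using i 2 by (simp add: nth)
    next
      case 3
      then show ?thesis using i mono[of "Suc i" "Suc (Suc i)"] by (simp add: nth)
    qed
  qed
  have "is = insert_interval j q is'"
  proof (rule nth_equalityI)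
    show "length is = length (insert_interval j q is')"
      using interval_partitions_length[OF part] by (simp add: insert_interval_def len)
    fix k assume "k < length is"
    then have k: "k \<le> Suc N" using interval_partitions_length[OF part] by simp
    show "is ! k = insert_interval j q is' ! k"
    proof (cases "k < j")
      case True
      then show ?thesis using k len j by (simp add: insert_interval_nth nth)
    next
      case False
      show ?thesis
      proof (cases "k = j")
        case True
        then show ?thesis using k len j eq nth[of "j - 1"] by (auto simp: insert_interval_nth)
      next
        case F: False
        then have "q \<le> is ! k" using False eq mono[of j k] k by simp
        then show ?thesis using k len j False F nth[of "k - 1"] by (auto simp: insert_interval_nth)
      qed
    qed
  qed
  then show ?thesis using that part' by blast
qed

lemma interval_length_insert_interval:
  assumes "is \<in> interval_partitions p N" "j \<in> {1..Suc N}" "k \<in> {1..Suc N}"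
  shows "interval_length (insert_interval j q is) k =
    (if k = j then int q else if j < k then interval_length is (k - 1) else interval_length is k)"
proof -
  note len = interval_partitions_length[OF assms(1)]
  consider "k = j" | "j < k" | "k < j" by linarith
  then show ?thesis
  proof cases
    case 2
    then have "\<not> k - 1 < j" "k - 1 - 1 = k - 2" by auto
    then show ?thesis using 2 assms len by (auto simp: interval_length_def insert_interval_nth)
  qed (use assms len in \<open>auto simp: interval_length_def insert_interval_nth\<close>)
qed

section \<open>Shuffle products evaluated on face-intervals\<close>

lemma finite_pq_shuffles: "finite (pq_shuffles p q)"
  by (rule finite_subset[of _ "Pow {0..<p + q} \<times> Pow {0..<p + q}"]) (auto simp: pq_shuffles_def)

text \<open>The last clause of \<open>wf_expression\<close>, isolated because the substitutions into
  an exponent are controlled only on the labels \<open>1\<close> to \<open>N\<close>.\<close>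

definition local_sign :: "nat \<Rightarrow> sign_expr \<Rightarrow> bool" where
  "local_sign N S \<longleftrightarrow> (\<forall>a b. (\<forall>k\<in>{1..N}. a k = b k) \<longrightarrow> S a = S b)"

lemma local_signD: "local_sign N S \<Longrightarrow> (\<And>k. k \<in> {1..N} \<Longrightarrow> a k = b k) \<Longrightarrow> S a = S b"
  unfolding local_sign_def by blast

text \<open>Exchanging the summations over shuffles and partitions yields a single sum over pairs,
  the form that \<open>cong_mod_sum_reindex\<close> takes.\<close>

lemma lin_ext_expression_EML:
  "lin_ext (\<lambda>(m, ys). expression K (Suc n) N id J S m ys) (push join_last (EML (sset_power n K) K ((p, w), (q, z)))) =
   (\<Sum>t\<in>interval_partitions (p + q) N \<times> pq_shuffles p q. case t of (is, (A, B)) \<Rightarrow>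
      if \<forall>u\<in>{1..Suc n}. separated is (J u)
      then Poly_Mapping.single
        (tensor_term K (Suc n) J (p + q)
          (snd (degens (sset_power n K) B (p, w)) @ [snd (degens K A (q, z))]) is)
        (minus_one_pow (S (interval_length is)) * (- 1) ^ sig A :: 'r::comm_ring_1) else 0)"
proof -
  have "lin_ext (\<lambda>(m, ys). expression K (Suc n) N id J S m ys) (push join_last (EML (sset_power n K) K ((p, w), (q, z)))) =
    (\<Sum>(A, B)\<in>pq_shuffles p q. \<Sum>is\<in>interval_partitions (p + q) N.
      if \<forall>u\<in>{1..Suc n}. separated is (J u)
      then Poly_Mapping.single
        (tensor_term K (Suc n) J (p + q)
          (snd (degens (sset_power n K) B (p, w)) @ [snd (degens K A (q, z))]) is)
        (minus_one_pow (S (interval_length is)) * (- 1) ^ sig A :: 'r) else 0)"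
    unfolding EML_def expression_id
    by (auto simp: push_sum lin_ext_sum join_last_def case_prod_beta scale_sum mult.commute
        if_distrib[of "scale _"] intro!: sum.cong cong: if_cong)
  also have "\<dots> = (\<Sum>is\<in>interval_partitions (p + q) N. \<Sum>(A, B)\<in>pq_shuffles p q.
      if \<forall>u\<in>{1..Suc n}. separated is (J u)
      then Poly_Mapping.single
        (tensor_term K (Suc n) J (p + q)
          (snd (degens (sset_power n K) B (p, w)) @ [snd (degens K A (q, z))]) is)
        (minus_one_pow (S (interval_length is)) * (- 1) ^ sig A :: 'r) else 0)"
    unfolding case_prod_beta by (rule sum.swap)
  finally show ?thesis
    by (simp add: sum.cartesian_product case_prod_beta)
qed

lemma pq_shufflesD:
  assumes "(A, B) \<in> pq_shuffles p q"
  shows "finite A" "finite B" "card A = p" "card B = q" "A \<union> B = {0..<p + q}" "A \<inter> B = {}"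
    "A \<subseteq> {..<p + q}" "B \<subseteq> {..<p + q}"
proof -
  show *: "A \<union> B = {0..<p + q}" "A \<inter> B = {}" "card A = p" "card B = q"
    using assms by (auto simp: pq_shuffles_def)
  then show sub: "A \<subseteq> {..<p + q}" "B \<subseteq> {..<p + q}" by auto
  show "finite A" "finite B" using finite_subset[OF sub(1)] finite_subset[OF sub(2)] by auto
qed

lemma sset_power_nth:
  "xs \<in> simplices (sset_power n K) m \<Longrightarrow> u \<in> {1..n} \<Longrightarrow> xs ! (u - 1) \<in> simplices K m"
  by (auto simp: sset_power_def subset_iff)

lemma sset_power_length: "xs \<in> simplices (sset_power n K) m \<Longrightarrow> length xs = n"
  by (simp add: sset_power_def)

context simplicial_set
begin

text \<open>The entries of a shuffle product as lattice paths: a step in \<open>A\<close> raises the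
  first \<open>n\<close> variables and repeats the last one, a step in \<open>B\<close> does the
  opposite.\<close>

lemma EML_entry:
  assumes AB: "(A, B) \<in> pq_shuffles p q" and w: "w \<in> simplices (sset_power n K) p" and z: "z \<in> simplices K q"
    and u: "u \<in> {1..Suc n}"
  defines "f \<equiv> \<lambda>u. if u = Suc n then squash A else squash B"
    and "x \<equiv> \<lambda>u. if u = Suc n then (q, z) else (p, w ! (u - 1))"
  shows "(p + q, (snd (degens (sset_power n K) B (p, w)) @ [snd (degens K A (q, z))]) ! (u - 1)) =
      act K (map (f u) [0..<Suc (p + q)]) (x u)"
    and "x u \<in> gsimplices K \<and> mono (f u) \<and> f u (p + q) \<le> fst (x u)"
proof -
  note sh = pq_shufflesD[OF AB]
  show x: "x u \<in> gsimplices K \<and> mono (f u) \<and> f u (p + q) \<le> fst (x u)"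
  proof (cases "u = Suc n")
    case True
    then show ?thesis using z sh degens_eq_act(2)[of "(q, z)" A]
      by (simp add: x_def f_def gsimplices_def squash_mono add.commute)
  next
    case False
    then have "w ! (u - 1) \<in> simplices K p" using sset_power_nth[OF w, of u] u by auto
    then show ?thesis using False sh degens_eq_act(2)[of "(p, w ! (u - 1))" B]
      by (simp add: x_def f_def gsimplices_def squash_mono)
  qed
  note len = sset_power_length[OF w]
  show "(p + q, (snd (degens (sset_power n K) B (p, w)) @ [snd (degens K A (q, z))]) ! (u - 1)) =
      act K (map (f u) [0..<Suc (p + q)]) (x u)"
  proof (cases "u = Suc n")
    case True
    have "(p + q, snd (degens K A (q, z))) = degens K A (q, z)"
      using sh by (intro prod_eqI) (auto simp: fst_degens)
    also have "\<dots> = act K (map (squash A) [0..<Suc (fst (q, z) + card A)]) (q, z)"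
      by (rule degens_eq_act) (use True x sh in \<open>auto simp: x_def add.commute\<close>)
    finally show ?thesis using True sh len
      by (simp add: degens_power f_def x_def nth_append add.commute del: upt_Suc)
  next
    case False
    then have u': "u - 1 < n" using u by auto
    have "(p + q, snd (degens K B (p, w ! (u - 1)))) = degens K B (p, w ! (u - 1))"
      using sh by (intro prod_eqI) (auto simp: fst_degens)
    also have "\<dots> = act K (map (squash B) [0..<Suc (fst (p, w ! (u - 1)) + card B)]) (p, w ! (u - 1))"
      by (rule degens_eq_act) (use False x sh in \<open>auto simp: x_def\<close>)
    finally show ?thesis using False sh len u'
      by (simp add: degens_power f_def x_def nth_append del: upt_Suc)
  qed
qed

text \<open>A step of the shuffle path that raises only the other factor would repeat a vertex in the
  face-interval that owns it, so the steps of the last factor must be exactly the interval \<open>j\<close>.\<close>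

lemma EML_survivor:
  assumes J: "label_partition (Suc n) (Suc N) J" and j: "J (Suc n) = {j}"
    and AB: "(A, B) \<in> pq_shuffles p q" and w: "w \<in> simplices (sset_power n K) p" and z: "z \<in> simplices K q"
    and part: "is \<in> interval_partitions (p + q) (Suc N)" and sep: "\<forall>u\<in>{1..Suc n}. separated is (J u)"
    and nondeg: "tensor_term K (Suc n) J (p + q)
      (snd (degens (sset_power n K) B (p, w)) @ [snd (degens K A (q, z))]) is \<notin> degenerate_tensors (Suc n) K"
  shows "B = {is ! (j - 1)..<is ! j}"
proof -
  note sh = pq_shufflesD[OF AB]
  have j1: "j \<in> {1..Suc N}" using J j by (force simp: label_partition_def)
  have inj: "inj_on (if u = Suc n then squash A else squash B) (vertices is (J u))" if u: "u \<in> {1..Suc n}" for u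
    using tensor_term_degenerate[OF J part sep EML_entry[OF AB w z] u] nondeg by blast
  have edge_A: "t \<notin> A" if "is ! (j - 1) \<le> t" "t < is ! j" for t
  proof
    assume "t \<in> A"
    then have "squash A t = squash A (Suc t)" by (simp add: squash_Suc)
    from not_inj_on_vertices_edge[of j "J (Suc n)", OF _ that this] inj[of "Suc n"] j
    show False by simp
  qed
  have edge_B: "t \<notin> B" if "u \<in> {1..n}" "k \<in> J u" "is ! (k - 1) \<le> t" "t < is ! k" for t u k
  proof
    assume "t \<in> B"
    then have "squash B t = squash B (Suc t)" by (simp add: squash_Suc)
    from not_inj_on_vertices_edge[OF that(2-4) this] inj[of u] that(1)
    show False by (auto split: if_splits)
  qed
  show ?thesis
  proof (intro equalityI subsetI)
    fix t assume t: "t \<in> B"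
    then have "t < p + q" using sh by auto
    then obtain k where k: "k \<in> {1..Suc N}" "is ! (k - 1) \<le> t" "t < is ! k"
      using interval_partitions_owner[OF part] by blast
    obtain u where u: "u \<in> {1..Suc n}" "k \<in> J u" using label_partition_owner[OF J k(1)] by blast
    have "u = Suc n" using edge_B[of u k t] u k t by fastforce
    then have "k = j" using u(2) j by simp
    then show "t \<in> {is ! (j - 1)..<is ! j}" using k by simp
  next
    fix t assume t: "t \<in> {is ! (j - 1)..<is ! j}"
    then have "t \<notin> A" using edge_A by simp
    moreover have "t < p + q" using t interval_partitions_le[OF part, of j] j1 by auto
    ultimately show "t \<in> B" using sh(5) by auto
  qed
qed

text \<open>\<open>transfer_vertices\<close> for a variable that is not split off. The collapsed
  block is the inserted interval \<open>j\<close>, and each interval of this variable lies entirely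
  before or after it, so its edges survive.\<close>

lemma EML_transfer:
  fixes q :: nat
  assumes J: "label_partition (Suc n) (Suc N) J" and j: "J (Suc n) = {j}"
    and part: "is' \<in> interval_partitions p N" and u: "u \<in> {1..n}"
  defines "is \<equiv> insert_interval j q is'" and "f \<equiv> squash {is' ! (j - 1)..<is' ! (j - 1) + q}"
    and "J' \<equiv> drop_label j ` J u"
  shows "separated is' J' \<Longrightarrow> separated is (J u)"
    and "separated is' J' \<Longrightarrow> map f (sorted_list_of_set (vertices is (J u))) = sorted_list_of_set (vertices is' J')"
    and "separated is (J u) \<Longrightarrow> \<not> separated is' J' \<Longrightarrow> \<not> inj_on f (vertices is (J u))"
proof -
  have j1: "j \<in> {1..Suc N}" using J j by (force simp: label_partition_def)
  have part2: "is \<in> interval_partitions (p + q) (Suc N)"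
    unfolding is_def by (rule insert_interval_partition[OF part j1])
  have Ju: "J u \<subseteq> {1..Suc N}" using J u by (simp add: label_partition_def)
  have nj: "j \<notin> J u"
  proof
    assume "j \<in> J u"
    then have "u = Suc n" using label_partition_unique[OF J, of u "Suc n" j] u j by simp
    then show False using u by simp
  qed
  note len = interval_partitions_length[OF part]
  have ends_is: "is ! (j - 1) = is' ! (j - 1)" "is ! j = is' ! (j - 1) + q"
    using j1 len by (auto simp: is_def insert_interval_nth)
  have f_is: "f (is ! k) = (if k < j then is' ! k else is' ! (k - 1))" if "k \<le> Suc N" for k
    unfolding f_def is_def by (rule insert_interval_squash[OF part j1 that])
  have f: "mono f" unfolding f_def by (rule squash_mono)
  have step: "f t = f (is ! (k - 1)) + (t - is ! (k - 1))"
    if k: "k \<in> J u" and t: "is ! (k - 1) \<le> t" "t \<le> is ! k" for k t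
    unfolding f_def
  proof (rule squash_step[OF t(1)])
    have "k \<noteq> j" "1 \<le> k" "k \<le> Suc N" using k nj Ju by auto
    then consider "k \<le> j - 1" | "j \<le> k - 1" "k \<le> Suc N" by linarith
    then show "{is ! (k - 1)..<t} \<inter> {is' ! (j - 1)..<is' ! (j - 1) + q} = {}"
    proof cases
      case 1
      then have "is ! k \<le> is ! (j - 1)" using interval_partitions_mono[OF part2, of k "j - 1"] j1 by auto
      then show ?thesis using t ends_is by auto
    next
      case 2
      then have "is ! j \<le> is ! (k - 1)" using interval_partitions_mono[OF part2, of j "k - 1"] by auto
      then show ?thesis using t ends_is by auto
    qed
  qed
  have ends: "is' ! drop_label j k = f (is ! k)" "is' ! (drop_label j k - 1) = f (is ! (k - 1))"
    if k: "k \<in> J u" for k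
  proof -
    have "k \<noteq> j" "1 \<le> k" "k \<le> Suc N" using k nj Ju by auto
    then show "is' ! drop_label j k = f (is ! k)" "is' ! (drop_label j k - 1) = f (is ! (k - 1))"
      by (auto simp: f_is drop_label_def)
  qed
  note tr = transfer_vertices[OF part2 Ju f step drop_label_strict_mono[OF nj] ends, folded J'_def]
  show "separated is' J' \<Longrightarrow> separated is (J u)"
    and "separated is' J' \<Longrightarrow> map f (sorted_list_of_set (vertices is (J u))) = sorted_list_of_set (vertices is' J')"
    and "separated is (J u) \<Longrightarrow> \<not> separated is' J' \<Longrightarrow> \<not> inj_on f (vertices is (J u))"
    using tr by blast+
qed

text \<open>For a fixed last factor \<open>z\<close> of dimension \<open>q\<close>, evaluation on
  shuffle products removes the last variable: what remains is an expression in \<open>n\<close>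
  variables with label \<open>j\<close> dropped, followed by \<open>z\<close>. The exponent depends
  on \<open>q\<close> through \<open>sign_drop\<close>.\<close>

lemma expression_EML:
  fixes S :: sign_expr
  assumes J: "label_partition (Suc n) (Suc N) J" and j: "J (Suc n) = {j}" and S: "local_sign (Suc N) S"
    and w: "w \<in> simplices (sset_power n K) p" and z: "z \<in> simplices K q"
  shows "cong_mod (degenerate_tensors (Suc n) K)
    (lin_ext (\<lambda>(m, ys). expression K (Suc n) (Suc N) id J S m ys)
      (push join_last (EML (sset_power n K) K ((p, w), (q, z)))))
    (push (\<lambda>zs. zs @ [(q, z)])
      (expression K n N id (\<lambda>u. drop_label j ` J u) (sign_drop j N q S) p w) :: _ \<Rightarrow>\<^sub>0 'r::comm_ring_1)"
proof -
  have j1: "j \<in> {1..Suc N}" using J j by (force simp: label_partition_def)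
  let ?J' = "\<lambda>u. drop_label j ` J u" and ?S' = "sign_drop j N q S"
  have J': "label_partition n N ?J'" by (rule label_partition_drop[OF J j])
  let ?ys = "\<lambda>A B. snd (degens (sset_power n K) B (p, w)) @ [snd (degens K A (q, z))]"
  define F :: "_ \<Rightarrow> (_ \<Rightarrow>\<^sub>0 'r)" where "F = (\<lambda>t. case t of (is, (A, B)) \<Rightarrow>
      if \<forall>u\<in>{1..Suc n}. separated is (J u)
      then Poly_Mapping.single (tensor_term K (Suc n) J (p + q) (?ys A B) is)
        (minus_one_pow (S (interval_length is)) * (- 1) ^ sig A) else 0)"
  \<comment> \<open>The survivor that belongs to \<open>is'\<close>: an interval of length
    \<open>q\<close> is inserted, and its edges are exactly the steps on which the last factor
    rises.\<close>
  define G where "G = (\<lambda>is'. (insert_interval j q is',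
     ({0..<p + q} - {is' ! (j - 1)..<is' ! (j - 1) + q}, {is' ! (j - 1)..<is' ! (j - 1) + q})))"
  define H :: "_ \<Rightarrow> (_ \<Rightarrow>\<^sub>0 'r)" where "H = (\<lambda>is'. if \<forall>u\<in>{1..n}. separated is' (?J' u)
      then Poly_Mapping.single (tensor_term K n ?J' p w is' @ [(q, z)])
        (minus_one_pow (?S' (interval_length is'))) else 0)"
  have G_shuffle: "snd (G is') \<in> pq_shuffles p q" and G_part: "fst (G is') \<in> interval_partitions (p + q) (Suc N)"
    if part: "is' \<in> interval_partitions p N" for is'
  proof -
    show "fst (G is') \<in> interval_partitions (p + q) (Suc N)"
      unfolding G_def fst_conv by (rule insert_interval_partition[OF part j1])
    have "is' ! (j - 1) \<le> p" using interval_partitions_le[OF part, of "j - 1"] j1 by auto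
    then have sub: "{is' ! (j - 1)..<is' ! (j - 1) + q} \<subseteq> {0..<p + q}" by auto
    then show "snd (G is') \<in> pq_shuffles p q"
      by (auto simp: G_def pq_shuffles_def card_Diff_subset)
  qed
  have "cong_mod (degenerate_tensors (Suc n) K)
      (sum F (interval_partitions (p + q) (Suc N) \<times> pq_shuffles p q)) (sum H (interval_partitions p N))"
  proof (rule cong_mod_sum_reindex[where G = G, OF _ finite_interval_partitions subset_refl])
    show "finite (interval_partitions (p + q) (Suc N) \<times> pq_shuffles p q)"
      by (intro finite_cartesian_product finite_interval_partitions finite_pq_shuffles)
    show "G ` interval_partitions p N \<subseteq> interval_partitions (p + q) (Suc N) \<times> pq_shuffles p q"
      by (rule image_subsetI) (simp add: mem_Times_iff G_shuffle G_part)
    show "inj_on G (interval_partitions p N)"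
      using inj_insert_interval[of j q p N] by (auto simp: inj_on_def G_def)
  next
    fix t assume t: "t \<in> interval_partitions (p + q) (Suc N) \<times> pq_shuffles p q" "t \<notin> G ` interval_partitions p N"
    obtain "is" A B where tt: "t = (is, (A, B))" by (metis prod.exhaust)
    have part: "is \<in> interval_partitions (p + q) (Suc N)" and AB: "(A, B) \<in> pq_shuffles p q"
      using t(1) tt by auto
    show "cong_mod (degenerate_tensors (Suc n) K) (F t) 0"
    proof (cases "(\<forall>u\<in>{1..Suc n}. separated is (J u)) \<and>
        tensor_term K (Suc n) J (p + q) (?ys A B) is \<notin> degenerate_tensors (Suc n) K")
      case True
      have B: "B = {is ! (j - 1)..<is ! j}"
        by (rule EML_survivor[OF J j AB w z part]) (use True in blast)+
      have "is ! (j - 1) \<le> is ! j" using interval_partitions_mono[OF part, of "j - 1" j] j1 by auto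
      then have eq: "is ! j = is ! (j - 1) + q" using B pq_shufflesD(4)[OF AB] by simp
      obtain is' where is': "is' \<in> interval_partitions p N" "is = insert_interval j q is'"
        using insert_intervalE[OF part j1 eq] by blast
      have "is ! (j - 1) = is' ! (j - 1)"
        using is' j1 interval_partitions_length[OF is'(1)] by (auto simp: insert_interval_nth)
      moreover have "A = {0..<p + q} - B" using pq_shufflesD(5,6)[OF AB] by auto
      ultimately have "t = G is'" using tt is'(2) B eq by (simp add: G_def)
      then show ?thesis using t(2) is'(1) by blast
    next
      case False
      then show ?thesis by (auto simp: F_def tt intro: cong_mod_single_zero)
    qed
  next
    fix is' assume part: "is' \<in> interval_partitions p N"
    let ?is = "insert_interval j q is'" and ?b = "is' ! (j - 1)"
    let ?B = "{?b..<?b + q}" and ?A = "{0..<p + q} - {?b..<?b + q}"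
    have G: "G is' = (?is, (?A, ?B))" by (simp add: G_def)
    have part2: "?is \<in> interval_partitions (p + q) (Suc N)" and AB: "(?A, ?B) \<in> pq_shuffles p q"
      using G_part[OF part] G_shuffle[OF part] by (simp_all add: G)
    note len = interval_partitions_length[OF part]
    have bp: "?b \<le> p" using interval_partitions_le[OF part, of "j - 1"] j1 by auto
    have sepn: "separated ?is (J (Suc n))" using j by (simp add: separated_def)
    show "cong_mod (degenerate_tensors (Suc n) K) (F (G is')) (H is')"
    proof (cases "\<forall>u\<in>{1..n}. separated is' (?J' u)")
      case True
      have sep: "\<forall>u\<in>{1..Suc n}. separated ?is (J u)"
        using EML_transfer(1)[OF J j part] True sepn by (metis atLeastAtMost_iff le_Suc_eq)
      have V: "vertices ?is {j} = {?b..?b + q}"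
        using j1 len by (auto simp: vertices_def insert_interval_nth)
      \<comment> \<open>All steps outside the block lie in \<open>?A\<close>, so the path of the
        last factor waits at vertex 0 up to \<open>?b\<close> and then runs once through the whole
        of \<open>z\<close>.\<close>
      have sq_step: "squash ?A t = t - ?b" if "?b \<le> t" "t \<le> ?b + q" for t
      proof -
        have "squash ?A ?b = squash ?A 0"
          by (rule squash_const) (use bp in auto)
        moreover have "squash ?A t = squash ?A ?b + (t - ?b)"
          by (rule squash_step) (use that in auto)
        ultimately show ?thesis by simp
      qed
      have "map (squash ?A) (sorted_list_of_set {?b..?b + q}) = [0..<Suc q]"
      proof -
        have "[?b..<Suc (?b + q)] = sorted_list_of_set {?b..?b + q}"
          by (simp add: atLeastLessThanSuc_atLeastAtMost[symmetric] del: upt_Suc)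
        moreover have "map (squash ?A) [?b..<Suc (?b + q)] = [0..<Suc q]"
          by (rule nth_equalityI) (auto simp: sq_step simp del: upt_Suc One_nat_def)
        ultimately show ?thesis by simp
      qed
      then have last: "act K (map (squash ?A) (sorted_list_of_set (vertices ?is (J (Suc n))))) (q, z) = (q, z)"
        using act_id[of "(q, z)"] by (simp add: j V)
      have "tensor_term K (Suc n) J (p + q) (?ys ?A ?B) ?is =
          map (\<lambda>u. act K (map (if u = Suc n then squash ?A else squash ?B)
              (sorted_list_of_set (vertices ?is (J u)))) (if u = Suc n then (q, z) else (p, w ! (u - 1)))) [1..<Suc n + 1]"
        by (rule tensor_term_act[OF J part2 sep EML_entry[OF AB w z]])
      also have "\<dots> = map (\<lambda>u. act K (sorted_list_of_set (vertices is' (?J' u))) (p, w ! (u - 1))) [1..<n + 1] @ [(q, z)]"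
        using last EML_transfer(2)[OF J j part, where q = q] True by auto
      also have "\<dots> = tensor_term K n ?J' p w is' @ [(q, z)]"
        by (simp only: tensor_term_self[OF J' part True w])
      finally have terms: "tensor_term K (Suc n) J (p + q) (?ys ?A ?B) ?is = tensor_term K n ?J' p w is' @ [(q, z)]" .
      have "S (\<lambda>k. if k = j then int q else if j < k \<and> k \<le> Suc N then interval_length is' (k - 1) else interval_length is' k)
          = S (interval_length ?is)"
        by (rule local_signD[OF S]) (auto simp: interval_length_insert_interval[OF part j1])
      \<comment> \<open>The steps of the first \<open>n\<close> variables that come after the block;
        \<open>q\<close> times their number is the signature.\<close>
      moreover have "(\<Sum>k = j..N. interval_length is' k) = int p - int ?b"
      proof -
        have "j - 1 \<le> N" "Suc (j - 1) = j" using j1 by auto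
        then show ?thesis
          using sum_interval_length[of "j - 1" N is'] interval_partitions_last[OF part] by simp
      qed
      moreover have "int (sig ?A) = int q * (int p - int ?b)"
        using sig_complement_interval[OF bp, of q] bp by (simp add: of_nat_diff)
      ultimately have "minus_one_pow (S (interval_length ?is)) * (- 1) ^ sig ?A = (minus_one_pow (?S' (interval_length is')) :: 'r)"
        by (simp add: minus_one_pow_mult sign_drop_def)
      then show ?thesis using True sep terms by (simp add: F_def H_def G)
    next
      case False
      then obtain u where u: "u \<in> {1..n}" "\<not> separated is' (?J' u)" by blast
      have H: "H is' = 0" unfolding H_def by (rule if_not_P) (rule False)
      show ?thesis
      proof (cases "\<forall>u\<in>{1..Suc n}. separated ?is (J u)")
        case sep: True
        \<comment> \<open>The intervals are apart before the collapse and touch after it, so their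
          gap consisted of edges of the block.\<close>
        then have "\<not> inj_on (squash ?B) (vertices ?is (J u))"
          using EML_transfer(3)[OF J j part u(1)] u by simp
        then have "tensor_term K (Suc n) J (p + q) (?ys ?A ?B) ?is \<in> degenerate_tensors (Suc n) K"
          using tensor_term_degenerate[OF J part2 sep EML_entry[OF AB w z], of u] u(1) by auto
        then show ?thesis by (auto simp: F_def H G intro: cong_mod_single_zero)
      next
        case False
        then show ?thesis by (simp only: F_def H G case_prod_conv if_False cong_mod_refl)
      qed
    qed
  qed simp
  moreover have "sum H (interval_partitions p N) = push (\<lambda>zs. zs @ [(q, z)])
      (expression K n N id ?J' ?S' p w)"
    unfolding expression_id push_sum by (rule sum.cong) (auto simp: H_def)
  ultimately show ?thesis
    unfolding lin_ext_expression_EML F_def by simp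
qed

end

section \<open>The Shih operator\<close>

lemma mono_skip: "mono (\<lambda>s::nat. if s < a then s else s + c)"
  by (simp add: mono_def)

lemma lin_ext_expression_SHI:
  "lin_ext (\<lambda>(m, ys). expression K (Suc n) N id J S m ys) (push join_last (SHI (sset_power n K) K (m, (x, y)))) =
   (\<Sum>t\<in>interval_partitions (m + 1) N \<times> (SIGMA pq:{(p, q). p + q < m}. pq_shuffles (fst pq + 1) (snd pq)).
      case t of (is, ((p, q), (A, B))) \<Rightarrow>
      if \<forall>u\<in>{1..Suc n}. separated is (J u)
      then Poly_Mapping.single
        (tensor_term K (Suc n) J (m + 1)
          (snd (degens (sset_power n K) (insert (m - p - q - 1) ((+) (m - p - q) ` B))
              (faces (sset_power n K) [m - q + 1..<m + 1] (m, x))) @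
           [snd (degens K ((+) (m - p - q) ` A) (faces K [m - p - q..<m - q] (m, y)))]) is)
        (minus_one_pow (S (interval_length is)) * (- 1) ^ (m - p - q - 1 + sig A) :: 'r::comm_ring_1) else 0)"
proof -
  have fin: "finite {(p, q). p + q < m}"
    by (rule finite_subset[of _ "{..m} \<times> {..m}"]) auto
  define T where "T = (\<lambda>is p q A B. if \<forall>u\<in>{1..Suc n}. separated is (J u)
      then Poly_Mapping.single
        (tensor_term K (Suc n) J (m + 1)
          (snd (degens (sset_power n K) (insert (m - p - q - 1) ((+) (m - p - q) ` B))
              (faces (sset_power n K) [m - q + 1..<m + 1] (m, x))) @
           [snd (degens K ((+) (m - p - q) ` A) (faces K [m - p - q..<m - q] (m, y)))]) is)
        (minus_one_pow (S (interval_length is)) * (- 1) ^ (m - p - q - 1 + sig A) :: 'r) else 0)"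
  have "lin_ext (\<lambda>(m, ys). expression K (Suc n) N id J S m ys) (push join_last (SHI (sset_power n K) K (m, (x, y)))) =
    (\<Sum>pq\<in>{(p, q). p + q < m}. \<Sum>AB\<in>pq_shuffles (fst pq + 1) (snd pq). \<Sum>is\<in>interval_partitions (m + 1) N.
      T is (fst pq) (snd pq) (fst AB) (snd AB))"
    unfolding SHI_def expression_id T_def
    by (simp add: push_sum lin_ext_sum join_last_def case_prod_beta scale_sum mult.commute Let_def
        if_distrib[of "scale _"] cong: if_cong)
  also have "\<dots> = (\<Sum>t\<in>(SIGMA pq:{(p, q). p + q < m}. pq_shuffles (fst pq + 1) (snd pq)).
      \<Sum>is\<in>interval_partitions (m + 1) N. T is (fst (fst t)) (snd (fst t)) (fst (snd t)) (snd (snd t)))"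
    by (subst sum.Sigma) (use fin finite_pq_shuffles in \<open>auto simp: case_prod_beta\<close>)
  also have "\<dots> = (\<Sum>is\<in>interval_partitions (m + 1) N.
      \<Sum>t\<in>(SIGMA pq:{(p, q). p + q < m}. pq_shuffles (fst pq + 1) (snd pq)).
      T is (fst (fst t)) (snd (fst t)) (fst (snd t)) (snd (snd t)))"
    by (rule sum.swap)
  finally show ?thesis
    by (simp add: sum.cartesian_product case_prod_beta T_def)
qed

context simplicial_set
begin

lemma faces_interval_eq_act:
  assumes z: "z \<in> gsimplices K" and ab: "a \<le> b" "b \<le> Suc (fst z)" "b - a \<le> fst z"
  shows "faces K [a..<b] z = act K (map (\<lambda>t. if t < a then t else t + (b - a)) [0..<Suc (fst z) - (b - a)]) z"
proof -
  let ?m = "Suc (fst z)"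
  have "faces K [a..<b] (act K [0..<?m] z) =
      act K (map ((!) [0..<?m]) (filter (\<lambda>t. t \<notin> set [a..<b]) [0..<length [0..<?m]])) z"
    by (rule faces_act[OF z]) (use ab in \<open>auto simp del: upt_Suc\<close>)
  also have "filter (\<lambda>t. t \<notin> set [a..<b]) [0..<length [0..<?m]] = [0..<a] @ [b..<?m]"
  proof -
    have "[0..<?m] = [0..<a] @ [a..<b] @ [b..<?m]"
      using ab upt_add_eq_append[of 0 a "?m - a"] upt_add_eq_append[of a b "?m - b"] by simp
    moreover have "filter (\<lambda>t. t \<notin> {a..<b}) [0..<a] = [0..<a]" "filter (\<lambda>t. t \<notin> {a..<b}) [a..<b] = []"
        "filter (\<lambda>t. t \<notin> {a..<b}) [b..<?m] = [b..<?m]"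
      by (auto simp: filter_id_conv filter_empty_conv simp del: upt_Suc)
    moreover have "length [0..<?m] = ?m" by simp
    ultimately show ?thesis by (simp only: filter_append set_upt append_Nil)
  qed
  also have "map ((!) [0..<?m]) ([0..<a] @ [b..<?m]) =
      map (\<lambda>t. if t < a then t else t + (b - a)) [0..<?m - (b - a)]"
    by (rule nth_equalityI) (use ab in \<open>auto simp: nth_append simp del: upt_Suc\<close>)
  finally show ?thesis by (simp only: act_id)
qed

text \<open>The degeneracies repeat positions of the shortened list; in terms of the original
  vertices this is \<open>squash C\<close> followed by a jump over the vertices \<open>a\<close> to
  \<open>b - 1\<close>.\<close>

lemma degens_faces_eq_act:
  assumes z: "z \<in> gsimplices K" and ab: "a \<le> b" "b \<le> Suc (fst z)" "b - a \<le> fst z"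
    and C: "finite C" "C \<subseteq> {..<fst z - (b - a) + card C}"
  shows "degens K C (faces K [a..<b] z) =
    act K (map (\<lambda>t. if squash C t < a then squash C t else squash C t + (b - a))
      [0..<Suc (fst z) - (b - a) + card C]) z"
proof -
  let ?vs = "map (\<lambda>t. if t < a then t else t + (b - a)) [0..<Suc (fst z) - (b - a)]"
  have vs: "sorted ?vs" "set ?vs \<subseteq> {..fst z}" "?vs \<noteq> []"
  proof -
    show "sorted ?vs"
      unfolding sorted_map
      by (rule sorted_wrt_mono_rel[OF _ sorted_upt]) (auto intro: monoD[OF mono_skip])
  qed (use ab in auto)
  have len: "length ?vs = Suc (fst z) - (b - a)" by simp
  have "degens K C (act K ?vs z) = act K (map (\<lambda>t. ?vs ! squash C t) [0..<length ?vs + card C]) z"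
    by (rule degens_act[OF z vs C(1)]) (use C ab in \<open>auto simp: Suc_diff_le\<close>)
  also have "map (\<lambda>t. ?vs ! squash C t) [0..<length ?vs + card C] =
      map (\<lambda>t. if squash C t < a then squash C t else squash C t + (b - a)) [0..<Suc (fst z) - (b - a) + card C]"
    unfolding len
  proof (rule map_cong[OF refl])
    fix t assume "t \<in> set [0..<Suc (fst z) - (b - a) + card C]"
    then have "t \<le> fst z - (b - a) + card C" using ab by auto
    then have "squash C t \<le> squash C (fst z - (b - a) + card C)" by (rule monoD[OF squash_mono])
    also have "\<dots> = fst z - (b - a)" using squash_diff[OF C] by simp
    finally have "squash C t < Suc (fst z) - (b - a)" using ab by simp
    then show "?vs ! squash C t = (if squash C t < a then squash C t else squash C t + (b - a))"
      by (simp del: upt_Suc)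
  qed
  finally show ?thesis using faces_interval_eq_act[OF z ab] by simp
qed

text \<open>The lattice path of a Shih summand. All variables rise together up to the vertex
  \<open>m - p - q - 1\<close>. The next step moves only the last variable, which jumps over the
  \<open>p\<close> vertices removed by its faces and lands on \<open>m - q\<close>. Then the shuffle
  follows, where steps in \<open>A\<close> raise the first \<open>n\<close> variables and steps in
  \<open>B\<close> the last one.\<close>

lemma SHI_entry:
  assumes pq: "p + q < m" and AB: "(A, B) \<in> pq_shuffles (p + 1) q"
    and xs: "xs \<in> simplices (sset_power (Suc n) K) m" and u: "u \<in> {1..Suc n}"
  defines "A' \<equiv> (+) (m - p - q) ` A" and "C \<equiv> insert (m - p - q - 1) ((+) (m - p - q) ` B)"
  defines "f \<equiv> \<lambda>u. if u = Suc n
    then (\<lambda>t. if squash A' t < m - p - q then squash A' t else squash A' t + p) else squash C"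
  shows "(m + 1, (snd (degens (sset_power n K) C (faces (sset_power n K) [m - q + 1..<m + 1] (m, butlast xs))) @
      [snd (degens K A' (faces K [m - p - q..<m - q] (m, last xs)))]) ! (u - 1)) =
      act K (map (f u) [0..<Suc (m + 1)]) (m, xs ! (u - 1))"
    and "(m, xs ! (u - 1)) \<in> gsimplices K \<and> mono (f u) \<and> f u (m + 1) \<le> fst (m, xs ! (u - 1))"
proof -
  note sh = pq_shufflesD[OF AB]
  have finC: "finite C" "finite A'" using sh by (auto simp: C_def A'_def)
  have card: "card A' = p + 1" "card C = q + 1"
  proof -
    have im: "card ((+) k ` X) = card X" for k :: nat and X
      by (rule card_image) (simp add: inj_on_def)
    show "card A' = p + 1" by (simp only: A'_def im sh)
    have "m - p - q - 1 \<notin> (+) (m - p - q) ` B" using pq by auto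
    then have "card C = Suc (card ((+) (m - p - q) ` B))"
      unfolding C_def by (rule card_insert_disjoint[OF finite_imageI[OF sh(2)]])
    then show "card C = q + 1" by (simp only: im sh Suc_eq_plus1)
  qed
  have sub: "A' \<subseteq> {..<m + 1}" "C \<subseteq> {..<m + 1}"
    using sh(7,8) pq by (auto simp: A'_def C_def)
  have sqA: "squash A' (m + 1) = m - p" using squash_diff[OF finC(2) sub(1)] card by simp
  have sqC: "squash C (m + 1) = m - q" using squash_diff[OF finC(1) sub(2)] card by simp
  note len = sset_power_length[OF xs]
  have x: "(m, xs ! (u - 1)) \<in> gsimplices K"
    using sset_power_nth[OF xs u] by (simp add: gsimplices_def)
  show "(m, xs ! (u - 1)) \<in> gsimplices K \<and> mono (f u) \<and> f u (m + 1) \<le> fst (m, xs ! (u - 1))"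
  proof (intro conjI x)
    show "mono (f u)"
      unfolding f_def using mono_skip squash_mono by (auto simp: mono_def)
    show "f u (m + 1) \<le> fst (m, xs ! (u - 1))"
      using sqA sqC pq by (simp add: f_def)
  qed
  show "(m + 1, (snd (degens (sset_power n K) C (faces (sset_power n K) [m - q + 1..<m + 1] (m, butlast xs))) @
      [snd (degens K A' (faces K [m - p - q..<m - q] (m, last xs)))]) ! (u - 1)) =
      act K (map (f u) [0..<Suc (m + 1)]) (m, xs ! (u - 1))"
  proof (cases "u = Suc n")
    case True
    have last: "last xs = xs ! (u - 1)" using len True by (metis diff_Suc_1 last_conv_nth list.size(3) nat.distinct(1))
    have "(m + 1, snd (degens K A' (faces K [m - p - q..<m - q] (m, last xs)))) =
        degens K A' (faces K [m - p - q..<m - q] (m, last xs))"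
      using finC card pq by (intro prod_eqI) (auto simp: fst_degens fst_faces)
    also have "\<dots> = act K (map (\<lambda>t. if squash A' t < m - p - q then squash A' t else squash A' t + (m - q - (m - p - q)))
        [0..<Suc (fst (m, last xs)) - (m - q - (m - p - q)) + card A']) (m, last xs)"
      by (rule degens_faces_eq_act) (use x last finC card sub pq in auto)
    also have "Suc (fst (m, last xs)) - (m - q - (m - p - q)) + card A' = Suc (m + 1)" using card pq by simp
    also have "m - q - (m - p - q) = p" using pq by simp
    finally show ?thesis using True len
      by (simp add: faces_power degens_power finC f_def nth_append last del: upt_Suc)
  next
    case False
    then have u': "u - 1 < n" using u by auto
    have "(m + 1, snd (degens K C (faces K [m - q + 1..<m + 1] (m, xs ! (u - 1))))) =
        degens K C (faces K [m - q + 1..<m + 1] (m, xs ! (u - 1)))"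
      using finC card pq by (intro prod_eqI) (auto simp: fst_degens fst_faces simp del: upt_Suc)
    also have "\<dots> = act K (map (\<lambda>t. if squash C t < m - q + 1 then squash C t else squash C t + (m + 1 - (m - q + 1)))
        [0..<Suc (fst (m, xs ! (u - 1))) - (m + 1 - (m - q + 1)) + card C]) (m, xs ! (u - 1))"
      by (rule degens_faces_eq_act) (use x finC card sub pq in auto)
    also have "Suc (fst (m, xs ! (u - 1))) - (m + 1 - (m - q + 1)) + card C = Suc (m + 1)" using card pq by simp
    \<comment> \<open>The faces of the first variables delete the vertices above
      \<open>m - q\<close>, and \<open>squash C\<close> never exceeds this bound, so the deletion is
      invisible in the path.\<close>
    also have "map (\<lambda>t. if squash C t < m - q + 1 then squash C t else squash C t + (m + 1 - (m - q + 1))) [0..<Suc (m + 1)] =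
        map (squash C) [0..<Suc (m + 1)]"
    proof (rule map_cong[OF refl])
      fix t assume "t \<in> set [0..<Suc (m + 1)]"
      then have "squash C t \<le> m - q" using monoD[OF squash_mono, of t "m + 1" C] sqC by auto
      then show "(if squash C t < m - q + 1 then squash C t else squash C t + (m + 1 - (m - q + 1))) = squash C t"
        by simp
    qed
    finally have *: "(m + 1, snd (degens K C (faces K [m - q + 1..<m + 1] (m, xs ! (u - 1))))) =
        act K (map (squash C) [0..<Suc (m + 1)]) (m, xs ! (u - 1))" .
    have "faces K [m - q + 1..<m + 1] (m, xs ! (u - 1)) = (m - q, snd (faces K [m - q + 1..<m + 1] (m, xs ! (u - 1))))"
      using pq by (intro prod_eqI) (auto simp: fst_faces simp del: upt_Suc)
    with * show ?thesis using False len u' pq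
      by (simp add: faces_power degens_power finC f_def nth_append nth_butlast del: upt_Suc)
  qed
qed

text \<open>The jump \<open>m - p - q - 1\<close> raises only the last variable, so one of its intervals owns it. If this were not
  the last one, \<open>x_(n+1)\<close> would be constant between that interval and the next one, and the term degenerate.
  Afterwards \<open>B\<close> is the rest of the interval, and \<open>A\<close> is everything after it.\<close>

lemma SHI_survivor:
  assumes J: "label_partition (Suc n) N J"
    and pq: "p + q < m" and AB: "(A, B) \<in> pq_shuffles (p + 1) q"
    and xs: "xs \<in> simplices (sset_power (Suc n) K) m"
    and part: "is \<in> interval_partitions (m + 1) N" and sep: "\<forall>u\<in>{1..Suc n}. separated is (J u)"
    and nondeg: "tensor_term K (Suc n) J (m + 1)
      (snd (degens (sset_power n K) (insert (m - p - q - 1) ((+) (m - p - q) ` B))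
          (faces (sset_power n K) [m - q + 1..<m + 1] (m, butlast xs))) @
       [snd (degens K ((+) (m - p - q) ` A) (faces K [m - p - q..<m - q] (m, last xs)))]) is
      \<notin> degenerate_tensors (Suc n) K"
  shows "is ! (Max (J (Suc n)) - 1) < m - p - q" "is ! Max (J (Suc n)) = m - p" "B = {0..<q}"
proof -
  note sh = pq_shufflesD[OF AB]
  let ?mb = "m - p - q" and ?v = "Max (J (Suc n))"
  let ?A = "(+) ?mb ` A" and ?C = "insert (?mb - 1) ((+) ?mb ` B)"
  let ?g = "\<lambda>t. if squash ?A t < ?mb then squash ?A t else squash ?A t + p"
  have Jn: "J (Suc n) \<subseteq> {1..N}" "J (Suc n) \<noteq> {}" "finite (J (Suc n))"
    using J finite_subset[of "J (Suc n)" "{1..N}"] by (auto simp: label_partition_def)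
  have v: "?v \<in> J (Suc n)" "\<And>k. k \<in> J (Suc n) \<Longrightarrow> k \<le> ?v" using Jn by auto
  have vN: "?v \<in> {1..N}" using v(1) Jn(1) by blast
  have inj: "inj_on (if u = Suc n then ?g else squash ?C) (vertices is (J u))" if u: "u \<in> {1..Suc n}" for u
    using tensor_term_degenerate[OF J part sep SHI_entry[OF pq AB xs] u] nondeg by blast
  have edge_A: "t \<notin> ?A" if "k \<in> J (Suc n)" "is ! (k - 1) \<le> t" "t < is ! k" for t k
  proof
    assume "t \<in> ?A"
    then have "squash ?A (Suc t) = squash ?A t" by (simp only: squash_Suc if_True)
    then have "?g t = ?g (Suc t)" by (simp only:)
    from not_inj_on_vertices_edge[OF that this] inj[of "Suc n"] show False by simp
  qed
  have edge_C: "k \<in> J (Suc n)" if t: "t \<in> ?C" and k: "k \<in> {1..N}" "is ! (k - 1) \<le> t" "t < is ! k" for t k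
  proof -
    obtain u where u: "u \<in> {1..Suc n}" "k \<in> J u" using label_partition_owner[OF J k(1)] by blast
    have "squash ?C t = squash ?C (Suc t)" using t by (simp only: squash_Suc if_True)
    from not_inj_on_vertices_edge[of k "J u" _ t "squash ?C", OF u(2) k(2,3) this] inj[OF u(1)]
    have "u = Suc n" by (auto split: if_splits)
    then show ?thesis using u(2) by simp
  qed
  have cover: "t \<in> ?A \<or> t \<in> ?C" if "?mb - 1 \<le> t" "t < m + 1" for t
  proof (cases "t = ?mb - 1")
    case False
    then have "t - ?mb \<in> A \<union> B" "t = ?mb + (t - ?mb)" using that pq sh(5) by auto
    then show ?thesis by blast
  qed simp
  have "?mb - 1 < m + 1" by simp
  then obtain k0 where k0: "k0 \<in> {1..N}" "is ! (k0 - 1) \<le> ?mb - 1" "?mb - 1 < is ! k0"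
    by (rule interval_partitions_owner[OF part])
  have k0J: "k0 \<in> J (Suc n)" by (rule edge_C[OF insertI1 k0])
  have "k0 = ?v"
  proof (rule ccontr)
    assume "k0 \<noteq> ?v"
    then have "?v \<in> {k \<in> J (Suc n). k0 < k}" using v k0J by force
    then have ne: "{k \<in> J (Suc n). k0 < k} \<noteq> {}" by blast
    define k' where "k' = Min {k \<in> J (Suc n). k0 < k}"
    have k': "k' \<in> J (Suc n)" "k0 < k'" "\<And>k. k \<in> J (Suc n) \<Longrightarrow> k0 < k \<Longrightarrow> k' \<le> k"
      using Min_in[OF _ ne] Jn(3) Min_le[of "{k \<in> J (Suc n). k0 < k}"] unfolding k'_def by auto
    have k'N: "k' \<le> N" using k'(1) Jn(1) by auto
    \<comment> \<open>A step of \<open>?C\<close> in this gap would be owned by a label of the last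
      variable strictly between \<open>k0\<close> and \<open>k'\<close>, which the choice of
      \<open>k'\<close> excludes.\<close>
    have sub: "{is ! k0..<is ! (k' - 1)} \<subseteq> ?A"
    proof
      fix t assume t: "t \<in> {is ! k0..<is ! (k' - 1)}"
      have "k' - 1 \<le> N" using k'N by simp
      then have "t < m + 1" using interval_partitions_le[OF part, of "k' - 1"] t by auto
      then obtain k where k: "k \<in> {1..N}" "is ! (k - 1) \<le> t" "t < is ! k"
        by (rule interval_partitions_owner[OF part])
      have "k \<notin> J (Suc n)"
      proof
        assume "k \<in> J (Suc n)"
        moreover have "k0 < k"
        proof (rule ccontr)
          assume "\<not> k0 < k"
          then have "is ! k \<le> is ! k0" using interval_partitions_mono[OF part, of k k0] k0(1) by auto
          then show False using k t by auto
        qed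
        ultimately have "k' \<le> k" by (rule k'(3))
        then have "is ! (k' - 1) \<le> is ! (k - 1)"
          using interval_partitions_mono[OF part, of "k' - 1" "k - 1"] k(1) by auto
        then show False using k t by auto
      qed
      then have "t \<notin> ?C" using edge_C[of t k] k by blast
      then show "t \<in> ?A" using cover[of t] t k0(3) \<open>t < m + 1\<close> by auto
    qed
    have "separated is (J (Suc n))" using sep by simp
    then have "is ! k0 < is ! (k' - 1)" using k0J k'(1,2) unfolding separated_def by blast
    then have "squash ?A (is ! (k' - 1)) = squash ?A (is ! k0)"
      by (intro squash_const sub) simp
    then have "?g (is ! k0) = ?g (is ! (k' - 1))" by (simp only:)
    moreover have "separated is (J (Suc n))" using sep by simp
    ultimately show False
      using not_inj_on_vertices[OF part Jn(1) _ k0J k'(1,2), of ?g] inj[of "Suc n"] by simp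
  qed
  then have e: "is ! (?v - 1) \<le> ?mb - 1" "?mb - 1 < is ! ?v" using k0 by auto
  then show "is ! (?v - 1) < ?mb" using pq by linarith
  have B_iff: "t \<in> B \<longleftrightarrow> t < is ! ?v - ?mb" for t
  proof
    assume t: "t \<in> B"
    then have tC: "?mb + t \<in> ?C" by blast
    have "?mb + t < m + 1" using t sh(8) pq by auto
    then obtain k where k: "k \<in> {1..N}" "is ! (k - 1) \<le> ?mb + t" "?mb + t < is ! k"
      by (rule interval_partitions_owner[OF part])
    have "k \<le> ?v" by (rule v(2)) (rule edge_C[OF tC k])
    then have "is ! k \<le> is ! ?v" using interval_partitions_mono[OF part, of k ?v] vN by auto
    then show "t < is ! ?v - ?mb" using k(3) by simp
  next
    assume t: "t < is ! ?v - ?mb"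
    then have "?mb + t \<notin> ?A" using edge_A[OF v(1), of "?mb + t"] e by simp
    then have "t \<notin> A" by blast
    moreover have "is ! ?v \<le> m + 1" using interval_partitions_le[OF part] vN by simp
    then have "t < p + 1 + q" using t pq by simp
    ultimately show "t \<in> B" using sh(5) by auto
  qed
  have B: "B = {0..<is ! ?v - ?mb}"
    by (rule set_eqI) (simp only: B_iff atLeastLessThan_iff le0 simp_thms)
  have q: "is ! ?v - ?mb = q"
    using sh(4) card_atLeastLessThan[of 0 "is ! ?v - ?mb"] unfolding B[symmetric] by (simp only: diff_zero)
  show "B = {0..<q}" using B unfolding q .
  show "is ! ?v = m - p" using q e pq by linarith
qed

end

section \<open>Cutting the last interval of a variable in two\<close>

lemma label_partition_extend:
  assumes "label_partition (Suc n) N J"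
  shows "label_partition (Suc n) (Suc N) (\<lambda>u. if u = Suc n then insert (Suc N) (J u) else J u)"
proof -
  let ?Jo = "\<lambda>u. if u = Suc n then insert (Suc N) (J u) else J u"
  have J: "\<And>u. u \<in> {1..Suc n} \<Longrightarrow> J u \<subseteq> {1..N}" "\<And>u. u \<in> {1..Suc n} \<Longrightarrow> J u \<noteq> {}"
    using assms by (auto simp: label_partition_def)
  have Jo: "k \<in> ?Jo u \<longleftrightarrow> (k \<in> J u \<and> k \<noteq> Suc N) \<or> (k = Suc N \<and> u = Suc n)" if "u \<in> {1..Suc n}" for k u
    using J(1)[OF that] by auto
  show ?thesis
    unfolding label_partition_def
  proof (intro conjI ballI)
    fix u assume u: "u \<in> {1..Suc n}"
    show "?Jo u \<subseteq> {1..Suc N}" using J(1)[OF u] by (auto simp: subset_iff)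
    show "?Jo u \<noteq> {}" using J(2)[OF u] by auto
  next
    fix k assume k: "k \<in> {1..Suc N}"
    show "\<exists>!u. u \<in> {1..Suc n} \<and> k \<in> ?Jo u"
    proof (cases "k = Suc N")
      case True
      show ?thesis
      proof (rule ex1I[of _ "Suc n"])
        show "Suc n \<in> {1..Suc n} \<and> k \<in> ?Jo (Suc n)" using True by simp
        fix u assume "u \<in> {1..Suc n} \<and> k \<in> ?Jo u"
        then show "u = Suc n" using Jo[of u k] True by blast
      qed
    next
      case False
      then have "k \<in> {1..N}" using k by auto
      then obtain u where u: "u \<in> {1..Suc n}" "k \<in> J u" by (rule label_partition_owner[OF assms])
      show ?thesis
      proof (rule ex1I[of _ u])
        show "u \<in> {1..Suc n} \<and> k \<in> ?Jo u" using u Jo[OF u(1)] False by blast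
        fix v assume v: "v \<in> {1..Suc n} \<and> k \<in> ?Jo v"
        then have "k \<in> J v" using Jo[of v k] False by blast
        then show "v = u" using label_partition_unique[OF assms, of v u k] u v by blast
      qed
    qed
  qed
qed

text \<open>The inverse of cutting the interval \<open>v\<close> at the jump of the Shih operator: the pieces are the new
  interval \<open>v\<close>, one edge, and the last interval of \<open>is\<close>.\<close>

definition widen_interval :: "nat \<Rightarrow> nat \<Rightarrow> nat \<Rightarrow> nat list \<Rightarrow> nat list" where
  "widen_interval N v m is = map (\<lambda>k. if k < v then is ! k else is ! k + Suc (m - is ! N)) [0..<Suc N]"

lemma widen_interval_nth:
  "k \<le> N \<Longrightarrow> widen_interval N v m is ! k = (if k < v then is ! k else is ! k + Suc (m - is ! N))"
  by (simp add: widen_interval_def del: upt_Suc)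

lemma widen_interval_partition:
  assumes "is \<in> interval_partitions m (Suc N)" "v \<in> {1..N}"
  shows "widen_interval N v m is \<in> interval_partitions (m + 1) N"
proof (rule interval_partitionsI)
  show "length (widen_interval N v m is) = Suc N" by (simp add: widen_interval_def)
  show "widen_interval N v m is ! 0 = 0" "widen_interval N v m is ! N = m + 1"
    using assms interval_partitions_0[OF assms(1)] interval_partitions_le[OF assms(1), of N]
    by (auto simp: widen_interval_nth)
  fix i assume "i < N"
  then show "widen_interval N v m is ! i \<le> widen_interval N v m is ! Suc i"
    using interval_partitions_mono[OF assms(1), of i "Suc i"] by (auto simp: widen_interval_nth)
qed

text \<open>The collapsed block consists of the jump edge and the part of the widened interval after
  it. Left of it nothing moves, and all endpoints from \<open>v\<close> on fall back by its
  length.\<close>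

lemma widen_interval_squash:
  assumes "is \<in> interval_partitions m (Suc N)" "v \<in> {1..N}" "k \<le> N"
  shows "squash {is ! v..<is ! v + Suc (m - is ! N)} (widen_interval N v m is ! k) = is ! k"
proof (cases "k < v")
  case True
  then have "is ! k \<le> is ! v" using interval_partitions_mono[OF assms(1), of k v] assms by auto
  then show ?thesis using True assms(3) unfolding squash_interval by (simp add: widen_interval_nth)
next
  case False
  then have "is ! v \<le> is ! k" using interval_partitions_mono[OF assms(1), of v k] assms by auto
  then have "min (Suc (m - is ! N)) (is ! k + Suc (m - is ! N) - is ! v) = Suc (m - is ! N)" by simp
  then show ?thesis using False assms(3) unfolding squash_interval by (simp add: widen_interval_nth)
qed

text \<open>Interval \<open>v\<close> must have room for the jump edge and \<open>q\<close> further
  edges, whence the first inequality. The second one says that the jump skips no negative number of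
  vertices; it becomes \<open>is' ! v < is' ! N\<close>.\<close>

lemma widen_intervalE:
  assumes part: "is \<in> interval_partitions (m + 1) N" and v: "v \<in> {1..N}" and q: "q \<le> m"
    and lt: "is ! (v - 1) + Suc q \<le> is ! v" "is ! v \<le> m"
  obtains is' where "is' \<in> interval_partitions m (Suc N)" "is' ! v < is' ! N" "is = widen_interval N v m is'"
    "is' ! v = is ! v - Suc q" "is' ! N = m - q"
proof -
  define is' where "is' = map (\<lambda>k. if k < v then is ! k else if k \<le> N then is ! k - Suc q else m) [0..<Suc (Suc N)]"
  have nth: "is' ! k = (if k < v then is ! k else if k \<le> N then is ! k - Suc q else m)" if "k \<le> Suc N" for k
    using that by (simp add: is'_def del: upt_Suc)
  have N: "is' ! N = m - q" "is' ! v = is ! v - Suc q" "is' ! Suc N = m"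
    using nth[of N] nth[of v] nth[of "Suc N"] v interval_partitions_last[OF part] by auto
  note mono = interval_partitions_mono[OF part]
  have part': "is' \<in> interval_partitions m (Suc N)"
  proof (rule interval_partitionsI)
    show "is' ! 0 = 0" using v nth[of 0] interval_partitions_0[OF part] by auto
    fix i assume i: "i < Suc N"
    consider "i = N" | "Suc i < v" "i < N" | "Suc i = v" "i < N" | "v \<le> i" "i < N" using i by linarith
    then show "is' ! i \<le> is' ! Suc i"
    proof cases
      case 1
      then show ?thesis using N by simp
    next
      case 2
      then show ?thesis using mono[of i "Suc i"] by (simp add: nth)
    next
      case 3
      then show ?thesis using lt by (auto simp: nth)
    next
      case 4
      then show ?thesis using mono[of i "Suc i"] by (simp add: nth)
    qed
  next
    show "length is' = Suc (Suc N)" by (simp add: is'_def)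
    show "is' ! Suc N = m" by (rule N(3))
  qed
  have lt': "is' ! v < is' ! N" using N lt q by simp
  have "is = widen_interval N v m is'"
  proof (rule nth_equalityI)
    show "length is = length (widen_interval N v m is')"
      using interval_partitions_length[OF part] by (simp add: widen_interval_def)
    fix k assume "k < length is"
    then have k: "k \<le> N" using interval_partitions_length[OF part] by simp
    have "v \<le> k \<Longrightarrow> Suc q \<le> is ! k" using mono[of v k] k lt by simp
    then show "is ! k = widen_interval N v m is' ! k"
      using k q by (auto simp: widen_interval_nth nth[of k] N)
  qed
  then show ?thesis using that part' lt' N by blast
qed

text \<open>The widened list alone forgets where interval \<open>v\<close> was cut, so the length of
  the split-off part has to be given too; the reindexing map retains it as \<open>q\<close>.\<close>

lemma inj_widen_interval:
  assumes "is \<in> interval_partitions m (Suc N)" "is' \<in> interval_partitions m (Suc N)"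
    and "widen_interval N v m is = widen_interval N v m is'" "m - is ! N = m - is' ! N"
  shows "is = is'"
proof (rule nth_equalityI)
  note len = interval_partitions_length[OF assms(1)] interval_partitions_length[OF assms(2)]
  show "length is = length is'" by (simp add: len)
  fix k assume k: "k < length is"
  show "is ! k = is' ! k"
  proof (cases "k = Suc N")
    case True
    then show ?thesis using interval_partitions_last[OF assms(1)] interval_partitions_last[OF assms(2)] by simp
  next
    case False
    then have "k \<le> N" using k len by simp
    then have "(if k < v then is ! k else is ! k + Suc (m - is ! N)) = (if k < v then is' ! k else is' ! k + Suc (m - is' ! N))"
      using assms(3) widen_interval_nth by metis
    then show ?thesis using assms(4) by (auto split: if_splits)
  qed
qed

text \<open>\<open>transfer_vertices\<close> with unchanged labels: the collapsed block lies inside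
  the widened interval \<open>v\<close>, which belongs to the last variable, so no edge of another
  variable is lost.\<close>

lemma SHI_transfer:
  assumes J: "label_partition (Suc n) N J" and part: "is' \<in> interval_partitions m (Suc N)"
    and v: "v \<in> J (Suc n)" "v \<in> {1..N}" and u: "u \<in> {1..n}"
  defines "is \<equiv> widen_interval N v m is'" and "f \<equiv> squash {is' ! v..<is' ! v + Suc (m - is' ! N)}"
  shows "separated is' (J u) \<Longrightarrow> separated is (J u)"
    and "separated is' (J u) \<Longrightarrow> map f (sorted_list_of_set (vertices is (J u))) = sorted_list_of_set (vertices is' (J u))"
    and "separated is (J u) \<Longrightarrow> \<not> separated is' (J u) \<Longrightarrow> \<not> inj_on f (vertices is (J u))"
proof -
  have part2: "is \<in> interval_partitions (m + 1) N"
    unfolding is_def by (rule widen_interval_partition[OF part v(2)])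
  have Ju: "J u \<subseteq> {1..N}" using J u by (simp add: label_partition_def)
  have nv: "v \<notin> J u"
  proof
    assume "v \<in> J u"
    then have "u = Suc n" using label_partition_unique[OF J, of u "Suc n" v] u v by simp
    then show False using u by simp
  qed
  have f_is: "f (is ! k) = is' ! k" if "k \<le> N" for k
    unfolding f_def is_def by (rule widen_interval_squash[OF part v(2) that])
  have f: "mono f" unfolding f_def by (rule squash_mono)
  have step: "f t = f (is ! (k - 1)) + (t - is ! (k - 1))"
    if k: "k \<in> J u" and t: "is ! (k - 1) \<le> t" "t \<le> is ! k" for k t
    unfolding f_def
  proof (rule squash_step[OF t(1)])
    have k': "k \<noteq> v" "1 \<le> k" "k \<le> N" using k nv Ju by auto
    show "{is ! (k - 1)..<t} \<inter> {is' ! v..<is' ! v + Suc (m - is' ! N)} = {}"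
    proof (cases "k < v")
      case True
      then have "is ! k \<le> is' ! v"
        using interval_partitions_mono[OF part, of k v] v(2) k' by (simp add: is_def widen_interval_nth)
      then show ?thesis using t by auto
    next
      case False
      then have "is ! v \<le> is ! (k - 1)" using interval_partitions_mono[OF part2, of v "k - 1"] k' by auto
      moreover have "is ! v = is' ! v + Suc (m - is' ! N)" using v(2) by (simp add: is_def widen_interval_nth)
      ultimately show ?thesis by auto
    qed
  qed
  have ends: "is' ! id k = f (is ! k)" "is' ! (id k - 1) = f (is ! (k - 1))" if k: "k \<in> J u" for k
  proof -
    have "k \<le> N" using k Ju by auto
    then show "is' ! id k = f (is ! k)" "is' ! (id k - 1) = f (is ! (k - 1))" by (simp_all add: f_is)
  qed
  have "strict_mono_on (J u) id" by (simp add: strict_mono_on_def)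
  note tr = transfer_vertices[OF part2 Ju f step this ends, unfolded id_def image_ident]
  show "separated is' (J u) \<Longrightarrow> separated is (J u)"
    and "separated is' (J u) \<Longrightarrow> map f (sorted_list_of_set (vertices is (J u))) = sorted_list_of_set (vertices is' (J u))"
    and "separated is (J u) \<Longrightarrow> \<not> separated is' (J u) \<Longrightarrow> \<not> inj_on f (vertices is (J u))"
    using tr by blast+
qed

text \<open>The last variable loses no vertex but has a jump in the middle of interval
  \<open>v\<close>. The image of the widened interval is therefore the union of two intervals, and
  the second one, ending at \<open>m\<close>, is that of the new label \<open>Suc N\<close>.\<close>

lemma SHI_last_transfer:
  assumes Jn: "Jn \<subseteq> {1..N}" and part: "is' \<in> interval_partitions m (Suc N)"
    and v: "v \<in> Jn" "\<And>k. k \<in> Jn \<Longrightarrow> k \<le> v" and lt: "is' ! v < is' ! N"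
  defines "is \<equiv> widen_interval N v m is'"
  defines "g \<equiv> (\<lambda>t. if squash {is ! v..<m + 1} t < Suc (is' ! v) then squash {is ! v..<m + 1} t
    else squash {is ! v..<m + 1} t + (is' ! N - Suc (is' ! v)))"
  shows "separated is' (insert (Suc N) Jn) \<longleftrightarrow> separated is Jn"
    and "map g (sorted_list_of_set (vertices is Jn)) = sorted_list_of_set (vertices is' (insert (Suc N) Jn))"
proof -
  let ?e = "is' ! v" and ?iv = "is ! v" and ?p = "is' ! N - Suc (is' ! v)"
  have vN: "v \<in> {1..N}" using v(1) Jn by blast
  have part2: "is \<in> interval_partitions (m + 1) N"
    unfolding is_def by (rule widen_interval_partition[OF part vN])
  have Nm: "is' ! N \<le> m" "is' ! Suc N = m"
    using interval_partitions_le[OF part] interval_partitions_last[OF part] by auto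
  have iv: "?iv = ?e + Suc (m - is' ! N)" using vN by (simp add: is_def widen_interval_nth)
  have ivm: "?iv + ?p = m" "?iv \<le> m" using iv lt Nm by auto
  have eq: "is ! k = is' ! k" if "k < v" for k
    using that vN by (simp add: is_def widen_interval_nth)
  have Jn_le: "1 \<le> k" "k \<le> v" if "k \<in> Jn" for k using that v Jn by auto
  have sep_iff: "is ! j < is ! (k - 1) \<longleftrightarrow> is' ! j < is' ! (k - 1)" if "j \<in> Jn" "k \<in> Jn" "j < k" for j k
    using Jn_le[OF that(2)] that(3) by (simp add: eq)
  have lastN: "is' ! j < is' ! N" if "j \<in> Jn" for j
    using interval_partitions_mono[OF part, of j v] Jn_le[OF that] vN lt by simp
  have "separated is' (insert (Suc N) Jn) \<longleftrightarrow> separated is' Jn"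
  proof
    assume "separated is' Jn"
    moreover have "k \<le> N" if "k \<in> Jn" for k using that Jn by auto
    ultimately show "separated is' (insert (Suc N) Jn)"
      using lastN by (fastforce simp: separated_def)
  qed (simp add: separated_def)
  also have "\<dots> \<longleftrightarrow> separated is Jn"
    using sep_iff by (auto simp: separated_def)
  finally show "separated is' (insert (Suc N) Jn) \<longleftrightarrow> separated is Jn" .
  have sq: "squash {?iv..<m + 1} t = t" if "t \<le> ?iv" for t
  proof -
    have "squash {?iv..<?iv + (m + 1 - ?iv)} t = t" using that unfolding squash_interval by simp
    then show ?thesis using ivm by simp
  qed
  \<comment> \<open>The steps in the set \<open>A\<close> of the shuffle begin only at
    \<open>?iv\<close>, the end of the widened interval. Up to there \<open>squash\<close> is the
    identity and only the jump by \<open>?p\<close> is left.\<close>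
  have g: "g t = (if t \<le> ?e then t else t + ?p)" if "t \<le> ?iv" for t
    using sq[OF that] by (simp add: g_def)
  have g_low: "g t = t" if "t \<le> ?e" for t using g[of t] that iv by simp
  have monog: "mono g"
  proof (rule monoI)
    fix s t :: nat assume "s \<le> t"
    then have "squash {?iv..<m + 1} s \<le> squash {?iv..<m + 1} t" by (rule monoD[OF squash_mono])
    then show "g s \<le> g t" by (simp add: g_def)
  qed
  have V_le: "vertices is Jn \<subseteq> {..?iv}"
  proof -
    have "is ! k \<le> ?iv" if "k \<in> Jn" for k
      using interval_partitions_mono[OF part2, of k v] Jn_le[OF that] vN by simp
    then show ?thesis by (fastforce simp: vertices_def)
  qed
  have inj: "inj_on g (vertices is Jn)"
  proof (rule inj_onI)
    fix s t assume "s \<in> vertices is Jn" "t \<in> vertices is Jn" "g s = g t"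
    moreover from this have "s \<le> ?iv" "t \<le> ?iv" using V_le by auto
    ultimately show "s = t" using g[of s] g[of t] by (auto split: if_splits)
  qed
  have "g ` vertices is Jn = vertices is' (insert (Suc N) Jn)"
  proof -
    let ?U = "vertices is (Jn - {v})"
    have U: "?U = vertices is' (Jn - {v})"
    proof -
      have "{is ! (k - 1)..is ! k} = {is' ! (k - 1)..is' ! k}" if "k \<in> Jn - {v}" for k
      proof -
        have "k < v" using Jn_le[of k] that by auto
        then show ?thesis by (simp add: eq)
      qed
      then show ?thesis unfolding vertices_def by (intro SUP_cong refl)
    qed
    have U_le: "t \<le> ?e" if t: "t \<in> ?U" for t
    proof -
      have "t \<in> vertices is' (Jn - {v})" using t by (simp only: U)
      then obtain k where k: "k \<in> Jn" "k \<noteq> v" "t \<le> is' ! k" by (auto simp: vertices_def)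
      then show ?thesis using interval_partitions_mono[OF part, of k v] Jn_le[OF k(1)] vN by simp
    qed
    have a: "is ! (v - 1) = is' ! (v - 1)" "is' ! (v - 1) \<le> ?e"
      using eq[of "v - 1"] interval_partitions_mono[OF part, of "v - 1" v] vN by auto
    \<comment> \<open>Interval \<open>v\<close> is cut at its jump edge from \<open>?e\<close> to
      \<open>Suc ?e\<close>; the piece after it is translated by \<open>?p\<close> onto the vertices
      \<open>is' ! N\<close> to \<open>m\<close>.\<close>
    have "vertices is Jn = ?U \<union> {is' ! (v - 1)..?e} \<union> {Suc ?e..?iv}"
    proof -
      have "vertices is Jn = ?U \<union> {is ! (v - 1)..is ! v}" using v(1) by (auto simp: vertices_def)
      also have "{is ! (v - 1)..is ! v} = {is' ! (v - 1)..?e} \<union> {Suc ?e..?iv}" using a iv by auto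
      finally show ?thesis by (simp add: Un_assoc)
    qed
    then have "g ` vertices is Jn = g ` ?U \<union> g ` {is' ! (v - 1)..?e} \<union> g ` {Suc ?e..?iv}"
      by (simp add: image_Un)
    also have "g ` ?U = (\<lambda>t. t) ` ?U"
      by (rule image_cong[OF refl]) (rule g_low, erule U_le)
    also have "g ` {is' ! (v - 1)..?e} = (\<lambda>t. t) ` {is' ! (v - 1)..?e}"
      by (rule image_cong[OF refl]) (rule g_low, simp)
    also have "g ` {Suc ?e..?iv} = (\<lambda>t. t + ?p) ` {Suc ?e..?iv}"
      by (rule image_cong[OF refl]) (simp add: g)
    also have "(\<lambda>t. t + ?p) ` {Suc ?e..?iv} = {Suc ?e + ?p..?iv + ?p}"
      by simp
    also have "{Suc ?e + ?p..?iv + ?p} = {is' ! N..is' ! Suc N}" using ivm lt Nm by simp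
    finally have "g ` vertices is Jn = vertices is' (Jn - {v}) \<union> {is' ! (v - 1)..is' ! v} \<union> {is' ! N..is' ! Suc N}"
      by (simp add: U)
    then show ?thesis using v(1) by (auto simp: vertices_def)
  qed
  then show "map g (sorted_list_of_set (vertices is Jn)) = sorted_list_of_set (vertices is' (insert (Suc N) Jn))"
    using mono_image_sorted_list[OF finite_subset[OF V_le] monog inj] by simp
qed

text \<open>The extra 1 is the jump edge. This identity is the origin of the substitution for the
  label \<open>v\<close> in the second step of the sign.\<close>

lemma interval_length_widen_interval:
  assumes part: "is \<in> interval_partitions m (Suc N)" and v: "v \<in> {1..N}" and k: "k \<in> {1..N}"
  shows "interval_length (widen_interval N v m is) k =
    (if k = v then interval_length is v + interval_length is (Suc N) + 1 else interval_length is k)"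
proof -
  have "is ! N \<le> m" "is ! Suc N = m"
    using interval_partitions_le[OF part] interval_partitions_last[OF part] by auto
  then show ?thesis
    using v k by (auto simp: interval_length_def widen_interval_nth)
qed

context simplicial_set
begin

text \<open>The case in which no variable is split off, and the base of the induction: the Shih
  operator acts on the last variable, adds one label to it and changes the exponent by the second
  step alone.\<close>

lemma expression_SHI:
  fixes S :: sign_expr
  assumes J: "label_partition (Suc n) N J" and S: "local_sign N S"
    and xs: "xs \<in> simplices (sset_power (Suc n) K) m"
  defines "v \<equiv> Max (J (Suc n))" and "Jo \<equiv> (\<lambda>u. if u = Suc n then insert (Suc N) (J u) else J u)"
  shows "cong_mod (degenerate_tensors (Suc n) K)
    (lin_ext (\<lambda>(m, ys). expression K (Suc n) N id J S m ys)
      (push join_last (SHI (sset_power n K) K (split_last (m, xs)))))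
    (expression K (Suc n) (Suc N) id Jo (sign_step2 N 0 v S) m xs :: _ \<Rightarrow>\<^sub>0 'r::comm_ring_1)"
proof -
  have Jn: "J (Suc n) \<subseteq> {1..N}" "J (Suc n) \<noteq> {}" "finite (J (Suc n))"
    using J finite_subset[of "J (Suc n)" "{1..N}"] by (auto simp: label_partition_def)
  have v: "v \<in> J (Suc n)" "\<And>k. k \<in> J (Suc n) \<Longrightarrow> k \<le> v" using Jn by (auto simp: v_def)
  have vN: "v \<in> {1..N}" using v(1) Jn(1) by blast
  have Jo: "label_partition (Suc n) (Suc N) Jo" unfolding Jo_def by (rule label_partition_extend[OF J])
  let ?So = "sign_step2 N 0 v S"
  let ?ys = "\<lambda>p q A B. snd (degens (sset_power n K) (insert (m - p - q - 1) ((+) (m - p - q) ` B))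
          (faces (sset_power n K) [m - q + 1..<m + 1] (m, butlast xs))) @
       [snd (degens K ((+) (m - p - q) ` A) (faces K [m - p - q..<m - q] (m, last xs)))]"
  let ?T = "interval_partitions (m + 1) N \<times> (SIGMA pq:{(p, q). p + q < m}. pq_shuffles (fst pq + 1) (snd pq))"
  \<comment> \<open>The jump must lead to a larger vertex. For the remaining partitions interval
    \<open>v\<close> and the additional interval touch, and the output has no summand.\<close>
  let ?P = "{is'. is' \<in> interval_partitions m (Suc N) \<and> is' ! v < is' ! N}"
  define F :: "_ \<Rightarrow> (_ \<Rightarrow>\<^sub>0 'r)" where "F = (\<lambda>t. case t of (is, ((p, q), (A, B))) \<Rightarrow>
      if \<forall>u\<in>{1..Suc n}. separated is (J u)
      then Poly_Mapping.single (tensor_term K (Suc n) J (m + 1) (?ys p q A B) is)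
        (minus_one_pow (S (interval_length is)) * (- 1) ^ (m - p - q - 1 + sig A)) else 0)"
  \<comment> \<open>The additional interval has length \<open>q\<close>, and the gap between
    interval \<open>v\<close> and it has length \<open>p + 1\<close>. The shuffle performs the
    \<open>q\<close> steps of the last variable first; the form \<open>0 + _\<close> fits
    \<open>sig_complement_interval\<close> with \<open>b = 0\<close>.\<close>
  define G where "G = (\<lambda>is'. (widen_interval N v m is', ((is' ! N - Suc (is' ! v), m - is' ! N),
     ({0..<is' ! N - Suc (is' ! v) + 1 + (m - is' ! N)} - {0..<0 + (m - is' ! N)}, {0..<m - is' ! N}))))"
  define H :: "_ \<Rightarrow> (_ \<Rightarrow>\<^sub>0 'r)" where "H = (\<lambda>is'. if \<forall>u\<in>{1..Suc n}. separated is' (Jo u)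
      then Poly_Mapping.single (tensor_term K (Suc n) Jo m xs is')
        (minus_one_pow (?So (interval_length is'))) else 0)"
  have fin: "finite {(p, q). p + q < m}"
    by (rule finite_subset[of _ "{..m} \<times> {..m}"]) auto
  have le: "is' ! N \<le> m" if "is' \<in> ?P" for is'
    using that interval_partitions_le[of is' m "Suc N" N] by auto
  have G_T: "G is' \<in> ?T" if "is' \<in> ?P" for is'
  proof -
    have "widen_interval N v m is' \<in> interval_partitions (m + 1) N"
      by (rule widen_interval_partition[OF _ vN]) (use that in simp)
    moreover have "({0..<x + 1 + y} - {0..<0 + y}, {0..<y}) \<in> pq_shuffles (x + 1) y" for x y :: nat
      by (auto simp: pq_shuffles_def card_Diff_subset)
    moreover have "is' ! N - Suc (is' ! v) + (m - is' ! N) < m"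
      using that le[OF that] by auto
    ultimately show ?thesis by (simp add: G_def)
  qed
  have "cong_mod (degenerate_tensors (Suc n) K) (sum F ?T) (sum H (interval_partitions m (Suc N)))"
  proof (rule cong_mod_sum_reindex[where G = G and P' = ?P, OF _ finite_interval_partitions])
    show "finite ?T"
      by (intro finite_cartesian_product finite_interval_partitions finite_SigmaI fin finite_pq_shuffles)
    show "?P \<subseteq> interval_partitions m (Suc N)" by blast
    show "G ` ?P \<subseteq> ?T" by (rule image_subsetI) (rule G_T)
    show "inj_on G ?P"
    proof (rule inj_onI)
      fix is1 is2 assume "is1 \<in> ?P" "is2 \<in> ?P" "G is1 = G is2"
      then show "is1 = is2"
        by (intro inj_widen_interval[of is1 m N is2 v]) (auto simp: G_def)
    qed
  next
    fix t assume t: "t \<in> ?T" "t \<notin> G ` ?P"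
    obtain "is" p q A B where tt: "t = (is, ((p, q), (A, B)))" by (metis prod.exhaust)
    have part: "is \<in> interval_partitions (m + 1) N" and pq: "p + q < m" and AB: "(A, B) \<in> pq_shuffles (p + 1) q"
      using t(1) tt by auto
    show "cong_mod (degenerate_tensors (Suc n) K) (F t) 0"
    proof (cases "(\<forall>u\<in>{1..Suc n}. separated is (J u)) \<and>
        tensor_term K (Suc n) J (m + 1) (?ys p q A B) is \<notin> degenerate_tensors (Suc n) K")
      case True
      then have sep: "\<forall>u\<in>{1..Suc n}. separated is (J u)"
        and nondeg: "tensor_term K (Suc n) J (m + 1) (?ys p q A B) is \<notin> degenerate_tensors (Suc n) K" by blast+
      note surv = SHI_survivor[OF J pq AB xs part sep nondeg, folded v_def]
      have "is ! (v - 1) + Suc q \<le> is ! v" "is ! v \<le> m" "q \<le> m" using surv(1,2) pq by auto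
      then obtain is' where is': "is' \<in> interval_partitions m (Suc N)" "is' ! v < is' ! N" "is = widen_interval N v m is'"
        "is' ! v = is ! v - Suc q" "is' ! N = m - q"
        using widen_intervalE[OF part vN] by metis
      have q: "m - is' ! N = q" and p: "is' ! N - Suc (is' ! v) = p" using is'(4,5) surv(2) pq by auto
      have "A = {0..<p + 1 + q} - B" using pq_shufflesD(5,6)[OF AB] by auto
      then have "t = G is'" unfolding G_def q p using tt is'(3) surv(3) by simp
      then show ?thesis using t(2) is'(1,2) by blast
    next
      case False
      then show ?thesis by (auto simp: F_def tt intro: cong_mod_single_zero)
    qed
  next
    fix is' assume P: "is' \<in> ?P"
    then have part: "is' \<in> interval_partitions m (Suc N)" and lt: "is' ! v < is' ! N" by auto
    let ?is = "widen_interval N v m is'"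
    define p q e where "p = is' ! N - Suc (is' ! v)" and "q = m - is' ! N" and "e = is' ! v"
    let ?A = "{0..<p + 1 + q} - {0..<0 + q}" and ?B = "{0..<q}"
    have G: "G is' = (?is, ((p, q), (?A, ?B)))" by (simp add: G_def p_def q_def)
    have part2: "?is \<in> interval_partitions (m + 1) N" and pq: "p + q < m" and AB: "(?A, ?B) \<in> pq_shuffles (p + 1) q"
      using G_T[OF P] unfolding G by auto
    have mb: "m - p - q = Suc e" using lt le[OF P] by (simp add: p_def q_def e_def)
    have isv: "?is ! v = e + Suc q" using vN by (simp add: widen_interval_nth e_def q_def)
    have A': "(+) (m - p - q) ` ?A = {?is ! v..<m + 1}"
    proof -
      have "?A = {q..<p + 1 + q}" by auto
      moreover have "(+) (Suc e) ` {q..<p + 1 + q} = {Suc e + q..<Suc e + (p + 1 + q)}"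
        by (simp only: image_add_atLeastLessThan ac_simps)
      moreover have "Suc e + (p + 1 + q) = m + 1" using pq mb by simp
      ultimately show ?thesis by (simp only: isv mb add_Suc_right add_Suc)
    qed
    have C: "insert (m - p - q - 1) ((+) (m - p - q) ` ?B) = {is' ! v..<is' ! v + Suc (m - is' ! N)}"
    proof -
      have "(+) (Suc e) ` {0..<q} = {Suc e..<Suc e + q}"
        by (simp only: image_add_atLeastLessThan ac_simps add_0_left add_0_right)
      moreover have "insert e {Suc e..<Suc e + q} = {e..<e + Suc q}" by auto
      ultimately show ?thesis using mb by (simp add: e_def[symmetric] q_def[symmetric])
    qed
    let ?g = "\<lambda>t. if squash {?is ! v..<m + 1} t < m - p - q then squash {?is ! v..<m + 1} t
      else squash {?is ! v..<m + 1} t + p"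
    let ?f = "squash {is' ! v..<is' ! v + Suc (m - is' ! N)}"
    have entry: "(m + 1, ?ys p q ?A ?B ! (u - 1)) =
        act K (map (if u = Suc n then ?g else ?f) [0..<Suc (m + 1)]) (m, xs ! (u - 1))"
      and entry': "(m, xs ! (u - 1)) \<in> gsimplices K \<and> mono (if u = Suc n then ?g else ?f) \<and>
        (if u = Suc n then ?g else ?f) (m + 1) \<le> fst (m, xs ! (u - 1))"
      if "u \<in> {1..Suc n}" for u
      using SHI_entry[OF pq AB xs that] unfolding A' C by blast+
    note last = SHI_last_transfer[OF Jn(1) part v lt, folded p_def, folded e_def, folded mb]
    note head = SHI_transfer[OF J part v(1) vN]
    show "cong_mod (degenerate_tensors (Suc n) K) (F (G is')) (H is')"
    proof (cases "\<forall>u\<in>{1..Suc n}. separated is' (Jo u)")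
      case True
      have sep: "\<forall>u\<in>{1..Suc n}. separated ?is (J u)"
      proof
        fix u assume u: "u \<in> {1..Suc n}"
        then have "separated is' (Jo u)" using True by blast
        then show "separated ?is (J u)"
          using last(1) head(1)[of u] u by (cases "u = Suc n") (auto simp: Jo_def)
      qed
      have "tensor_term K (Suc n) J (m + 1) (?ys p q ?A ?B) ?is =
          map (\<lambda>u. act K (map (if u = Suc n then ?g else ?f)
              (sorted_list_of_set (vertices ?is (J u)))) (m, xs ! (u - 1))) [1..<Suc n + 1]"
        by (rule tensor_term_act[OF J part2 sep entry entry'])
      also have "\<dots> = map (\<lambda>u. act K (sorted_list_of_set (vertices is' (Jo u))) (m, xs ! (u - 1))) [1..<Suc n + 1]"
      proof (rule map_cong[OF refl])
        fix u assume "u \<in> set [1..<Suc n + 1]"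
        then have u: "u \<in> {1..Suc n}" by auto
        then have "separated is' (Jo u)" using True by blast
        then have "map (if u = Suc n then ?g else ?f) (sorted_list_of_set (vertices ?is (J u))) =
            sorted_list_of_set (vertices is' (Jo u))"
          using last(2) head(2)[of u] u by (cases "u = Suc n") (auto simp: Jo_def)
        then show "act K (map (if u = Suc n then ?g else ?f) (sorted_list_of_set (vertices ?is (J u)))) (m, xs ! (u - 1)) =
            act K (sorted_list_of_set (vertices is' (Jo u))) (m, xs ! (u - 1))" by (simp only:)
      qed
      also have "\<dots> = tensor_term K (Suc n) Jo m xs is'"
        by (rule tensor_term_self[OF Jo part True xs, symmetric])
      finally have terms: "tensor_term K (Suc n) J (m + 1) (?ys p q ?A ?B) ?is = tensor_term K (Suc n) Jo m xs is'" .
      let ?a = "interval_length is'"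
      have S_eq: "S (\<lambda>k. if N - 0 + 1 \<le> k \<and> k \<le> N then ?a (k + 1) - 1
            else if k = v then ?a v + ?a (N - 0 + 1) + 1 else ?a k) = S (interval_length ?is)"
        by (rule local_signD[OF S]) (auto simp: interval_length_widen_interval[OF part vN])
      \<comment> \<open>The summand \<open>m - p - q - 1\<close> in the exponent of SHI is the
        vertex \<open>e\<close> before the jump, the total length of the intervals 1 to
        \<open>v\<close>. The signature is \<open>q\<close> times the gap \<open>p + 1\<close>,
        which is the total length of the intervals \<open>v + 1\<close> to \<open>N\<close>.\<close>
      have sum1: "(\<Sum>k = 1..v. ?a k) = int e"
        using sum_interval_length[of 0 v is'] interval_partitions_0[OF part] by (simp add: e_def)
      have sum2: "(\<Sum>k = v + 1..N - 0. ?a k) = int (p + 1)"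
        using sum_interval_length[of v N is'] vN lt by (simp add: p_def)
      have aN: "?a (N - 0 + 1) = int q"
        using le[OF P] interval_partitions_last[OF part] by (simp add: interval_length_def q_def)
      have "sig ?A = q * (p + 1)" using sig_complement_interval[of 0 "p + 1" q] by simp
      moreover have "?So ?a = S (interval_length ?is) + (\<Sum>k = 1..v. ?a k) + (\<Sum>k = v + 1..N - 0. ?a k) * ?a (N - 0 + 1)"
        unfolding sign_step2_def S_eq ..
      ultimately have "?So ?a = S (interval_length ?is) + int (m - p - q - 1 + sig ?A)"
        unfolding sum1 sum2 aN mb by (simp add: algebra_simps)
      then have sign: "minus_one_pow (S (interval_length ?is)) * (- 1) ^ (m - p - q - 1 + sig ?A) = (minus_one_pow (?So ?a) :: 'r)"
        by (simp only: minus_one_pow_mult)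
      have "F (G is') = Poly_Mapping.single (tensor_term K (Suc n) J (m + 1) (?ys p q ?A ?B) ?is)
          (minus_one_pow (S (interval_length ?is)) * (- 1) ^ (m - p - q - 1 + sig ?A))"
        unfolding F_def G case_prod_conv by (rule if_P) (rule sep)
      moreover have "H is' = Poly_Mapping.single (tensor_term K (Suc n) Jo m xs is') (minus_one_pow (?So ?a))"
        unfolding H_def by (rule if_P) (rule True)
      ultimately show ?thesis by (simp only: sign terms cong_mod_refl)
    next
      case False
      have H: "H is' = 0" unfolding H_def by (rule if_not_P) (rule False)
      show ?thesis
      proof (cases "\<forall>u\<in>{1..Suc n}. separated ?is (J u)")
        case sep: True
        obtain u where u: "u \<in> {1..Suc n}" "\<not> separated is' (Jo u)" using False by blast
        have "separated ?is (J u)" "separated ?is (J (Suc n))" using sep u(1) by auto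
        then have un: "u \<noteq> Suc n" "\<not> separated is' (J u)"
          using u(2) last(1) by (cases "u = Suc n"; simp add: Jo_def)+
        then have "\<not> inj_on ?f (vertices ?is (J u))"
          using head(3)[of u] \<open>separated ?is (J u)\<close> u(1) by auto
        then have "\<not> inj_on (if u = Suc n then ?g else ?f) (vertices ?is (J u))"
          by (simp only: un if_False simp_thms)
        then have "tensor_term K (Suc n) J (m + 1) (?ys p q ?A ?B) ?is \<in> degenerate_tensors (Suc n) K"
          using tensor_term_degenerate[where f = "\<lambda>u. if u = Suc n then ?g else ?f" and
                z = "\<lambda>u. (m, xs ! (u - 1))", OF J part2 sep entry entry' u(1)] by blast
        then show ?thesis by (auto simp: F_def H G intro: cong_mod_single_zero)
      next
        case False
        then show ?thesis by (simp only: F_def H G case_prod_conv if_False cong_mod_refl)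
      qed
    qed
  next
    fix is' assume "is' \<in> interval_partitions m (Suc N)" "is' \<notin> ?P"
    then have "\<not> is' ! v < is' ! N" by blast
    moreover have "v < Suc N" using vN by simp
    ultimately have "\<not> separated is' (insert (Suc N) (J (Suc n)))"
      using v(1) by (auto simp: separated_def)
    then have "\<not> (\<forall>u\<in>{1..Suc n}. separated is' (Jo u))"
      by (auto simp: Jo_def)
    then show "cong_mod (degenerate_tensors (Suc n) K) (H is') 0"
      by (simp only: H_def if_False cong_mod_refl)
  qed
  moreover have "sum F ?T = lin_ext (\<lambda>(m, ys). expression K (Suc n) N id J S m ys)
      (push join_last (SHI (sset_power n K) K (split_last (m, xs))))"
    by (simp only: split_last_def case_prod_conv lin_ext_expression_SHI F_def)
  moreover have "sum H (interval_partitions m (Suc N)) = expression K (Suc n) (Suc N) id Jo ?So m xs"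
    by (simp only: expression_id H_def)
  ultimately show ?thesis by (simp only:)
qed

end

section \<open>The recursion over the split-off factors\<close>

text \<open>New factors are put at the front of the list, so the last factor \<open>t\<close> is a
  spectator. Raising \<open>n\<close> and \<open>s\<close> together keeps \<open>n - s\<close>, the
  power of \<open>K\<close> on which the operator acts.\<close>

lemma AW_ns_push:
  "AW_ns K (Suc n) (Suc s) (push (\<lambda>(z, zs). (z, zs @ [t])) c) = push (\<lambda>(z, zs). (z, zs @ [t])) (AW_ns K n s c)"
  unfolding AW_ns_def lin_ext_push push_lin_ext push_push
  by (rule lin_ext_cong) (simp add: case_prod_unfold push_push)

lemma SHI_ns_push:
  "SHI_ns K (Suc n) (Suc s) (push (\<lambda>(z, zs). (z, zs @ [t])) c) = push (\<lambda>(z, zs). (z, zs @ [t])) (SHI_ns K n s c)"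
  unfolding SHI_ns_def lin_ext_push push_lin_ext push_push
  by (rule lin_ext_cong) (simp add: case_prod_unfold push_push)

lemma EML_ns_push:
  assumes "\<And>b. b \<in> Poly_Mapping.keys c \<Longrightarrow> snd b \<noteq> []"
  shows "EML_ns K (Suc n) (Suc s) (push (\<lambda>(z, zs). (z, zs @ [t])) c) = push (\<lambda>(z, zs). (z, zs @ [t])) (EML_ns K n s c)"
  unfolding EML_ns_def lin_ext_push push_lin_ext push_push
  by (rule lin_ext_cong) (use assms in \<open>simp add: case_prod_unfold push_push\<close>)

lemma fold_AW_ns_push:
  "fold (AW_ns K (Suc n)) (map Suc L) (push (\<lambda>(z, zs). (z, zs @ [t])) c) =
    push (\<lambda>(z, zs). (z, zs @ [t])) (fold (AW_ns K n) L c)"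
  by (induction L arbitrary: c) (simp_all add: AW_ns_push)

lemma keys_AW_ns:
  assumes "\<And>b. b \<in> Poly_Mapping.keys c \<Longrightarrow> length (snd b) = k"
  shows "b \<in> Poly_Mapping.keys (AW_ns K n s c) \<Longrightarrow> length (snd b) = Suc k"
proof -
  have "Poly_Mapping.keys (AW_ns K n s c) \<subseteq> {b. length (snd b) = Suc k}"
    unfolding AW_ns_def case_prod_unfold
    by (rule keys_lin_ext_subset, rule keys_push_subset) (simp add: assms)
  then show "b \<in> Poly_Mapping.keys (AW_ns K n s c) \<Longrightarrow> length (snd b) = Suc k" by blast
qed

lemma keys_SHI_ns:
  assumes "\<And>b. b \<in> Poly_Mapping.keys c \<Longrightarrow> length (snd b) = k"
  shows "b \<in> Poly_Mapping.keys (SHI_ns K n s c) \<Longrightarrow> length (snd b) = k"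
proof -
  have "Poly_Mapping.keys (SHI_ns K n s c) \<subseteq> {b. length (snd b) = k}"
    unfolding SHI_ns_def case_prod_unfold
    by (rule keys_lin_ext_subset, rule keys_push_subset) (simp add: assms)
  then show "b \<in> Poly_Mapping.keys (SHI_ns K n s c) \<Longrightarrow> length (snd b) = k" by blast
qed

lemma keys_EML_ns:
  assumes "\<And>b. b \<in> Poly_Mapping.keys c \<Longrightarrow> length (snd b) = k"
  shows "b \<in> Poly_Mapping.keys (EML_ns K n s c) \<Longrightarrow> length (snd b) = k - 1"
proof -
  have "Poly_Mapping.keys (EML_ns K n s c) \<subseteq> {b. length (snd b) = k - 1}"
    unfolding EML_ns_def case_prod_unfold
    by (rule keys_lin_ext_subset, rule keys_push_subset) (simp add: assms)
  then show "b \<in> Poly_Mapping.keys (EML_ns K n s c) \<Longrightarrow> length (snd b) = k - 1" by blast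
qed

lemma keys_fold_AW_ns:
  assumes "\<And>b. b \<in> Poly_Mapping.keys c \<Longrightarrow> length (snd b) = k"
  shows "b \<in> Poly_Mapping.keys (fold (AW_ns K n) L c) \<Longrightarrow> length (snd b) = k + length L"
  using assms
proof (induction L arbitrary: c k)
  case (Cons s L)
  have "length (snd b) = Suc k + length L"
    by (rule Cons.IH[of "AW_ns K n s c"]) (use Cons.prems keys_AW_ns[OF Cons.prems(2)] in auto)
  then show ?case by simp
qed simp

lemma foldr_EML_ns_push:
  assumes "\<And>b. b \<in> Poly_Mapping.keys c \<Longrightarrow> length (snd b) = k" "length L \<le> k"
  shows "foldr (EML_ns K (Suc n)) (map Suc L) (push (\<lambda>(z, zs). (z, zs @ [t])) c) =
      push (\<lambda>(z, zs). (z, zs @ [t])) (foldr (EML_ns K n) L c) \<and>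
    (\<forall>b\<in>Poly_Mapping.keys (foldr (EML_ns K n) L c). length (snd b) = k - length L)"
  using assms(2)
proof (induction L)
  case (Cons s L)
  then have IH: "foldr (EML_ns K (Suc n)) (map Suc L) (push (\<lambda>(z, zs). (z, zs @ [t])) c) =
      push (\<lambda>(z, zs). (z, zs @ [t])) (foldr (EML_ns K n) L c)"
    "\<And>b. b \<in> Poly_Mapping.keys (foldr (EML_ns K n) L c) \<Longrightarrow> length (snd b) = k - length L"
    by auto
  have "snd b \<noteq> []" if "b \<in> Poly_Mapping.keys (foldr (EML_ns K n) L c)" for b
    using IH(2)[OF that] Cons.prems by auto
  then have e: "EML_ns K (Suc n) (Suc s) (push (\<lambda>(z, zs). (z, zs @ [t])) (foldr (EML_ns K n) L c)) =
      push (\<lambda>(z, zs). (z, zs @ [t])) (EML_ns K n s (foldr (EML_ns K n) L c))"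
    by (rule EML_ns_push)
  have "length (snd b) = k - length L - 1" if "b \<in> Poly_Mapping.keys (EML_ns K n s (foldr (EML_ns K n) L c))" for b
    by (rule keys_EML_ns[OF _ that]) (rule IH(2))
  then show ?case by (simp add: IH(1) e)
qed (use assms(1) in simp)

lemma fold_AW_ns_sum: "fold (AW_ns K n) L (sum f I) = (\<Sum>i\<in>I. fold (AW_ns K n) L (f i))"
  by (induction L arbitrary: f) (simp_all add: AW_ns_def lin_ext_sum)

lemma foldr_EML_ns_sum: "foldr (EML_ns K n) L (sum f I) = (\<Sum>i\<in>I. foldr (EML_ns K n) L (f i))"
  by (induction L) (simp_all add: EML_ns_def lin_ext_sum)

lemma ESA_0:
  "ESA K (Suc n) 0 (Poly_Mapping.single (m, xs) 1) = push join_last (SHI (sset_power n K) K (split_last (m, xs)))"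
  by (simp add: ESA_def SHI_ns_def push_push)

text \<open>\<open>ESA_(n+1,l+1) = EML \<circ> (ESA_(n,l) \<otimes> 1) \<circ> AW\<close>, which is what the induction on \<open>l\<close> uses.\<close>

lemma ESA_Suc:
  "ESA K (Suc n) (Suc l) (Poly_Mapping.single (m, xs) 1) =
   (\<Sum>c\<le>m. lin_ext (\<lambda>z. push join_last (EML (sset_power n K) K (z, faces K [0..<c] (m, last xs))))
      (ESA K n l (Poly_Mapping.single (faces (sset_power n K) [c + 1..<m + 1] (m, butlast xs)) 1)) :: _ \<Rightarrow>\<^sub>0 'r::comm_ring_1)"
proof -
  let ?L = "[1..<l + 1]"
  let ?fr = "\<lambda>c. faces (sset_power n K) [c + 1..<m + 1] (m, butlast xs)"
  let ?bk = "\<lambda>c. faces K [0..<c] (m, last xs)"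
  define X :: "nat \<Rightarrow> (_ \<Rightarrow>\<^sub>0 'r)" where
    "X = (\<lambda>c. foldr (EML_ns K n) ?L (SHI_ns K n (l + 1) (fold (AW_ns K n) ?L (Poly_Mapping.single (?fr c, []) 1))))"
  \<comment> \<open>The pass with index 1 is the outermost AW and EML; the other indices are those
    of the shorter loop raised by one, as the spectator lemmas require.\<close>
  have L: "[1..<Suc l + 1] = 1 # map Suc ?L"
    by (simp add: map_Suc_upt upt_conv_Cons del: upt_Suc)
  have AW1: "AW_ns K (Suc n) 1 (Poly_Mapping.single ((m, xs), []) 1) =
      (\<Sum>c\<le>m. push (\<lambda>(z, zs). (z, zs @ [?bk c])) (Poly_Mapping.single (?fr c, []) (1::'r)))"
    by (simp add: AW_ns_def AW_def split_last_def push_sum)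
  have keys0: "\<And>b. b \<in> Poly_Mapping.keys (Poly_Mapping.single (?fr c, []) (1::'r)) \<Longrightarrow> length (snd b) = 0" for c
    by (simp split: if_splits)
  have keys1: "length (snd d) = 0 + length ?L"
    if "d \<in> Poly_Mapping.keys (fold (AW_ns K n) ?L (Poly_Mapping.single (?fr c, []) (1::'r)))" for d c
    by (rule keys_fold_AW_ns[OF _ that]) (rule keys0)
  let ?Y = "\<lambda>c. SHI_ns K n (l + 1) (fold (AW_ns K n) ?L (Poly_Mapping.single (?fr c, []) (1::'r)))"
  have keys2: "length (snd b) = l" if "b \<in> Poly_Mapping.keys (?Y c)" for b c
  proof -
    have "length (snd b) = 0 + length ?L"
      by (rule keys_SHI_ns[OF _ that]) (rule keys1)
    then show ?thesis by simp
  qed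
  have EMLs: "foldr (EML_ns K (Suc n)) (map Suc ?L) (push (\<lambda>(z, zs). (z, zs @ [t])) (?Y c)) =
      push (\<lambda>(z, zs). (z, zs @ [t])) (foldr (EML_ns K n) ?L (?Y c)) \<and>
      (\<forall>b\<in>Poly_Mapping.keys (foldr (EML_ns K n) ?L (?Y c)). length (snd b) = l - length ?L)" for c t
    by (rule foldr_EML_ns_push, erule keys2) simp
  \<comment> \<open>The \<open>l\<close> factors produced by AW are all absorbed by the
    \<open>l\<close> passes of EML, so that nothing but the spectator is left beside the first
    entry.\<close>
  have X_keys: "snd b = []" if "b \<in> Poly_Mapping.keys (X c)" for b c
    using EMLs[of "?bk c" c] that unfolding X_def by simp
  have X_fst: "push fst (X c) = ESA K n l (Poly_Mapping.single (?fr c) 1)" for c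
    by (simp add: ESA_def X_def del: upt_Suc)
  have X: "X c = push (\<lambda>z. (z, [])) (push fst (X c))" for c
  proof -
    have "push (\<lambda>z. (z, [])) (push fst (X c)) = push (\<lambda>b. b) (X c)"
      unfolding push_push by (rule push_cong, rule prod_eqI) (simp_all add: X_keys)
    then show ?thesis by simp
  qed
  have inner: "foldr (EML_ns K (Suc n)) (map Suc ?L) (SHI_ns K (Suc n) (Suc (l + 1)) (fold (AW_ns K (Suc n)) (map Suc ?L)
        (push (\<lambda>(z, zs). (z, zs @ [?bk c])) (Poly_Mapping.single (?fr c, []) (1::'r))))) =
      push (\<lambda>(z, zs). (z, zs @ [?bk c])) (X c)" for c
    unfolding fold_AW_ns_push SHI_ns_push X_def using EMLs[of "?bk c" c] by blast
  have "ESA K (Suc n) (Suc l) (Poly_Mapping.single (m, xs) (1::'r)) =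
      push fst (EML_ns K (Suc n) 1 (foldr (EML_ns K (Suc n)) (map Suc ?L)
        (SHI_ns K (Suc n) (Suc (l + 1)) (fold (AW_ns K (Suc n)) (map Suc ?L)
          (AW_ns K (Suc n) 1 (Poly_Mapping.single ((m, xs), []) 1))))))"
    unfolding ESA_def L push_single by (simp del: upt_Suc)
  also have "\<dots> = push fst (EML_ns K (Suc n) 1 (\<Sum>c\<le>m. foldr (EML_ns K (Suc n)) (map Suc ?L)
        (SHI_ns K (Suc n) (Suc (l + 1)) (fold (AW_ns K (Suc n)) (map Suc ?L)
          (push (\<lambda>(z, zs). (z, zs @ [?bk c])) (Poly_Mapping.single (?fr c, []) 1))))))"
    unfolding AW1 fold_AW_ns_sum by (simp only: foldr_EML_ns_sum[symmetric] SHI_ns_def lin_ext_sum)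
  also have "\<dots> = (\<Sum>c\<le>m. push fst (EML_ns K (Suc n) 1 (push (\<lambda>(z, zs). (z, zs @ [?bk c])) (X c))))"
    unfolding inner by (simp add: EML_ns_def lin_ext_sum push_sum)
  also have "\<dots> = (\<Sum>c\<le>m. lin_ext (\<lambda>z. push join_last (EML (sset_power n K) K (z, ?bk c)))
      (ESA K n l (Poly_Mapping.single (?fr c) 1)))"
  proof (rule sum.cong[OF refl])
    fix c
    show "push fst (EML_ns K (Suc n) 1 (push (\<lambda>(z, zs). (z, zs @ [?bk c])) (X c))) =
        lin_ext (\<lambda>z. push join_last (EML (sset_power n K) K (z, ?bk c))) (ESA K n l (Poly_Mapping.single (?fr c) 1))"
      unfolding X_fst[symmetric]
      by (subst X) (simp add: EML_ns_def lin_ext_push push_push push_lin_ext)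
  qed
  finally show ?thesis .
qed

context simplicial_set
begin

section \<open>Front and back faces, and the generators occurring in ESA\<close>

lemma act_mono_closed:
  assumes "z \<in> gsimplices K" "mono f" "f M \<le> fst z"
  shows "act K (map f [0..<Suc M]) z \<in> gsimplices K"
proof -
  have "{0..<Suc M} \<subseteq> {..M}" by auto
  from act_sorted_closed(1)[OF assms this] show ?thesis by (simp del: upt_Suc)
qed

lemma sset_power_memI:
  assumes "length ys = n" "\<And>u. u \<in> {1..n} \<Longrightarrow> (m, ys ! (u - 1)) \<in> gsimplices K"
  shows "ys \<in> simplices (sset_power n K) m"
proof -
  have "y \<in> simplices K m" if y: "y \<in> set ys" for y
  proof -
    obtain i where "i < n" "y = ys ! i" using y assms(1) by (auto simp: in_set_conv_nth)
    then show ?thesis using assms(2)[of "Suc i"] by (simp add: gsimplices_def)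
  qed
  then show ?thesis using assms(1) by (auto simp: sset_power_def)
qed

text \<open>The front part of an AW summand with cut \<open>c\<close> keeps the vertices 0 to
  \<open>c\<close>. Its path is the inclusion into the vertices of the original \<open>xs\<close>,
  to which the action stays referred.\<close>

lemma front_entry:
  assumes xs: "xs \<in> simplices (sset_power (Suc n) K) m" and c: "c \<le> m"
  defines "ys \<equiv> snd (faces (sset_power n K) [c + 1..<m + 1] (m, butlast xs))"
  shows "faces (sset_power n K) [c + 1..<m + 1] (m, butlast xs) = (c, ys)"
    and "u \<in> {1..n} \<Longrightarrow> (c, ys ! (u - 1)) = act K (map (\<lambda>t. t) [0..<Suc c]) (m, xs ! (u - 1))"
    and "ys \<in> simplices (sset_power n K) c"
proof -
  note len = sset_power_length[OF xs]
  show pair: "faces (sset_power n K) [c + 1..<m + 1] (m, butlast xs) = (c, ys)"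
    using c by (simp add: ys_def faces_power del: upt_Suc)
  have entry: "(c, ys ! (u - 1)) = act K (map (\<lambda>t. t) [0..<Suc c]) (m, xs ! (u - 1))" if u: "u \<in> {1..n}" for u
  proof -
    have x: "(m, xs ! (u - 1)) \<in> gsimplices K"
      using sset_power_nth[OF xs, of u] u by (simp add: gsimplices_def)
    have "(c, ys ! (u - 1)) = (c, snd (faces K [c + 1..<m + 1] (m, xs ! (u - 1))))"
    proof -
      have "u - 1 < n" using u by auto
      then show ?thesis using len by (simp add: ys_def faces_power nth_butlast del: upt_Suc)
    qed
    also have "\<dots> = faces K [c + 1..<m + 1] (m, xs ! (u - 1))"
      using c by (intro prod_eqI) (auto simp: fst_faces simp del: upt_Suc)
    also have "\<dots> = act K (map (\<lambda>t. if t < c + 1 then t else t + (m + 1 - (c + 1)))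
        [0..<Suc (fst (m, xs ! (u - 1))) - (m + 1 - (c + 1))]) (m, xs ! (u - 1))"
      by (rule faces_interval_eq_act[OF x]) (use c in auto)
    also have "map (\<lambda>t. if t < c + 1 then t else t + (m + 1 - (c + 1)))
        [0..<Suc (fst (m, xs ! (u - 1))) - (m + 1 - (c + 1))] = map (\<lambda>t. t) [0..<Suc c]"
      by (rule nth_equalityI) (use c in \<open>auto simp del: upt_Suc\<close>)
    finally show ?thesis .
  qed
  then show "u \<in> {1..n} \<Longrightarrow> (c, ys ! (u - 1)) = act K (map (\<lambda>t. t) [0..<Suc c]) (m, xs ! (u - 1))" .
  show "ys \<in> simplices (sset_power n K) c"
  proof (rule sset_power_memI)
    show "length ys = n" using len by (simp add: ys_def faces_power del: upt_Suc)
    fix u assume u: "u \<in> {1..n}"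
    show "(c, ys ! (u - 1)) \<in> gsimplices K"
      unfolding entry[OF u]
      by (rule act_mono_closed) (use c u sset_power_nth[OF xs, of u] in \<open>auto simp: gsimplices_def mono_def\<close>)
  qed
qed

lemma back_entry:
  assumes xs: "xs \<in> simplices (sset_power (Suc n) K) m" and c: "c \<le> m"
  shows "faces K [0..<c] (m, last xs) = act K (sorted_list_of_set {c..m}) (m, xs ! n)"
    and "faces K [0..<c] (m, last xs) \<in> gsimplices K" "fst (faces K [0..<c] (m, last xs)) = m - c"
proof -
  have last: "last xs = xs ! n" using sset_power_length[OF xs] by (metis diff_Suc_1 last_conv_nth list.size(3) nat.distinct(1))
  have x: "(m, xs ! n) \<in> gsimplices K"
    using sset_power_nth[OF xs, of "Suc n"] by (simp add: gsimplices_def)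
  have "faces K [0..<c] (m, xs ! n) = act K (map (\<lambda>t. if t < 0 then t else t + (c - 0))
      [0..<Suc (fst (m, xs ! n)) - (c - 0)]) (m, xs ! n)"
    by (rule faces_interval_eq_act[OF x]) (use c in auto)
  also have "map (\<lambda>t. if t < 0 then t else t + (c - 0)) [0..<Suc (fst (m, xs ! n)) - (c - 0)] = [c..<Suc m]"
    by (rule nth_equalityI) (use c in \<open>auto simp del: upt_Suc\<close>)
  also have "[c..<Suc m] = sorted_list_of_set {c..m}"
    by (simp add: atLeastLessThanSuc_atLeastAtMost[symmetric] del: upt_Suc)
  finally show eq: "faces K [0..<c] (m, last xs) = act K (sorted_list_of_set {c..m}) (m, xs ! n)"
    by (simp only: last)
  show "faces K [0..<c] (m, last xs) \<in> gsimplices K"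
    unfolding eq by (rule act_closed) (use x c in auto)
  show "fst (faces K [0..<c] (m, last xs)) = m - c" by (simp add: fst_faces)
qed

text \<open>\<open>expression_EML\<close> and the prescribed values of \<open>h\<close> concern
  genuine simplices only; this certifies that ESA produces no other generators.\<close>

lemma keys_ESA:
  assumes "l < n" "xs \<in> simplices (sset_power n K) m"
  shows "Poly_Mapping.keys (ESA K n l (Poly_Mapping.single (m, xs) (1::'r::comm_ring_1))) \<subseteq>
    {Suc m} \<times> simplices (sset_power n K) (Suc m)"
  using assms
proof (induction l arbitrary: n m xs)
  case 0
  then obtain n' where n: "n = Suc n'" by (cases n) auto
  note xs = 0(2)[unfolded n]
  let ?mb = "\<lambda>pq::nat \<times> nat. m - fst pq - snd pq"
  let ?ys = "\<lambda>pq AB. snd (degens (sset_power n' K) (insert (?mb pq - 1) ((+) (?mb pq) ` snd AB))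
          (faces (sset_power n' K) [m - snd pq + 1..<m + 1] (m, butlast xs))) @
       [snd (degens K ((+) (?mb pq) ` fst AB) (faces K [?mb pq..<m - snd pq] (m, last xs)))]"
  have ys: "?ys pq AB \<in> simplices (sset_power (Suc n') K) (Suc m)"
    if pq: "pq \<in> {(p, q). p + q < m}" and AB: "AB \<in> pq_shuffles (fst pq + 1) (snd pq)" for pq AB
  proof (rule sset_power_memI)
    have pq': "fst pq + snd pq < m" and AB': "(fst AB, snd AB) \<in> pq_shuffles (fst pq + 1) (snd pq)"
      using pq AB by auto
    show "length (?ys pq AB) = Suc n'"
      using pq_shufflesD(2)[OF AB'] sset_power_length[OF xs] by (simp add: faces_power degens_power del: upt_Suc)
    fix u assume u: "u \<in> {1..Suc n'}"
    have "(m + 1, ?ys pq AB ! (u - 1)) \<in> gsimplices K"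
      unfolding SHI_entry(1)[OF pq' AB' xs u]
      by (rule act_mono_closed) (use SHI_entry(2)[OF pq' AB' xs u] in blast)+
    then show "(Suc m, ?ys pq AB ! (u - 1)) \<in> gsimplices K" by (simp only: Suc_eq_plus1)
  qed
  have "Poly_Mapping.keys (SHI (sset_power n' K) K (m, (butlast xs, last xs)) :: _ \<Rightarrow>\<^sub>0 'r) \<subseteq>
      {b. join_last b \<in> {Suc m} \<times> simplices (sset_power (Suc n') K) (Suc m)}"
    unfolding SHI_def case_prod_conv
    by (rule keys_sum_subset, unfold case_prod_unfold, rule keys_sum_subset, unfold Let_def,
        rule keys_single_subset, unfold mem_Collect_eq join_last_def case_prod_conv, rule SigmaI, simp, rule ys)
      (simp_all only: mem_Collect_eq case_prod_unfold)
  then show ?case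
    unfolding n ESA_0 split_last_def case_prod_conv by (intro keys_push_subset) blast
next
  case (Suc l)
  then obtain n' where n: "n = Suc n'" by (cases n) auto
  note xs = Suc.prems(2)[unfolded n]
  show ?case
    unfolding n ESA_Suc
  proof (rule keys_sum_subset, rule keys_lin_ext_subset)
    fix c z
    assume c: "c \<in> {..m}" and z: "z \<in> Poly_Mapping.keys (ESA K n' l
      (Poly_Mapping.single (faces (sset_power n' K) [c + 1..<m + 1] (m, butlast xs)) (1::'r)))"
    have c: "c \<le> m" using c by simp
    obtain ys where ys: "faces (sset_power n' K) [c + 1..<m + 1] (m, butlast xs) = (c, ys)"
      "ys \<in> simplices (sset_power n' K) c"
      by (rule that[OF front_entry(1,3)[OF xs c]])
    have "l < n'" using Suc.prems(1) n by simp
    have "z \<in> {Suc c} \<times> simplices (sset_power n' K) (Suc c)"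
      by (rule subsetD[OF Suc.IH[OF \<open>l < n'\<close> ys(2)] z[unfolded ys(1)]])
    then obtain w where w: "z = (Suc c, w)" "w \<in> simplices (sset_power n' K) (Suc c)"
      by (cases z) simp
    let ?t = "faces K [0..<c] (m, last xs)"
    have t0: "?t = (m - c, snd ?t)"
      by (rule prod_eqI) (simp_all add: back_entry(3)[OF xs c])
    have y0: "snd ?t \<in> simplices K (m - c)"
      using back_entry(2,3)[OF xs c] by (simp only: mem_gsimplices_iff)
    obtain y where t: "?t = (m - c, y)" "y \<in> simplices K (m - c)"
      by (rule that[OF t0 y0])
    show "Poly_Mapping.keys (push join_last (EML (sset_power n' K) K (z, ?t)) :: _ \<Rightarrow>\<^sub>0 'r) \<subseteq>
        {Suc m} \<times> simplices (sset_power (Suc n') K) (Suc m)"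
      unfolding t w EML_def case_prod_conv push_sum
    proof (rule keys_sum_subset)
      fix AB assume AB: "AB \<in> pq_shuffles (Suc c) (m - c)"
      then have AB': "(fst AB, snd AB) \<in> pq_shuffles (Suc c) (m - c)" by simp
      let ?ys = "snd (degens (sset_power n' K) (snd AB) (Suc c, w)) @ [snd (degens K (fst AB) (m - c, y))]"
      have "?ys \<in> simplices (sset_power (Suc n') K) (Suc c + (m - c))"
      proof (rule sset_power_memI)
        show "length ?ys = Suc n'"
          using pq_shufflesD(2)[OF AB'] sset_power_length[OF w(2)] by (simp add: degens_power)
        fix u assume u: "u \<in> {1..Suc n'}"
        show "(Suc c + (m - c), ?ys ! (u - 1)) \<in> gsimplices K"
          unfolding EML_entry(1)[OF AB' w(2) t(2) u]
          by (rule act_mono_closed) (use EML_entry(2)[OF AB' w(2) t(2) u] in blast)+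
      qed
      moreover have "Suc c + (m - c) = Suc m" using c by simp
      ultimately show "Poly_Mapping.keys (push join_last (case AB of (A, B) \<Rightarrow>
          Poly_Mapping.single (Suc c + (m - c), (snd (degens (sset_power n' K) B (Suc c, w)), snd (degens K A (m - c, y))))
            ((- 1) ^ sig A)) :: _ \<Rightarrow>\<^sub>0 'r) \<subseteq> {Suc m} \<times> simplices (sset_power (Suc n') K) (Suc m)"
        by (simp add: case_prod_beta join_last_def)
    qed
  qed
qed

end

section \<open>Summation over the cut points of AW\<close>

lemma label_partition_snoc:
  assumes J1: "label_partition n N J1" and J2: "\<And>u. u \<in> {1..n} \<Longrightarrow> J2 u = J1 u" "J2 (Suc n) = {Suc N}"
  shows "label_partition (Suc n) (Suc N) J2"
  unfolding label_partition_def
proof (intro conjI ballI)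
  fix u assume u: "u \<in> {1..Suc n}"
  then consider "u \<in> {1..n}" | "u = Suc n" by fastforce
  then show "J2 u \<subseteq> {1..Suc N}"
  proof cases
    case 1
    then have "J1 u \<subseteq> {1..N}" using J1 by (simp add: label_partition_def)
    then show ?thesis using J2(1)[OF 1] by auto
  qed (simp add: J2(2))
  from u consider "u \<in> {1..n}" | "u = Suc n" by fastforce
  then show "J2 u \<noteq> {}"
  proof cases
    case 1
    then show ?thesis using J2(1)[OF 1] J1 by (simp add: label_partition_def)
  qed (simp add: J2(2))
next
  fix k assume k: "k \<in> {1..Suc N}"
  have notin: "Suc N \<notin> J2 u" if "u \<in> {1..n}" for u
  proof -
    have "J1 u \<subseteq> {1..N}" using J1 that by (simp add: label_partition_def)
    then show ?thesis using J2(1)[OF that] by auto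
  qed
  show "\<exists>!u. u \<in> {1..Suc n} \<and> k \<in> J2 u"
  proof (cases "k = Suc N")
    case True
    show ?thesis
    proof (rule ex1I[of _ "Suc n"])
      show "Suc n \<in> {1..Suc n} \<and> k \<in> J2 (Suc n)" using True J2(2) by simp
      fix u assume u: "u \<in> {1..Suc n} \<and> k \<in> J2 u"
      show "u = Suc n"
      proof (rule ccontr)
        assume "u \<noteq> Suc n"
        then have "u \<in> {1..n}" using u by auto
        then show False using notin[of u] u True by simp
      qed
    qed
  next
    case False
    then have "k \<in> {1..N}" using k by auto
    then obtain u where u: "u \<in> {1..n}" "k \<in> J1 u" by (rule label_partition_owner[OF J1])
    show ?thesis
    proof (rule ex1I[of _ u])
      show "u \<in> {1..Suc n} \<and> k \<in> J2 u" using u J2(1)[OF u(1)] by simp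
      fix v assume v: "v \<in> {1..Suc n} \<and> k \<in> J2 v"
      then have "v \<noteq> Suc n" using J2(2) False by auto
      then have "v \<in> {1..n}" using v by auto
      then show "v = u" using label_partition_unique[OF J1, of v u k] u v J2(1)[of v] by simp
    qed
  qed
qed

lemma expression_cong:
  assumes "\<And>u. u \<in> {1..n} \<Longrightarrow> J u = J' u"
  shows "expression K n N id J S m xs = expression K n N id J' S m xs"
proof -
  have "tensor_term K n J m xs is = tensor_term K n J' m xs is" for "is"
    unfolding tensor_term_def by (rule map_cong[OF refl]) (use assms in auto)
  then show ?thesis
    unfolding expression_id by (intro sum.cong refl) (use assms in auto)
qed

context simplicial_set
begin

text \<open>A cut \<open>c\<close> and a partition of \<open>c\<close> into \<open>N\<close>
  intervals are the same as a partition of \<open>m\<close> into \<open>N + 1\<close> intervals, the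
  last one running from \<open>c\<close> to \<open>m\<close> and preceding the last variable. The
  exponents \<open>S1 q\<close>, one for each dimension of the back face, merge into
  \<open>S2\<close>, which reads \<open>q\<close> as a length.\<close>

lemma AW_glue:
  fixes S2 :: sign_expr
  assumes J1: "label_partition n N J1" and J2: "\<And>u. u \<in> {1..n} \<Longrightarrow> J2 u = J1 u" "J2 (Suc n) = {Suc N}"
    and xs: "xs \<in> simplices (sset_power (Suc n) K) m"
    and S1: "\<And>q a b. (\<forall>k\<le>N. a k = b k) \<Longrightarrow> S1 q a = S1 q b" and S2: "\<And>a q. a (Suc N) = int q \<Longrightarrow> S2 a = S1 q a"
  shows "(\<Sum>c\<le>m. push (\<lambda>zs. zs @ [faces K [0..<c] (m, last xs)])
      (expression K n N id J1 (S1 (m - c)) c (snd (faces (sset_power n K) [c + 1..<m + 1] (m, butlast xs))))) =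
    (expression K (Suc n) (Suc N) id J2 S2 m xs :: _ \<Rightarrow>\<^sub>0 'r::comm_ring_1)"
proof -
  note J2_part = label_partition_snoc[OF J1 J2]
  let ?ys = "\<lambda>c. snd (faces (sset_power n K) [c + 1..<m + 1] (m, butlast xs))"
  let ?t = "\<lambda>c. faces K [0..<c] (m, last xs)"
  define F :: "nat \<times> nat list \<Rightarrow> (_ \<Rightarrow>\<^sub>0 'r)" where "F = (\<lambda>ci. if \<forall>u\<in>{1..n}. separated (snd ci) (J1 u)
     then Poly_Mapping.single (tensor_term K n J1 (fst ci) (?ys (fst ci)) (snd ci) @ [?t (fst ci)])
       (minus_one_pow (S1 (m - fst ci) (interval_length (snd ci)))) else 0)"
  let ?H = "\<lambda>is. if \<forall>u\<in>{1..Suc n}. separated is (J2 u)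
     then Poly_Mapping.single (tensor_term K (Suc n) J2 m xs is) (minus_one_pow (S2 (interval_length is)) :: 'r) else 0"
  have "(\<Sum>c\<le>m. push (\<lambda>zs. zs @ [?t c]) (expression K n N id J1 (S1 (m - c)) c (?ys c))) =
      (\<Sum>c\<le>m. \<Sum>is\<in>interval_partitions c N. F (c, is))"
    unfolding expression_id push_sum
    by (intro sum.cong refl) (simp add: F_def)
  also have "\<dots> = sum F (SIGMA c:{..m}. interval_partitions c N)"
    by (subst sum.Sigma) (simp_all add: finite_interval_partitions case_prod_unfold)
  also have "\<dots> = sum ?H (interval_partitions m (Suc N))"
  \<comment> \<open>The cut is the last entry but one of the larger partition, so appending
    \<open>m\<close> and removing the last entry are inverse to each other.\<close>
  proof (rule sum.reindex_bij_witness[where i = "\<lambda>is. (is ! N, butlast is)" and j = "\<lambda>(c, is). is @ [m]"])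
    fix ci assume "ci \<in> (SIGMA c:{..m}. interval_partitions c N)"
    then obtain c "is" where ci: "ci = (c, is)" "c \<le> m" and part: "is \<in> interval_partitions c N" by auto
    note len = interval_partitions_length[OF part]
    have last: "is ! N = c" by (rule interval_partitions_last[OF part])
    show "(((case ci of (c, is) \<Rightarrow> is @ [m]) ! N), butlast (case ci of (c, is) \<Rightarrow> is @ [m])) = ci"
      using ci len last by (simp add: nth_append)
    have nth: "(is @ [m]) ! k = is ! k" if "k \<le> N" for k using that len by (simp add: nth_append)
    have part2: "is @ [m] \<in> interval_partitions m (Suc N)"
    proof (rule interval_partitionsI)
      fix i assume i: "i < Suc N"
      show "(is @ [m]) ! i \<le> (is @ [m]) ! Suc i"
      proof (cases "i = N")
        case True
        then show ?thesis using len last ci by (simp add: nth_append)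
      next
        case False
        then show ?thesis using i nth[of i] nth[of "Suc i"] interval_partitions_mono[OF part, of i "Suc i"] by simp
      qed
    qed (use len interval_partitions_0[OF part] in \<open>simp_all add: nth_append\<close>)
    then show "(case ci of (c, is) \<Rightarrow> is @ [m]) \<in> interval_partitions m (Suc N)" using ci by simp
    have J1u: "J1 u \<subseteq> {1..N}" if "u \<in> {1..n}" for u using J1 that by (simp add: label_partition_def)
    have sep_eq: "separated (is @ [m]) (J1 u) \<longleftrightarrow> separated is (J1 u)" if u: "u \<in> {1..n}" for u
      unfolding separated_def
    proof (intro ball_cong refl)
      fix j k assume "j \<in> J1 u" "k \<in> J1 u"
      then have "j \<le> N" "k \<le> N" using J1u[OF u] by auto
      then have "j \<le> N" "k - 1 \<le> N" by simp_all
      then show "(j < k \<longrightarrow> (is @ [m]) ! j < (is @ [m]) ! (k - 1)) = (j < k \<longrightarrow> is ! j < is ! (k - 1))"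
        by (simp only: nth)
    qed
    have sep: "(\<forall>u\<in>{1..Suc n}. separated (is @ [m]) (J2 u)) \<longleftrightarrow> (\<forall>u\<in>{1..n}. separated is (J1 u))"
    proof -
      have "separated (is @ [m]) (J2 (Suc n))" by (simp add: J2(2) separated_def)
      moreover have "{1..Suc n} = insert (Suc n) {1..n}" by auto
      ultimately show ?thesis using sep_eq J2(1) by auto
    qed
    show "?H (case ci of (c, is) \<Rightarrow> is @ [m]) = F ci"
    proof (cases "\<forall>u\<in>{1..n}. separated is (J1 u)")
      case True
      then have sep2: "\<forall>u\<in>{1..Suc n}. separated (is @ [m]) (J2 u)" using sep by blast
      have V: "vertices (is @ [m]) (J2 u) = vertices is (J1 u)" if u: "u \<in> {1..n}" for u
        unfolding vertices_def J2(1)[OF u]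
      proof (intro SUP_cong refl)
        fix k assume "k \<in> J1 u"
        then have "k \<le> N" using J1u[OF u] by auto
        then have "k \<le> N" "k - 1 \<le> N" by simp_all
        then show "{(is @ [m]) ! (k - 1)..(is @ [m]) ! k} = {is ! (k - 1)..is ! k}" by (simp only: nth)
      qed
      have Vn: "vertices (is @ [m]) (J2 (Suc n)) = {c..m}"
        using len last by (simp add: J2(2) vertices_def nth_append)
      have "tensor_term K (Suc n) J2 m xs (is @ [m]) =
          map (\<lambda>u. act K (sorted_list_of_set (vertices (is @ [m]) (J2 u))) (m, xs ! (u - 1))) [1..<Suc n + 1]"
        by (rule tensor_term_self[OF J2_part part2 sep2 xs])
      also have "\<dots> = map (\<lambda>u. act K (sorted_list_of_set (vertices is (J1 u))) (m, xs ! (u - 1))) [1..<n + 1] @ [?t c]"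
      proof -
        have "[1..<Suc n + 1] = [1..<n + 1] @ [Suc n]" by simp
        moreover have "map (\<lambda>u. act K (sorted_list_of_set (vertices (is @ [m]) (J2 u))) (m, xs ! (u - 1))) [1..<n + 1] =
            map (\<lambda>u. act K (sorted_list_of_set (vertices is (J1 u))) (m, xs ! (u - 1))) [1..<n + 1]"
          by (rule map_cong[OF refl], subst V) auto
        moreover have "act K (sorted_list_of_set (vertices (is @ [m]) (J2 (Suc n)))) (m, xs ! (Suc n - 1)) = ?t c"
          using back_entry(1)[OF xs ci(2)] by (simp add: Vn)
        ultimately show ?thesis by (simp only: map_append list.map)
      qed
      also have "map (\<lambda>u. act K (sorted_list_of_set (vertices is (J1 u))) (m, xs ! (u - 1))) [1..<n + 1] =
          map (\<lambda>u. act K (map (\<lambda>t. t) (sorted_list_of_set (vertices is (J1 u)))) (m, xs ! (u - 1))) [1..<n + 1]"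
        by simp
      also have "\<dots> = tensor_term K n J1 c (?ys c) is"
      proof (rule tensor_term_act[OF J1 part True, symmetric])
        fix u assume u: "u \<in> {1..n}"
        show "(c, ?ys c ! (u - 1)) = act K (map (\<lambda>t. t) [0..<Suc c]) (m, xs ! (u - 1))"
          by (rule front_entry(2)[OF xs ci(2) u])
        show "(m, xs ! (u - 1)) \<in> gsimplices K \<and> mono (\<lambda>t::nat. t) \<and> c \<le> fst (m, xs ! (u - 1))"
          using sset_power_nth[OF xs, of u] u ci(2) by (auto simp: gsimplices_def mono_def)
      qed
      finally have terms: "tensor_term K (Suc n) J2 m xs (is @ [m]) = tensor_term K n J1 c (?ys c) is @ [?t c]" .
      \<comment> \<open>Here the parameter \<open>m - c\<close> is identified with the length of the
        appended interval.\<close>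
      have "interval_length (is @ [m]) (Suc N) = int (m - c)"
        using len last ci(2) by (simp add: interval_length_def nth_append)
      then have "S2 (interval_length (is @ [m])) = S1 (m - c) (interval_length (is @ [m]))"
        by (rule S2)
      also have "\<dots> = S1 (m - c) (interval_length is)"
      proof (rule S1, intro allI impI)
        fix k assume "k \<le> N"
        then have "k \<le> N" "k - 1 \<le> N" by auto
        then show "interval_length (is @ [m]) k = interval_length is k"
          by (simp only: interval_length_def nth)
      qed
      finally have sign: "S2 (interval_length (is @ [m])) = S1 (m - c) (interval_length is)" .
      have "?H (is @ [m]) = Poly_Mapping.single (tensor_term K (Suc n) J2 m xs (is @ [m]))
          (minus_one_pow (S2 (interval_length (is @ [m]))))"
        by (rule if_P) (rule sep2)
      moreover have "F (c, is) = Poly_Mapping.single (tensor_term K n J1 c (?ys c) is @ [?t c])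
          (minus_one_pow (S1 (m - c) (interval_length is)))"
        unfolding F_def fst_conv snd_conv by (rule if_P) (rule True)
      ultimately show ?thesis by (simp only: ci(1) case_prod_conv terms sign)
    next
      case False
      then have "\<not> (\<forall>u\<in>{1..Suc n}. separated (is @ [m]) (J2 u))" using sep by blast
      then have "?H (is @ [m]) = 0" by (rule if_not_P)
      moreover have "F (c, is) = 0" unfolding F_def fst_conv snd_conv by (rule if_not_P) (rule False)
      ultimately show ?thesis by (simp only: ci(1) case_prod_conv)
    qed
  next
    fix "is" assume part: "is \<in> interval_partitions m (Suc N)"
    note len = interval_partitions_length[OF part]
    have snoc: "butlast is @ [m] = is"
      using len interval_partitions_last[OF part] by (metis append_butlast_last_id diff_Suc_1 last_conv_nth length_0_conv nat.distinct(1))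
    then show "(case (is ! N, butlast is) of (c, is) \<Rightarrow> is @ [m]) = is" by simp
    have nth: "butlast is ! k = is ! k" if "k \<le> N" for k using that len by (simp add: nth_butlast)
    have "butlast is \<in> interval_partitions (is ! N) N"
    proof (rule interval_partitionsI)
      fix i assume "i < N"
      then show "butlast is ! i \<le> butlast is ! Suc i"
        using nth[of i] nth[of "Suc i"] interval_partitions_mono[OF part, of i "Suc i"] by simp
    qed (use len nth interval_partitions_0[OF part] in simp_all)
    then show "(is ! N, butlast is) \<in> (SIGMA c:{..m}. interval_partitions c N)"
      using interval_partitions_le[OF part, of N] by simp
  qed
  also have "\<dots> = expression K (Suc n) (Suc N) id J2 S2 m xs"
    unfolding expression_id ..
  finally show ?thesis .
qed

end

section \<open>Labels and signs under removal of the last variable\<close>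

lemma head_labels_drop:
  "head_labels n l (\<lambda>u. drop_label j ` J u) = drop_label j ` head_labels n l J"
  by (simp add: head_labels_def image_UN)

text \<open>\<open>drop_label j\<close> preserves the order away from \<open>j\<close>, and ranks
  within a set depend on the order only.\<close>

lemma card_drop_label:
  assumes "finite H" "j \<notin> H" "w \<in> H"
  shows "card {w' \<in> drop_label j ` H. w' \<le> drop_label j w} = card {w' \<in> H. w' \<le> w}"
proof -
  have iff: "drop_label j w' \<le> drop_label j w \<longleftrightarrow> w' \<le> w" if "w' \<in> H" for w'
    using drop_label_strict_mono[OF assms(2)] that assms(3)
    by (metis linorder_not_less strict_mono_onD order_le_less)
  have "{w' \<in> drop_label j ` H. w' \<le> drop_label j w} = drop_label j ` {w' \<in> H. w' \<le> w}"
    using iff by blast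
  moreover have "inj_on (drop_label j) {w' \<in> H. w' \<le> w}"
    using strict_mono_on_imp_inj_on[OF drop_label_strict_mono[OF assms(2)]] by (rule inj_on_subset) blast
  ultimately show ?thesis by (simp add: card_image)
qed

text \<open>Head labels enter through their ranks, which the removal of \<open>j\<close> does not
  change because \<open>j\<close> is no head label. A tail label equals \<open>r + 1 + u\<close> and
  does not depend on \<open>n\<close>.\<close>

lemma relabelled_Suc:
  assumes J: "label_partition (Suc n) N J" and j: "J (Suc n) = {j}" and u: "u \<in> {1..n}" and l: "l < n"
  shows "relabelled (Suc n) r (Suc l) J u = relabelled n r l (\<lambda>u. drop_label j ` J u) u"
proof (cases "u \<le> n - l")
  case True
  let ?H = "head_labels n l J"
  have H: "head_labels (Suc n) (Suc l) J = ?H" by (simp add: head_labels_def)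
  have "?H \<subseteq> {1..N}" using J by (auto simp: head_labels_def label_partition_def)
  then have fin: "finite ?H" by (rule finite_subset) simp
  have "j \<notin> ?H"
  proof
    assume "j \<in> ?H"
    then obtain v where v: "v \<in> {1..n - l}" "j \<in> J v" by (auto simp: head_labels_def)
    then have "v = Suc n" using label_partition_unique[OF J, of v "Suc n" j] j by auto
    then show False using v by auto
  qed
  moreover have "J u \<subseteq> ?H" using True u by (auto simp: head_labels_def)
  ultimately have "(\<lambda>w. card {w' \<in> ?H. w' \<le> w}) ` J u =
      (\<lambda>w. card {w' \<in> drop_label j ` ?H. w' \<le> drop_label j w}) ` J u"
    using card_drop_label[OF fin] by (intro image_cong refl) auto
  then show ?thesis
    using True unfolding relabelled_def H head_labels_drop by (simp add: image_image)
next
  case False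
  then show ?thesis using u by (simp add: relabelled_def)
qed

lemma output_labels_Suc:
  assumes J: "label_partition (Suc n) N J" and j: "J (Suc n) = {j}" and l: "l < n"
  shows "u \<in> {1..n} \<Longrightarrow> output_labels (Suc n) r (Suc l) J u = output_labels n r l (\<lambda>u. drop_label j ` J u) u"
    and "output_labels (Suc n) r (Suc l) J (Suc n) = {Suc (n + r + 1)}"
proof -
  show "output_labels (Suc n) r (Suc l) J u = output_labels n r l (\<lambda>u. drop_label j ` J u) u" if u: "u \<in> {1..n}"
  proof -
    have "Suc n - Suc l = n - l" "Suc n + r - Suc l + 1 = n + r - l + 1" by auto
    then show ?thesis unfolding output_labels_def relabelled_Suc[OF J j u l] by simp
  qed
  show "output_labels (Suc n) r (Suc l) J (Suc n) = {Suc (n + r + 1)}"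
  proof -
    have "\<not> Suc n \<le> n - l" "Suc n \<noteq> n - l" by auto
    then show ?thesis by (simp add: output_labels_def relabelled_def)
  qed
qed

text \<open>On the left the lowering caused by the first pass is counted by
  \<open>current_label\<close>; on the right \<open>drop_label\<close> has already performed it. So
  consecutive pass numbers meet the same label.\<close>

lemma current_label_Suc:
  assumes J: "label_partition (Suc n) (Suc N) J" and j: "J (Suc n) = {j}"
    and sing: "\<And>u. u \<in> {1..l} \<Longrightarrow> \<exists>i. J (n + 1 - u) = {i}" and l: "l < n" and u: "u \<in> {1..l}"
  shows "current_label (Suc n) J (Suc u) = current_label n (\<lambda>u. drop_label j ` J u) u"
    and "current_label n (\<lambda>u. drop_label j ` J u) u \<le> N"
proof -
  let ?s = "sole_label (Suc n) J" and ?s' = "sole_label n (\<lambda>u. drop_label j ` J u)"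
  have s1: "?s 1 = j" by (simp add: sole_label_def j)
  have s: "J (n + 1 - w) = {?s (Suc w)}" if w: "w \<in> {1..l}" for w
  proof -
    obtain i where i: "J (n + 1 - w) = {i}" using sing[OF w] by blast
    have "?s (Suc w) = the_elem (J (n + 1 - w))" by (simp add: sole_label_def)
    then show ?thesis by (simp only: i the_elem_eq)
  qed
  have s': "?s' w = drop_label j (?s (Suc w))" if "w \<in> {1..l}" for w
    by (simp only: sole_label_def[of n] s[OF that] image_insert image_empty the_elem_eq)
  have nj: "?s (Suc w) \<noteq> j" if w: "w \<in> {1..l}" for w
  proof
    assume "?s (Suc w) = j"
    moreover have "?s (Suc w) \<in> J (n + 1 - w)" by (subst s[OF w]) simp
    ultimately have "j \<in> J (n + 1 - w)" by (simp only:)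
    moreover have "n + 1 - w \<in> {1..Suc n}" using w l by auto
    ultimately have "n + 1 - w = Suc n" using label_partition_unique[OF J, of "n + 1 - w" "Suc n" j] j by auto
    then show False using w l by auto
  qed
  have less_iff: "?s' w < ?s' u \<longleftrightarrow> ?s (Suc w) < ?s (Suc u)" if w: "w \<in> {1..<u}" for w
  proof -
    have wl: "w \<in> {1..l}" using w u by auto
    show ?thesis unfolding s'[OF wl] s'[OF u] using nj[OF wl] nj[OF u] by (auto simp: drop_label_def)
  qed
  \<comment> \<open>Pass 1 counts exactly if \<open>j\<close> lies below the label in question; the
    later passes are those of the smaller expression with their numbers raised by one.\<close>
  have "{w \<in> {1..<Suc u}. ?s w < ?s (Suc u)} =
      (if j < ?s (Suc u) then {1} else {}) \<union> Suc ` {w \<in> {1..<u}. ?s (Suc w) < ?s (Suc u)}"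
  proof (rule set_eqI)
    fix w
    show "w \<in> {w \<in> {1..<Suc u}. ?s w < ?s (Suc u)} \<longleftrightarrow>
      w \<in> (if j < ?s (Suc u) then {1} else {}) \<union> Suc ` {w \<in> {1..<u}. ?s (Suc w) < ?s (Suc u)}"
    proof (cases "w = 1")
      case True
      then show ?thesis using u s1 by auto
    next
      case False
      then show ?thesis by (cases w) auto
    qed
  qed
  moreover have "card ((if j < ?s (Suc u) then {1} else {}) \<union> Suc ` {w \<in> {1..<u}. ?s (Suc w) < ?s (Suc u)}) =
      (if j < ?s (Suc u) then 1 else 0) + card {w \<in> {1..<u}. ?s (Suc w) < ?s (Suc u)}"
    by (subst card_Un_disjoint) (auto simp: card_image)
  moreover have "{w \<in> {1..<u}. ?s' w < ?s' u} = {w \<in> {1..<u}. ?s (Suc w) < ?s (Suc u)}"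
    using less_iff by blast
  ultimately show "current_label (Suc n) J (Suc u) = current_label n (\<lambda>u. drop_label j ` J u) u"
    unfolding current_label_def s'[OF u] by (simp add: drop_label_def)
  have "?s (Suc u) \<in> J (n + 1 - u)" by (subst s[OF u]) simp
  moreover have "J (n + 1 - u) \<subseteq> {1..Suc N}" using J u l by (auto simp: label_partition_def)
  moreover have "j \<le> Suc N" using J j by (force simp: label_partition_def)
  ultimately have "drop_label j (?s (Suc u)) \<le> N" using nj[OF u] by (fastforce simp: drop_label_def)
  then show "current_label n (\<lambda>u. drop_label j ` J u) u \<le> N"
    unfolding current_label_def s'[OF u] by simp
qed

text \<open>The first pass substitutes \<open>a (Suc N) + 1\<close> for the length of interval
  \<open>j\<close>, whereas \<open>sign_drop\<close> uses \<open>q\<close>; hence the value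
  \<open>q - 1\<close> at the label \<open>Suc N\<close>.\<close>

lemma sign_drop_eq_step1:
  assumes "j \<in> {1..Suc N}" "jc 1 = j"
  shows "sign_drop j N q S a = sign_step1 (Suc N) jc 1 S (a(Suc N := int q - 1))"
proof -
  have "(\<lambda>k. if k = j then int q else if j < k \<and> k \<le> Suc N then a (k - 1) else a k) =
      (\<lambda>k. if k = j then (a(Suc N := int q - 1)) (Suc N - 1 + 1) + 1
        else if j < k \<and> k \<le> Suc N - 1 + 1 then (a(Suc N := int q - 1)) (k - 1) else (a(Suc N := int q - 1)) k)"
    using assms(1) by (auto simp: fun_eq_iff)
  moreover have "(\<Sum>k = j..N. a k) = (\<Sum>k = j..N. (a(Suc N := int q - 1)) k)"
    by (rule sum.cong) auto
  ultimately show ?thesis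
    unfolding sign_drop_def sign_step1_def assms(2) by simp
qed

text \<open>A later pass neither reads nor substitutes at the label \<open>Suc N\<close>, so the
  value fixed there commutes with it; \<open>jc u \<le> N\<close> is what keeps the substituted
  label away from it.\<close>

lemma sign_step1_upd:
  assumes T: "\<And>a. T' a = T (a(Suc N := x))" and u: "1 \<le> u" "u \<le> N" "jc u \<le> N"
  shows "sign_step1 N jc u T' a = sign_step1 N jc u T (a(Suc N := x))"
proof -
  have "(\<lambda>k. if k = jc u then a (N - u + 1) + 1 else if jc u < k \<and> k \<le> N - u + 1 then a (k - 1) else a k)(Suc N := x) =
    (\<lambda>k. if k = jc u then (a(Suc N := x)) (N - u + 1) + 1
       else if jc u < k \<and> k \<le> N - u + 1 then (a(Suc N := x)) (k - 1) else (a(Suc N := x)) k)"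
    using u by (auto simp: fun_eq_iff)
  moreover have "(\<Sum>k = jc u..N - u. (a(Suc N := x)) k) = (\<Sum>k = jc u..N - u. a k)"
    by (rule sum.cong) auto
  moreover have "(a(Suc N := x)) (N - u + 1) = a (N - u + 1)" using u by auto
  ultimately show ?thesis unfolding sign_step1_def T by simp
qed

lemma fold_sign_step1_upd:
  assumes "\<And>a. T' a = T (a(Suc N := x))" and "\<And>u. u \<in> set L \<Longrightarrow> 1 \<le> u \<and> u \<le> N \<and> jc u \<le> N"
  shows "fold (sign_step1 N jc) L T' a = fold (sign_step1 N jc) L T (a(Suc N := x))"
  using assms
proof (induction L arbitrary: T T')
  case (Cons u L)
  have "fold (sign_step1 N jc) L (sign_step1 N jc u T') a = fold (sign_step1 N jc) L (sign_step1 N jc u T) (a(Suc N := x))"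
  proof (rule Cons.IH)
    fix a
    show "sign_step1 N jc u T' a = sign_step1 N jc u T (a(Suc N := x))"
      by (rule sign_step1_upd, rule Cons.prems(1)) (use Cons.prems(2) in auto)
  qed (use Cons.prems(2) in auto)
  then show ?case by (simp only: fold.simps o_apply)
qed simp

lemma fold_map_cong: "(\<And>u. u \<in> set L \<Longrightarrow> f (g u) = f' u) \<Longrightarrow> fold f (map g L) T = fold f' L T"
  by (induction L arbitrary: T) auto

text \<open>The pass \<open>u = 1\<close> of the first loop is the sign of the last shuffle product, in which the length of
  the split-off factor is a parameter \<open>q\<close>; the remaining passes and the second step do not touch it.\<close>

lemma output_sign_Suc:
  assumes J: "label_partition (Suc n) (Suc (n + r)) J" and j: "J (Suc n) = {j}"
    and sing: "\<And>u. u \<in> {1..l} \<Longrightarrow> \<exists>i. J (n + 1 - u) = {i}" and l: "l < n"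
    and a: "a (Suc (Suc (n + r))) = int q"
  shows "output_sign (Suc n) r (Suc l) J S a =
    output_sign n r l (\<lambda>u. drop_label j ` J u) (sign_drop j (n + r) q S) a"
proof -
  let ?N = "n + r" and ?J' = "\<lambda>u. drop_label j ` J u"
  let ?cl = "current_label (Suc n) J" and ?cl' = "current_label n ?J'"
  let ?L = "[1..<l + 1]"
  have j1: "j \<in> {1..Suc ?N}" using J j by (force simp: label_partition_def)
  have L: "[1..<Suc l + 1] = 1 # map Suc ?L"
    by (simp add: map_Suc_upt upt_conv_Cons del: upt_Suc)
  have cl1: "?cl 1 = j" by (simp add: current_label_def sole_label_def j)
  define T where "T = fold (sign_step1 ?N ?cl') ?L (sign_step1 (Suc ?N) ?cl 1 S)"
  have fold1: "fold (sign_step1 (Suc ?N) ?cl) [1..<Suc l + 1] S = T"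
    unfolding L fold.simps o_apply T_def
  proof (rule fold_map_cong)
    fix u assume "u \<in> set ?L"
    then have "u \<in> {1..l}" by auto
    from current_label_Suc(1)[OF J j sing l this]
    show "sign_step1 (Suc ?N) ?cl (Suc u) = sign_step1 ?N ?cl' u"
      unfolding sign_step1_def by (simp only: diff_Suc_Suc)
  qed
  have fold2: "fold (sign_step1 ?N ?cl') ?L (sign_drop j ?N q S) b = T (b(Suc ?N := int q - 1))" for b
    unfolding T_def
  proof (rule fold_sign_step1_upd)
    show "sign_drop j ?N q S a = sign_step1 (Suc ?N) ?cl 1 S (a(Suc ?N := int q - 1))" for a
      by (rule sign_drop_eq_step1[where jc = ?cl, OF j1 cl1])
    fix u assume "u \<in> set ?L"
    then have u: "u \<in> {1..l}" by auto
    then show "1 \<le> u \<and> u \<le> ?N \<and> ?cl' u \<le> ?N"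
      using current_label_Suc(2)[OF J j sing l u] l by auto
  qed
  have nl: "n - l \<in> {1..n}" using l by auto
  have v: "Max (relabelled (Suc n) r (Suc l) J (Suc n - Suc l)) = Max (relabelled n r l ?J' (n - l))"
    using relabelled_Suc[OF J j nl l] by simp
  let ?v = "Max (relabelled n r l ?J' (n - l))"
  \<comment> \<open>For the larger expression the second step puts
    \<open>a (Suc (Suc ?N)) - 1\<close> at the label \<open>Suc ?N\<close>. As that length is
    \<open>q\<close>, this is the value \<open>q - 1\<close> with which \<open>fold2\<close> was
    stated.\<close>
  have "(\<lambda>k. if Suc ?N - Suc l + 1 \<le> k \<and> k \<le> Suc ?N then a (k + 1) - 1
          else if k = ?v then a ?v + a (Suc ?N - Suc l + 1) + 1 else a k) =
      (\<lambda>k. if ?N - l + 1 \<le> k \<and> k \<le> ?N then a (k + 1) - 1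
          else if k = ?v then a ?v + a (?N - l + 1) + 1 else a k)(Suc ?N := int q - 1)"
    using a by (auto simp: fun_eq_iff)
  moreover have "Suc n + r = Suc ?N" by simp
  ultimately show ?thesis
    unfolding output_sign_def v sign_step2_def by (simp only: fold1 fold2 diff_Suc_Suc)
qed

lemma local_sign_drop:
  assumes S: "local_sign (Suc N) S" and j: "j \<in> {1..Suc N}"
  shows "local_sign N (sign_drop j N q S)"
  unfolding local_sign_def
proof (intro allI impI)
  fix a b :: "nat \<Rightarrow> int" assume ab: "\<forall>k\<in>{1..N}. a k = b k"
  have "S (\<lambda>k. if k = j then int q else if j < k \<and> k \<le> Suc N then a (k - 1) else a k) =
      S (\<lambda>k. if k = j then int q else if j < k \<and> k \<le> Suc N then b (k - 1) else b k)"
  proof (rule local_signD[OF S])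
    fix k assume k: "k \<in> {1..Suc N}"
    consider "k = j" | "k - 1 \<in> {1..N}" "j < k" "k \<le> Suc N" | "k < j" "k \<in> {1..N}" using k j by fastforce
    then show "(if k = j then int q else if j < k \<and> k \<le> Suc N then a (k - 1) else a k) =
        (if k = j then int q else if j < k \<and> k \<le> Suc N then b (k - 1) else b k)"
      using ab by cases auto
  qed
  moreover have "(\<Sum>k = j..N. a k) = (\<Sum>k = j..N. b k)"
    by (rule sum.cong) (use ab j in auto)
  ultimately show "sign_drop j N q S a = sign_drop j N q S b"
    by (simp only: sign_drop_def)
qed

lemma sign_step1_local:
  assumes S: "\<And>a b. (\<forall>k\<le>N. a k = b k) \<Longrightarrow> S a = S b" and u: "1 \<le> u" "u \<le> N"
    and ab: "\<forall>k\<le>N. a k = b k"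
  shows "sign_step1 N jc u S a = sign_step1 N jc u S b"
proof -
  have "S (\<lambda>k. if k = jc u then a (N - u + 1) + 1 else if jc u < k \<and> k \<le> N - u + 1 then a (k - 1) else a k) =
      S (\<lambda>k. if k = jc u then b (N - u + 1) + 1 else if jc u < k \<and> k \<le> N - u + 1 then b (k - 1) else b k)"
    by (rule S) (use ab u in auto)
  moreover have "(\<Sum>k = jc u..N - u. a k) = (\<Sum>k = jc u..N - u. b k)"
    by (rule sum.cong) (use ab in auto)
  moreover have "a (N - u + 1) = b (N - u + 1)" using ab u by auto
  ultimately show ?thesis by (simp only: sign_step1_def)
qed

lemma fold_sign_step1_local:
  assumes "\<And>a b. (\<forall>k\<le>N. a k = b k) \<Longrightarrow> S a = S b" and "\<And>u. u \<in> set L \<Longrightarrow> 1 \<le> u \<and> u \<le> N"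
    and "\<forall>k\<le>N. a k = b k"
  shows "fold (sign_step1 N jc) L S a = fold (sign_step1 N jc) L S b"
  using assms(1,2)
proof (induction L arbitrary: S)
  case Nil
  then show ?case using assms(3) by simp
next
  case (Cons u L)
  have u: "1 \<le> u" "u \<le> N" using Cons.prems(2) by auto
  have "fold (sign_step1 N jc) L (sign_step1 N jc u S) a = fold (sign_step1 N jc) L (sign_step1 N jc u S) b"
  proof (rule Cons.IH)
    fix a b :: "nat \<Rightarrow> int" assume ab: "\<forall>k\<le>N. a k = b k"
    show "sign_step1 N jc u S a = sign_step1 N jc u S b"
      by (rule sign_step1_local[OF _ u ab]) (rule Cons.prems(1))
  qed (use Cons.prems(2) in auto)
  then show ?case by simp
qed

text \<open>\<open>AW_glue\<close> evaluates the exponent on a partition with and without the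
  appended interval; the lengths agree on the labels up to \<open>Suc (n + r)\<close>, and these are
  all that is read.\<close>

lemma output_sign_local:
  assumes S: "local_sign (n + r) S" and l: "l < n" and v: "Max (relabelled n r l J (n - l)) \<le> Suc (n + r)"
    and ab: "\<forall>k\<le>Suc (n + r). a k = b k"
  shows "output_sign n r l J S a = output_sign n r l J S b"
proof -
  let ?N = "n + r" and ?v = "Max (relabelled n r l J (n - l))"
  let ?T = "fold (sign_step1 ?N (current_label n J)) [1..<l + 1] S"
  have "?T (\<lambda>k. if ?N - l + 1 \<le> k \<and> k \<le> ?N then a (k + 1) - 1
          else if k = ?v then a ?v + a (?N - l + 1) + 1 else a k) =
      ?T (\<lambda>k. if ?N - l + 1 \<le> k \<and> k \<le> ?N then b (k + 1) - 1
          else if k = ?v then b ?v + b (?N - l + 1) + 1 else b k)"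
  proof (rule fold_sign_step1_local)
    fix a b :: "nat \<Rightarrow> int" assume "\<forall>k\<le>?N. a k = b k"
    then show "S a = S b" by (intro local_signD[OF S]) auto
  next
    show "\<forall>k\<le>?N. (if ?N - l + 1 \<le> k \<and> k \<le> ?N then a (k + 1) - 1
          else if k = ?v then a ?v + a (?N - l + 1) + 1 else a k) =
        (if ?N - l + 1 \<le> k \<and> k \<le> ?N then b (k + 1) - 1
          else if k = ?v then b ?v + b (?N - l + 1) + 1 else b k)"
      using ab by auto
  qed (use l in auto)
  moreover have "(\<Sum>k = 1..?v. a k) = (\<Sum>k = 1..?v. b k)"
    by (rule sum.cong) (use ab v in auto)
  moreover have "(\<Sum>k = ?v + 1..?N - l. a k) = (\<Sum>k = ?v + 1..?N - l. b k)"
    by (rule sum.cong) (use ab in auto)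
  moreover have "a (?N - l + 1) = b (?N - l + 1)" using ab by auto
  ultimately show ?thesis by (simp only: output_sign_def sign_step2_def)
qed

lemma degenerate_tensors_snoc:
  "zs \<in> degenerate_tensors n K \<Longrightarrow> t \<in> gsimplices K \<Longrightarrow> zs @ [t] \<in> degenerate_tensors (Suc n) K"
  by (auto simp: degenerate_tensors_def normalized_tensor_power_def)

lemma label_partition_cong:
  assumes "\<And>u. u \<in> {1..n} \<Longrightarrow> J u = J' u" and "label_partition n N J"
  shows "label_partition n N J'"
proof -
  have "(u \<in> {1..n} \<and> j \<in> J u) = (u \<in> {1..n} \<and> j \<in> J' u)" for u j
    using assms(1) by auto
  moreover have "(\<forall>u\<in>{1..n}. J u \<subseteq> {1..N} \<and> J u \<noteq> {}) = (\<forall>u\<in>{1..n}. J' u \<subseteq> {1..N} \<and> J' u \<noteq> {})"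
    by (rule ball_cong[OF refl]) (simp only: assms(1))
  ultimately show ?thesis using assms(2) unfolding label_partition_def by (simp only:)
qed

text \<open>If no variable is split off, all labels are head labels, and the rank of a label
  \<open>w\<close> among 1 to \<open>N\<close> is \<open>w\<close>.\<close>

lemma relabelled_0:
  assumes J: "label_partition n N J" and N: "N = n + r" and u: "u \<in> {1..n}"
  shows "relabelled n r 0 J u = J u"
proof -
  have Ju: "J u \<subseteq> {1..N}" if "u \<in> {1..n}" for u using J that by (simp add: label_partition_def)
  have H: "head_labels n 0 J = {1..N}"
  proof
    show "head_labels n 0 J \<subseteq> {1..N}"
    proof
      fix k assume "k \<in> head_labels n 0 J"
      then obtain u where "u \<in> {1..n}" "k \<in> J u" by (auto simp: head_labels_def)
      then show "k \<in> {1..N}" using Ju by blast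
    qed
    show "{1..N} \<subseteq> head_labels n 0 J"
    proof
      fix k assume "k \<in> {1..N}"
      then obtain u where "u \<in> {1..n}" "k \<in> J u" by (rule label_partition_owner[OF J])
      then show "k \<in> head_labels n 0 J" by (auto simp: head_labels_def)
    qed
  qed
  have "card {w' \<in> {1..N}. w' \<le> w} = w" if "w \<in> J u" for w
  proof -
    have "w \<in> {1..N}" using Ju[OF u] that by blast
    then have "{w' \<in> {1..N}. w' \<le> w} = {1..w}" by auto
    then show ?thesis by simp
  qed
  then have "(\<lambda>w. card {w' \<in> {1..N}. w' \<le> w}) ` J u = J u" by force
  then show ?thesis using u by (simp add: relabelled_def H)
qed

context simplicial_set
begin

text \<open>Splitting off the last variable changes \<open>n\<close>, the labels and the exponent,
  the latter in a different way for each \<open>q\<close>, so all of these are arbitrary in the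
  induction. The statement on labels is carried along because glueing the AW summands presupposes it
  for the smaller expression.\<close>

lemma expression_ESA:
  fixes S :: sign_expr
  assumes "label_partition n (n + r) J" "local_sign (n + r) S" "l < n"
    and "\<And>u. u \<in> {1..l} \<Longrightarrow> \<exists>i. J (n + 1 - u) = {i}"
  shows "label_partition n (Suc (n + r)) (output_labels n r l J)"
    and "xs \<in> simplices (sset_power n K) m \<Longrightarrow> cong_mod (degenerate_tensors n K)
      (lin_ext (\<lambda>(m, ys). expression K n (n + r) id J S m ys) (ESA K n l (Poly_Mapping.single (m, xs) (1::'r::comm_ring_1))))
      (expression K n (Suc (n + r)) id (output_labels n r l J) (output_sign n r l J S) m xs)"
proof -
  have *: "label_partition n (Suc (n + r)) (output_labels n r l J) \<and>
    (\<forall>m. \<forall>xs\<in>simplices (sset_power n K) m. cong_mod (degenerate_tensors n K)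
      (lin_ext (\<lambda>(m, ys). expression K n (n + r) id J S m ys) (ESA K n l (Poly_Mapping.single (m, xs) (1::'r))))
      (expression K n (Suc (n + r)) id (output_labels n r l J) (output_sign n r l J S) m xs))"
    using assms
  proof (induction l arbitrary: n J S)
    case 0
    then obtain n' where n: "n = Suc n'" by (cases n) auto
    let ?Jo = "\<lambda>u. if u = n then insert (Suc (n + r)) (J u) else J u"
    note J = 0(1)
    have out: "output_labels n r 0 J u = ?Jo u" if u: "u \<in> {1..n}" for u
      using relabelled_0[OF J refl u] by (cases "u = n") (simp_all add: output_labels_def)
    have Jo: "label_partition n (Suc (n + r)) ?Jo"
      using label_partition_extend[OF J[unfolded n]] unfolding n by simp
    have sign: "output_sign n r 0 J S = sign_step2 (n + r) 0 (Max (J n)) S"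
      using relabelled_0[OF J refl, of n] n by (simp add: output_sign_def)
    have "label_partition n (Suc (n + r)) (output_labels n r 0 J)"
      by (rule label_partition_cong[OF out[symmetric] Jo])
    moreover have "cong_mod (degenerate_tensors n K)
      (lin_ext (\<lambda>(m, ys). expression K n (n + r) id J S m ys) (ESA K n 0 (Poly_Mapping.single (m, xs) (1::'r))))
      (expression K n (Suc (n + r)) id (output_labels n r 0 J) (output_sign n r 0 J S) m xs)"
      if xs: "xs \<in> simplices (sset_power n K) m" for m xs
    proof -
      have "expression K n (Suc (n + r)) id (output_labels n r 0 J) (output_sign n r 0 J S) m xs =
          (expression K n (Suc (n + r)) id ?Jo (sign_step2 (n + r) 0 (Max (J n)) S) m xs :: _ \<Rightarrow>\<^sub>0 'r)"
        unfolding sign by (rule expression_cong[OF out])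
      then show ?thesis
        using expression_SHI[OF J[unfolded n] 0(2)[unfolded n] xs[unfolded n]]
        unfolding n ESA_0 by (simp only:)
    qed
    ultimately show ?case by blast
  next
    case (Suc l)
    then obtain n' where n: "n = Suc n'" by (cases n) auto
    have l: "l < n'" using Suc.prems(3) n by simp
    have J: "label_partition (Suc n') (Suc (n' + r)) J" using Suc.prems(1) by (simp add: n)
    have S: "local_sign (Suc (n' + r)) S" using Suc.prems(2) by (simp add: n)
    obtain j where j: "J (Suc n') = {j}" using Suc.prems(4)[of 1] by (auto simp: n)
    have sing: "\<exists>i. J (n' + 1 - u) = {i}" if "u \<in> {1..l}" for u
      using Suc.prems(4)[of "Suc u"] that by (simp add: n)
    have j1: "j \<in> {1..Suc (n' + r)}" using J j by (force simp: label_partition_def)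
    let ?J' = "\<lambda>u. drop_label j ` J u" and ?S' = "\<lambda>q. sign_drop j (n' + r) q S"
    have J': "label_partition n' (n' + r) ?J'" by (rule label_partition_drop[OF J j])
    have S': "local_sign (n' + r) (?S' q)" for q by (rule local_sign_drop[OF S j1])
    have sing': "\<exists>i. ?J' (n' + 1 - u) = {i}" if "u \<in> {1..l}" for u
      using sing[OF that] by (metis image_empty image_insert)
    note IH = Suc.IH[OF J' S' l sing']
    let ?O = "output_labels n' r l ?J'" and ?OS = "\<lambda>q. output_sign n' r l ?J' (?S' q)"
    have O: "label_partition n' (Suc (n' + r)) ?O" using IH by blast
    have IH2: "\<forall>m. \<forall>xs\<in>simplices (sset_power n' K) m. cong_mod (degenerate_tensors n' K)
        (lin_ext (\<lambda>(m, ys). expression K n' (n' + r) id ?J' (?S' q) m ys) (ESA K n' l (Poly_Mapping.single (m, xs) (1::'r))))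
        (expression K n' (Suc (n' + r)) id ?O (?OS q) m xs)" for q
    proof (rule conjunct2[OF Suc.IH[OF J' S' l]])
      show "\<exists>i. ?J' (n' + 1 - u) = {i}" if "u \<in> {1..l}" for u by (rule sing'[OF that])
    qed
    note out = output_labels_Suc[OF J j l, where r = r]
    have out_last: "output_labels (Suc n') r (Suc l) J (Suc n') = {Suc (Suc (n' + r))}"
      using out(2) by simp
    have part: "label_partition (Suc n') (Suc (Suc (n' + r))) (output_labels (Suc n') r (Suc l) J)"
      by (rule label_partition_snoc[OF O out(1) out_last])
    have v: "Max (relabelled n' r l ?J' (n' - l)) \<le> Suc (n' + r)"
    proof -
      have u: "n' - l \<in> {1..n'}" using l by auto
      let ?R = "relabelled n' r l ?J' (n' - l)"
      have "?R \<subseteq> ?O (n' - l)" by (auto simp: output_labels_def)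
      also have "\<dots> \<subseteq> {1..Suc (n' + r)}" using O u by (simp add: label_partition_def)
      finally have R: "?R \<subseteq> {1..Suc (n' + r)}" .
      have "?J' (n' - l) \<noteq> {}" using J' u by (simp add: label_partition_def)
      then have "?R \<noteq> {}" by (simp add: relabelled_def)
      then have "Max ?R \<in> ?R" using finite_subset[OF R] by (intro Max_in) auto
      then show ?thesis using R by auto
    qed
    have main: "cong_mod (degenerate_tensors (Suc n') K)
      (lin_ext (\<lambda>(m, ys). expression K (Suc n') (Suc (n' + r)) id J S m ys)
        (ESA K (Suc n') (Suc l) (Poly_Mapping.single (m, xs) (1::'r))))
      (expression K (Suc n') (Suc (Suc (n' + r))) id (output_labels (Suc n') r (Suc l) J)
        (output_sign (Suc n') r (Suc l) J S) m xs)"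
      if xs: "xs \<in> simplices (sset_power (Suc n') K) m" for m xs
    proof -
      let ?E = "\<lambda>(m, ys). expression K (Suc n') (Suc (n' + r)) id J S m ys :: _ \<Rightarrow>\<^sub>0 'r"
      let ?ys = "\<lambda>c. snd (faces (sset_power n' K) [c + 1..<m + 1] (m, butlast xs))"
      let ?t = "\<lambda>c. faces K [0..<c] (m, last xs)"
      let ?ESA = "\<lambda>c. ESA K n' l (Poly_Mapping.single (c, ?ys c) (1::'r))"
      let ?E' = "\<lambda>c (p, w). expression K n' (n' + r) id ?J' (?S' (m - c)) p w :: _ \<Rightarrow>\<^sub>0 'r"
      \<comment> \<open>At a fixed cut, \<open>expression_EML\<close> removes the last variable from
        every generator; the exponent that remains contains \<open>m - c\<close> as a constant, and
        the induction hypothesis is applied to this exponent.\<close>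
      have step: "cong_mod (degenerate_tensors (Suc n') K)
          (lin_ext ?E (lin_ext (\<lambda>z. push join_last (EML (sset_power n' K) K (z, ?t c)))
            (ESA K n' l (Poly_Mapping.single (faces (sset_power n' K) [c + 1..<m + 1] (m, butlast xs)) (1::'r)))))
          (push (\<lambda>zs. zs @ [?t c]) (expression K n' (Suc (n' + r)) id ?O (?OS (m - c)) c (?ys c)))"
        if "c \<in> {..m}" for c
      proof -
        have c: "c \<le> m" using that by simp
        note fr = front_entry[OF xs c]
        have t0: "?t c = (m - c, snd (?t c))"
          by (rule prod_eqI) (simp_all add: back_entry(3)[OF xs c])
        have y0: "snd (?t c) \<in> simplices K (m - c)"
          using back_entry(2,3)[OF xs c] by (simp only: mem_gsimplices_iff)
        obtain y where t: "?t c = (m - c, y)" "y \<in> simplices K (m - c)"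
          by (rule that[OF t0 y0])
        have "lin_ext ?E (lin_ext (\<lambda>z. push join_last (EML (sset_power n' K) K (z, ?t c))) (?ESA c)) =
            lin_ext (\<lambda>z. lin_ext ?E (push join_last (EML (sset_power n' K) K (z, ?t c)))) (?ESA c)"
          by (rule lin_ext_lin_ext)
        also have "cong_mod (degenerate_tensors (Suc n') K) \<dots>
            (lin_ext (\<lambda>z. push (\<lambda>zs. zs @ [?t c]) (?E' c z)) (?ESA c))"
        proof (rule cong_mod_lin_ext)
          fix z assume z: "z \<in> Poly_Mapping.keys (?ESA c)"
          have "z \<in> {Suc c} \<times> simplices (sset_power n' K) (Suc c)"
            by (rule subsetD[OF keys_ESA[OF l fr(3)] z])
          then obtain w where w: "z = (Suc c, w)" "w \<in> simplices (sset_power n' K) (Suc c)"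
            by (cases z) simp
          show "cong_mod (degenerate_tensors (Suc n') K)
              (lin_ext ?E (push join_last (EML (sset_power n' K) K (z, ?t c))))
              (push (\<lambda>zs. zs @ [?t c]) (?E' c z))"
            unfolding w(1) t(1) case_prod_conv by (rule expression_EML[OF J j S w(2) t(2)])
        qed
        also have "lin_ext (\<lambda>z. push (\<lambda>zs. zs @ [?t c]) (?E' c z)) (?ESA c) =
            push (\<lambda>zs. zs @ [?t c]) (lin_ext (?E' c) (?ESA c))"
          by (rule push_lin_ext[symmetric])
        also have "cong_mod (degenerate_tensors (Suc n') K) \<dots>
            (push (\<lambda>zs. zs @ [?t c]) (expression K n' (Suc (n' + r)) id ?O (?OS (m - c)) c (?ys c)))"
        proof (rule cong_mod_push)
          show "cong_mod (degenerate_tensors n' K) (lin_ext (?E' c) (?ESA c))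
              (expression K n' (Suc (n' + r)) id ?O (?OS (m - c)) c (?ys c))"
            by (rule bspec[OF spec[OF IH2] fr(3)])
          show "zs @ [?t c] \<in> degenerate_tensors (Suc n') K" if "zs \<in> degenerate_tensors n' K" for zs
            by (rule degenerate_tensors_snoc[OF that back_entry(2)[OF xs c]])
        qed
        finally show ?thesis by (simp only: fr(1)[symmetric])
      qed
      have "lin_ext ?E (ESA K (Suc n') (Suc l) (Poly_Mapping.single (m, xs) (1::'r))) =
          (\<Sum>c\<le>m. lin_ext ?E (lin_ext (\<lambda>z. push join_last (EML (sset_power n' K) K (z, ?t c)))
            (ESA K n' l (Poly_Mapping.single (faces (sset_power n' K) [c + 1..<m + 1] (m, butlast xs)) 1))))"
        unfolding ESA_Suc lin_ext_sum ..
      also have "cong_mod (degenerate_tensors (Suc n') K) \<dots>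
          (\<Sum>c\<le>m. push (\<lambda>zs. zs @ [?t c]) (expression K n' (Suc (n' + r)) id ?O (?OS (m - c)) c (?ys c)))"
        by (rule cong_mod_sum) (rule step)
      also have "(\<Sum>c\<le>m. push (\<lambda>zs. zs @ [?t c]) (expression K n' (Suc (n' + r)) id ?O (?OS (m - c)) c (?ys c))) =
          (expression K (Suc n') (Suc (Suc (n' + r))) id (output_labels (Suc n') r (Suc l) J)
            (output_sign (Suc n') r (Suc l) J S) m xs :: _ \<Rightarrow>\<^sub>0 'r)"
      proof (rule AW_glue[OF O out(1) out_last xs])
        show "?OS q a = ?OS q b" if "\<forall>k\<le>Suc (n' + r). a k = b k" for q a b
          by (rule output_sign_local[OF S' l v that])
        show "output_sign (Suc n') r (Suc l) J S a = ?OS q a" if "a (Suc (Suc (n' + r))) = int q" for a q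
          by (rule output_sign_Suc[where n = n' and J = J and r = r and a = a and q = q, OF J j sing l that])
      qed
      finally show ?thesis .
    qed
    show ?case unfolding n add_Suc by (intro conjI allI ballI part main)
  qed
  show "label_partition n (Suc (n + r)) (output_labels n r l J)" by (rule conjunct1[OF *])
  show "xs \<in> simplices (sset_power n K) m \<Longrightarrow> cong_mod (degenerate_tensors n K)
      (lin_ext (\<lambda>(m, ys). expression K n (n + r) id J S m ys) (ESA K n l (Poly_Mapping.single (m, xs) (1::'r))))
      (expression K n (Suc (n + r)) id (output_labels n r l J) (output_sign n r l J S) m xs)"
    by (rule bspec[OF spec[OF conjunct2[OF *]]])
qed

end

section \<open>Permutation of the tensor factors, and the theorem\<close>

definition permute_factors :: "nat \<Rightarrow> (nat \<Rightarrow> nat) \<Rightarrow> 'b list \<Rightarrow> 'b list" where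
  "permute_factors n lam zs = map (\<lambda>i. zs ! (lam i - 1)) [1..<n + 1]"

text \<open>The sets \<open>J u\<close> are attached to variables and not to tensor positions, so
  \<open>lam\<close> merely reorders a finished tuple and leaves the exponent alone.\<close>

lemma expression_permute:
  assumes "lam permutes {1..n}"
  shows "expression K n N lam J S m xs = push (permute_factors n lam) (expression K n N id J S m xs)"
proof -
  have eq: "map (\<lambda>i. face_intervals K is (J (lam i)) (m, xs ! (lam i - 1))) [1..<n + 1] =
      permute_factors n lam (tensor_term K n J m xs is)" for "is"
    unfolding permute_factors_def
  proof (rule map_cong[OF refl])
    fix i assume "i \<in> set [1..<n + 1]"
    then have "i \<in> {1..n}" by auto
    then have "lam i \<in> {1..n}" using permutes_in_image[OF assms] by blast
    then have "lam i - 1 < n" "Suc (lam i - 1) = lam i" by auto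
    then show "face_intervals K is (J (lam i)) (m, xs ! (lam i - 1)) = tensor_term K n J m xs is ! (lam i - 1)"
      by (simp add: tensor_term_def del: upt_Suc)
  qed
  have "push (permute_factors n lam) (expression K n N id J S m xs) = (\<Sum>is\<in>interval_partitions m N.
     if \<forall>u\<in>{1..n}. separated is (J u)
     then Poly_Mapping.single (permute_factors n lam (tensor_term K n J m xs is)) (minus_one_pow (S (interval_length is))) else 0)"
    unfolding expression_id push_sum by (intro sum.cong refl) simp
  then show ?thesis
    unfolding expression_def[of K n N lam] eq by (rule sym)
qed

text \<open>A permutation preserves the length and the set of entries of a tuple, and its degeneracy
  depends on nothing else.\<close>

lemma permute_factors_degenerate:
  assumes lam: "lam permutes {1..n}" and zs: "zs \<in> degenerate_tensors n K"
  shows "permute_factors n lam zs \<in> degenerate_tensors n K"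
proof -
  have len: "length zs = n" and sub: "set zs \<subseteq> gsimplices K" and deg: "set zs \<inter> degenerate_simplices K \<noteq> {}"
    using zs by (auto simp: degenerate_tensors_def normalized_tensor_power_def)
  have set: "set (permute_factors n lam zs) = set zs"
  proof -
    have "set (permute_factors n lam zs) = (\<lambda>u. zs ! (u - 1)) ` lam ` {1..n}"
      by (auto simp: permute_factors_def simp del: upt_Suc)
    also have "lam ` {1..n} = {1..n}" by (rule permutes_image[OF lam])
    also have "(\<lambda>u. zs ! (u - 1)) ` {1..n} = (!) zs ` {..<n}"
      by (force simp: image_iff Bex_def intro: exI[of _ "Suc _"])
    also have "\<dots> = set zs" using len by (auto simp: set_conv_nth)
    finally show ?thesis .
  qed
  show ?thesis
    using sub deg by (simp add: degenerate_tensors_def normalized_tensor_power_def set) (simp add: permute_factors_def)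
qed

theorem theorem3:
  fixes K :: "'a sset"
    and n r l :: nat
    and h :: "('a list gsimplex \<Rightarrow>\<^sub>0 'r::comm_ring_1) set \<Rightarrow> ('a gsimplex list \<Rightarrow>\<^sub>0 'r) set"
    and lam :: "nat \<Rightarrow> nat"
    and J :: "nat \<Rightarrow> nat set"
    and sgn_e :: sign_expr
  assumes "simplicial_set K"
    and "2 \<le> n"
    and "l \<le> n - 2"
    and "graded_morphism r (normalized_chains (sset_power n K)) (normalized_tensor_power n K) h"
    and "wf_expression n (n + r) lam J sgn_e"
    and "\<And>m xs. xs \<in> simplices (sset_power n K) m \<Longrightarrow>
           h (ncls (normalized_chains (sset_power n K)) (Poly_Mapping.single (m, xs) 1)) =
           ncls (normalized_tensor_power n K) (expression K n (n + r) lam J sgn_e m xs)"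
    and a: "\<forall>u\<in>{1..n}. J u \<noteq> {}"
    and b: "\<forall>u\<in>{1..l}. card (J (n + 1 - u)) \<le> 1"
    and c: "Max (J (n - l)) \<noteq> Max (head_labels n l J)"
    and d: "\<forall>u\<in>{1..l}. \<not> (\<exists>w\<in>{1..n}. sole_label n J u - 1 \<in> J w \<and> sole_label n J u + 1 \<in> J w)"
    and "xs \<in> simplices (sset_power n K) m"
  shows "h (ncls (normalized_chains (sset_power n K)) (ESA K n l (Poly_Mapping.single (m, xs) 1))) =
         ncls (normalized_tensor_power n K)
           (expression K n (n + r + 1) lam (output_labels n r l J) (output_sign n r l J sgn_e) m xs)"
proof -
  interpret simplicial_set K by fact
  have l: "l < n" using assms(2,3) by simp
  have lam: "lam permutes {1..n}" and S: "local_sign (n + r) sgn_e"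
    and Jsub: "\<And>u. u \<in> {1..n} \<Longrightarrow> J u \<subseteq> {1..n + r}" and owner: "\<forall>j\<in>{1..n + r}. \<exists>!u. u \<in> {1..n} \<and> j \<in> J u"
    using assms(5) by (simp_all add: wf_expression_def local_sign_def)
  have J: "label_partition n (n + r) J"
    using Jsub owner a by (simp add: label_partition_def)
  have sing: "\<exists>i. J (n + 1 - u) = {i}" if u: "u \<in> {1..l}" for u
  proof -
    have un: "n + 1 - u \<in> {1..n}" using u l by auto
    have "finite (J (n + 1 - u))" by (rule finite_subset[OF Jsub[OF un]]) simp
    moreover have "J (n + 1 - u) \<noteq> {}" using a un by blast
    moreover have "card (J (n + 1 - u)) \<le> 1" using b u by blast
    ultimately have "card (J (n + 1 - u)) = 1" by (metis One_nat_def Suc_leI card_gt_0_iff le_antisym)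
    then show ?thesis by (meson card_1_singletonE)
  qed
  let ?C = "normalized_chains (sset_power n K)" and ?C' = "normalized_tensor_power n K"
  let ?ESA = "ESA K n l (Poly_Mapping.single (m, xs) (1::'r))"
  let ?p = "permute_factors n lam"
  have "?ESA \<in> free_chains (gens ?C)"
    using keys_ESA[OF l assms(11), where ?'r = 'r]
    by (auto simp: free_chains_def normalized_chains_def gsimplices_def)
  then have "h (ncls ?C ?ESA) = ncls ?C' (lin_ext (\<lambda>(m, ys). expression K n (n + r) lam J sgn_e m ys) ?ESA)"
  proof (rule graded_morphism_lin_ext[OF assms(4), rotated])
    fix z assume "z \<in> gens ?C"
    then show "h (ncls ?C (Poly_Mapping.single z 1)) =
        ncls ?C' (case z of (m, ys) \<Rightarrow> expression K n (n + r) lam J sgn_e m ys)"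
      using assms(6) by (cases z) (simp add: normalized_chains_def gsimplices_def)
  qed
  \<comment> \<open>The reordering is moved outside the linear extension, which leaves an expression
    in the order of the variables.\<close>
  also have "\<dots> = ncls ?C' (push ?p (lin_ext (\<lambda>(m, ys). expression K n (n + r) id J sgn_e m ys) ?ESA))"
    unfolding push_lin_ext expression_permute[OF lam] case_prod_unfold ..
  also have "\<dots> = ncls ?C' (push ?p (expression K n (Suc (n + r)) id (output_labels n r l J) (output_sign n r l J sgn_e) m xs))"
  proof (rule ncls_eqI, fold degenerate_tensors_def, rule cong_mod_push)
    show "cong_mod (degenerate_tensors n K)
        (lin_ext (\<lambda>(m, ys). expression K n (n + r) id J sgn_e m ys) ?ESA)
        (expression K n (Suc (n + r)) id (output_labels n r l J) (output_sign n r l J sgn_e) m xs)"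
      by (rule expression_ESA(2)[OF J S l sing assms(11)])
    show "?p zs \<in> degenerate_tensors n K" if "zs \<in> degenerate_tensors n K" for zs
      by (rule permute_factors_degenerate[OF lam that])
  qed
  finally show ?thesis
    unfolding expression_permute[OF lam] Suc_eq_plus1 .
qed

end
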